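(* Let $G=(V,E)$ be a directed graph with cemetery vertex $\delta$, $U=V\setminus\{\delta\}$ and base point $x_0\in U$, satisfying the standing assumptions of the context, and let $(\alpha_e)_{e\in E}$ be positive weights. Then for every directed spanning tree $T$ of $G$ and every $\lambda=(\lambda_e)\in\mathbb{C}^E$ with $\Re(\lambda_e)>0$ for all $e\in E$, the integrals below are well-defined and $$ C_\alpha\, \hat I^{(\alpha)}_{\Delta,\hat T}(\lambda)=\mathbb{E}^{(\alpha)}\left[e^{-\langle\lambda,z\rangle}\,\frac{\prod_{e\in T}p_e}{\det(I-P_U)}\right], $$ where $C_\alpha=\prod_{x\in U}\Gamma(\beta_x)\big/\prod_{e\in E}\Gamma(\alpha_e)$; on the left-hand side $\hat T=\{\hat e:\ e\in T\}\cup\{\hat e_x:\ x\in U\}$ is the directed spanning tree of the graph $\hat G$ associated with $T$; and on the right-hand side $z_e=G^p_U(x_0,\underline e)\,p_e$ is the expected number of crossings of the edge $e$ by the Markov chain on $G$ started at $x_0$ with transition probabilities $(p_e)$ and killed at $\delta$, and $\langle\lambda,z\rangle=\sum_{e\in E}\lambda_e z_e$.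
   Context: **Graph.** $G=(V,E)$ is a finite directed graph, $E\subset V\times V$, without loops (no edges $(x,x)$). For $e\in E$, $\underline e$ is its origin and $\overline e$ its destination, $e=(\underline e,\overline e)$. One has $V=U\sqcup\{\delta\}$ and a base point $x_0\in U$ such that: no edge has origin $\delta$; for every $x\in U$ there is a directed simple path from $x$ to $\delta$; for every $x\in U$ there is a directed simple path from $x_0$ to $x$. **Paths, cycles, trees.** A simple path from $x$ to $y$ ($x\ne y$) is a set of edges $\{e_1,\dots,e_k\}$ for which there are distinct vertices $x_0'=x,x_1',\dots,x_k'=y$ with $e_j=(x_{j-1}',x_j')$ or $e_j=(x_j',x_{j-1}')$ for each $j$; it is directed if $e_j=(x'_{j-1},x'_j)$ for all $j$. A (simple) cycle is a set of distinct edges $\{e_1,\dots,e_k\}$ ($k\ge 2$) for which there are distinct vertices $x_0',\dots,x_{k-1}'$ (with $x_k'=x_0'$) such that $e_j=(x'_{j-1},x'_j)$ or $e_j=(x'_j,x'_{j-1})$ for each $j$. A spanning tree is a subset $T\subset E$ containing no cycle and containing a simple path between any two vertices. It is directed (towards $\delta$) if for every $x\in U$ it contains a unique edge with origin $x$. (The same definitions are used for $\hat G$ below.) **Dirichlet environment.** Set $\tilde\Delta=\{(p_e)\in(0,1]^E:\ \sum_{e:\underline e=x}p_e=1\ \forall x\in U\}$. For positive weights $(\alpha_e)_{e\in E}$ let $\beta_x=\sum_{\underline e=x}\alpha_e$ for $x\in U$. $\mathbb{E}^{(\alpha)}$ is the expectation with respect to the probability on $\tilde\Delta$ with density $\frac{\prod_{x\in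 U}\Gamma(\beta_x)}{\prod_{e\in E}\Gamma(\alpha_e)}\prod_{e\in E}p_e^{\alpha_e-1}$ relative to $\prod_{e\in\tilde E}dp_e$, where $\tilde E$ is obtained from $E$ by removing, for each $x\in U$, one arbitrary edge with origin $x$ (i.e. independent Dirichlet laws with parameters $(\alpha_e)_{\underline e=x}$ at each $x\in U$). An environment $(p_e)$ defines a Markov chain on $V$ jumping along edge $e$ from $\underline e$ with probability $p_e$, started at $x_0$ and stopped at $\delta$. $P_U$ is its transition matrix restricted to $U\times U$, and $G^p_U(x,y)=(I-P_U)^{-1}_{x,y}$ is the Green function of the chain killed at $\delta$. **Affine space and domain.** For $\theta\in\mathbb{R}^E$ and $x\in U$, $\mathrm{div}(\theta)(x)=\sum_{\underline e=x}\theta_e-\sum_{\overline e=x}\theta_e$. Let $\mathcal{H}^{G,x_0}=\{z\in\mathbb{R}^E:\ \mathrm{div}(z)=\delta_{x_0}\}$ ($\delta_{x_0}$ is the Dirac mass at $x_0$), of dimension $|E|-|U|$, endowed with an arbitrary fixed orientation, and $\Delta=\{z\in\mathcal{H}^{G,x_0}:\ z_e>0\ \forall e\in E\}$. **The bipartite graph $\hat G$.** $\hat G=(\hat V,\hat E)$ has vertices $\hat V=\hat U\cup\{\delta\}$, $\hat U=\{-,+\}\times U$, with $x_-=(-,x)$, $x_+=(+,x)$. Its edges are: for each $e=(x,y)\in E$, the edge $\hat e=(x_+,y_-)$ if $y\ne\delta$ and $\hat e=(x_+,\delta)$ if $y=\delta$; and for each $x\in U$, the edge $\hat e_x=(x_-,x_+)$.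 The affine space $\{\hat z\in\mathbb{R}^{\hat E}:\ \mathrm{div}(\hat z)=\delta_{(-,x_0)}\}$ is identified with $\mathcal{H}^{G,x_0}$ via $z_{\hat e}=z_e$ ($e\in E$) and $z_{\hat e_x}=\sum_{\underline e=x}z_e$ ($x\in U$). Weights on $\hat E$: $\alpha_{\hat e}=\alpha_e$ for $e\in E$, and $\alpha_{\hat e_x}=-\beta_x$ for $x\in U$. **Hypergeometric integrals.** For a spanning tree $\hat T$ of $\hat G$, let $\omega_{\hat T}=\frac{dz_{e_1}}{z_{e_1}}\wedge\dots\wedge\frac{dz_{e_n}}{z_{e_n}}$, where $n=|E|-|U|$ and $\{e_1,\dots,e_n\}=\hat E\setminus\hat T$ is ordered so that $\omega_{\hat T}$ is positively oriented on $\Delta$. For $\lambda\in\mathbb{C}^E$ with $\Re(\lambda_e)>0$ for all $e \in E$ (extended by $0$ on the edges $\hat e_x$), set $$\hat I^{(\alpha)}_{\Delta,\hat T}(\lambda)=\int_\Delta e^{-\sum_{e\in E}\lambda_e z_e}\Big(\prod_{e\in\hat E}z_e^{\alpha_e}\Big)\,\omega_{\hat T}.$$ *)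

theory Defs
  imports "HOL-Analysis.Analysis"
begin

section \<open>Paths, cycles and trees\<close>

text \<open>Sets of edges over an arbitrary type of vertices; an edge is the pair (origin, destination).\<close>

definition simple_path :: "('v \<times> 'v) set \<Rightarrow> 'v \<Rightarrow> 'v \<Rightarrow> bool" where
  "simple_path S x y \<longleftrightarrow> x \<noteq> y \<and>
     (\<exists>vs es. distinct vs \<and> length vs = Suc (length es) \<and> hd vs = x \<and> last vs = y \<and> S = set es \<and>
        (\<forall>j<length es. es ! j = (vs ! j, vs ! Suc j) \<or> es ! j = (vs ! Suc j, vs ! j)))"

definition directed_simple_path :: "('v \<times> 'v) set \<Rightarrow> 'v \<Rightarrow> 'v \<Rightarrow> bool" where
  "directed_simple_path S x y \<longleftrightarrow> x \<noteq> y \<and>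
     (\<exists>vs es. distinct vs \<and> length vs = Suc (length es) \<and> hd vs = x \<and> last vs = y \<and> S = set es \<and>
        (\<forall>j<length es. es ! j = (vs ! j, vs ! Suc j)))"

text \<open>A pair of opposite edges \<open>(x, y)\<close>, \<open>(y, x)\<close> is a cycle (the case \<open>k = 2\<close>).\<close>

definition is_cycle :: "('v \<times> 'v) set \<Rightarrow> bool" where
  "is_cycle S \<longleftrightarrow>
     (\<exists>vs es. distinct vs \<and> distinct es \<and> length vs = length es \<and> 2 \<le> length es \<and> S = set es \<and>
        (\<forall>j<length es. es ! j = (vs ! j, vs ! (Suc j mod length es)) \<or>
                       es ! j = (vs ! (Suc j mod length es), vs ! j)))"

definition spanning_tree :: "('v \<times> 'v) set \<Rightarrow> ('v \<times> 'v) set \<Rightarrow> bool" where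
  "spanning_tree E T \<longleftrightarrow> T \<subseteq> E \<and> (\<nexists>C. C \<subseteq> T \<and> is_cycle C) \<and>
     (\<forall>x y. x \<noteq> y \<longrightarrow> (\<exists>S. S \<subseteq> T \<and> simple_path S x y))"

section \<open>Graphs with a cemetery vertex\<close>

text \<open>The vertex set is \<open>'u option\<close>: \<open>None\<close> is the cemetery \<open>\<delta>\<close> and \<open>U\<close> is the set of the
  vertices \<open>Some x\<close>, identified with the type \<open>'u\<close>.\<close>

type_synonym 'u edge = "'u option \<times> 'u option"

definition directed_spanning_tree :: "'u edge set \<Rightarrow> 'u edge set \<Rightarrow> bool" where
  "directed_spanning_tree E T \<longleftrightarrow>
     spanning_tree E T \<and> (\<forall>x. \<exists>!e. e \<in> T \<and> fst e = Some x)"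

text \<open>A simple path has distinct endpoints, so reachability from \<open>x0\<close> is required for \<open>x \<noteq> x0\<close>.\<close>

definition cemetery_graph :: "'u edge set \<Rightarrow> 'u \<Rightarrow> bool" where
  "cemetery_graph E x0 \<longleftrightarrow>
     (\<forall>v. (v, v) \<notin> E) \<and>
     (\<forall>v. (None, v) \<notin> E) \<and>
     (\<forall>x. \<exists>S. S \<subseteq> E \<and> directed_simple_path S (Some x) None) \<and>
     (\<forall>x. x \<noteq> x0 \<longrightarrow> (\<exists>S. S \<subseteq> E \<and> directed_simple_path S (Some x0) (Some x)))"

definition out_edges :: "'u edge set \<Rightarrow> 'u \<Rightarrow> 'u edge set" where
  "out_edges E x = {e \<in> E. fst e = Some x}"

definition in_edges :: "'u edge set \<Rightarrow> 'u \<Rightarrow> 'u edge set" where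
  "in_edges E x = {e \<in> E. snd e = Some x}"

definition beta :: "'u edge set \<Rightarrow> ('u edge \<Rightarrow> real) \<Rightarrow> 'u \<Rightarrow> real" where
  "beta E \<alpha> x = (\<Sum>e\<in>out_edges E x. \<alpha> e)"

definition C_const :: "'u::finite edge set \<Rightarrow> ('u edge \<Rightarrow> real) \<Rightarrow> real" where
  "C_const E \<alpha> = (\<Prod>x\<in>UNIV. Gamma (beta E \<alpha> x)) / (\<Prod>e\<in>E. Gamma (\<alpha> e))"

section \<open>The Dirichlet environment\<close>

definition environments :: "'u edge set \<Rightarrow> ('u edge \<Rightarrow> real) set" where
  "environments E = {p \<in> E \<rightarrow>\<^sub>E {0<..1}. \<forall>x. (\<Sum>e\<in>out_edges E x. p e) = 1}"

text \<open>\<open>r x\<close> is the edge with origin \<open>x\<close> that is left out of the coordinates; its weight is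
  recovered from the others.\<close>

definition complete_env ::
    "'u edge set \<Rightarrow> ('u \<Rightarrow> 'u edge) \<Rightarrow> ('u edge \<Rightarrow> real) \<Rightarrow> 'u edge \<Rightarrow> real" where
  "complete_env E r q = (\<lambda>e\<in>E. let x = the (fst e) in
     if e = r x then 1 - (\<Sum>e'\<in>out_edges E x - {r x}. q e') else q e)"

definition dirichlet_env ::
    "'u::finite edge set \<Rightarrow> ('u edge \<Rightarrow> real) \<Rightarrow> ('u \<Rightarrow> 'u edge) \<Rightarrow> ('u edge \<Rightarrow> real) measure" where
  "dirichlet_env E \<alpha> r =
     distr
       (density (PiM (E - range r) (\<lambda>_. lborel))
         (\<lambda>q. ennreal (indicator (environments E) (complete_env E r q) *
            (C_const E \<alpha> * (\<Prod>e\<in>E. complete_env E r q e powr (\<alpha> e - 1))))))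
       (PiM E (\<lambda>_. borel))
       (complete_env E r)"

definition P_U :: "'u::finite edge set \<Rightarrow> ('u edge \<Rightarrow> real) \<Rightarrow> real^'u^'u" where
  "P_U E p = (\<chi> x y. if (Some x, Some y) \<in> E then p (Some x, Some y) else 0)"

definition green :: "'u::finite edge set \<Rightarrow> ('u edge \<Rightarrow> real) \<Rightarrow> real^'u^'u" where
  "green E p = matrix_inv (mat 1 - P_U E p)"

definition crossings :: "'u::finite edge set \<Rightarrow> 'u \<Rightarrow> ('u edge \<Rightarrow> real) \<Rightarrow> 'u edge \<Rightarrow> real" where
  "crossings E x0 p e = green E p $ x0 $ the (fst e) * p e"

section \<open>The affine space and its domain\<close>

text \<open>The space of real functions on \<open>E\<close> is realised as the vectors indexed by all pairs of
  vertices that vanish outside \<open>E\<close>.\<close>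

definition divergence :: "'u::finite edge set \<Rightarrow> real^'u edge \<Rightarrow> 'u \<Rightarrow> real" where
  "divergence E z x = (\<Sum>e\<in>out_edges E x. z $ e) - (\<Sum>e\<in>in_edges E x. z $ e)"

definition flow_space :: "'u::finite edge set \<Rightarrow> 'u \<Rightarrow> (real^'u edge) set" where
  "flow_space E x0 = {z. (\<forall>e. e \<notin> E \<longrightarrow> z $ e = 0) \<and>
     (\<forall>x. divergence E z x = (if x = x0 then 1 else 0))}"

definition flow_domain :: "'u::finite edge set \<Rightarrow> 'u \<Rightarrow> (real^'u edge) set" where
  "flow_domain E x0 = {z \<in> flow_space E x0. \<forall>e\<in>E. 0 < z $ e}"

definition flow_dim :: "'u::finite edge set \<Rightarrow> nat" where
  "flow_dim E = card E - CARD('u)"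

text \<open>An affine frame of the flow space: an origin \<open>a\<close> and direction vectors
  \<open>v 0, \<dots>, v (n - 1)\<close>. The orientation is the one given by the ordered direction vectors.\<close>

definition frame_map :: "nat \<Rightarrow> real^'e::finite \<Rightarrow> (nat \<Rightarrow> real^'e) \<Rightarrow> (nat \<Rightarrow> real) \<Rightarrow> real^'e" where
  "frame_map n a v t = a + (\<Sum>j<n. t j *\<^sub>R v j)"

definition affine_frame ::
    "'u::finite edge set \<Rightarrow> 'u \<Rightarrow> real^'u edge \<Rightarrow> (nat \<Rightarrow> real^'u edge) \<Rightarrow> bool" where
  "affine_frame E x0 a v \<longleftrightarrow>
     bij_betw (frame_map (flow_dim E) a v) ({..<flow_dim E} \<rightarrow>\<^sub>E UNIV) (flow_space E x0)"

section \<open>The bipartite graph\<close>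

datatype side = Minus | Plus

type_synonym 'u hat_edge = "(side \<times> 'u) edge"

fun hat_edge :: "'u edge \<Rightarrow> 'u hat_edge" where
  "hat_edge (v, w) = (map_option (Pair Plus) v, map_option (Pair Minus) w)"

definition hat_vertex_edge :: "'u \<Rightarrow> 'u hat_edge" where
  "hat_vertex_edge x = (Some (Minus, x), Some (Plus, x))"

definition hat_lift :: "'u edge set \<Rightarrow> 'u hat_edge set" where
  "hat_lift S = hat_edge ` S \<union> range hat_vertex_edge"

text \<open>The function on the edges of the bipartite graph with value \<open>f e\<close> on \<open>hat_edge e\<close> and
  \<open>g x\<close> on \<open>hat_vertex_edge x\<close>.\<close>

definition hat_ext :: "('u edge \<Rightarrow> real) \<Rightarrow> ('u \<Rightarrow> real) \<Rightarrow> 'u hat_edge \<Rightarrow> real" where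
  "hat_ext f g e = (case fst e of
       Some (Minus, x) \<Rightarrow> g x
     | _ \<Rightarrow> f (map_option snd (fst e), map_option snd (snd e)))"

lemma hat_ext_hat_edge [simp]: "hat_ext f g (hat_edge e) = f e"
  by (cases e) (auto simp: hat_ext_def option.map_comp o_def option.map_ident split: option.split)

lemma hat_ext_hat_vertex_edge [simp]: "hat_ext f g (hat_vertex_edge x) = g x"
  by (simp add: hat_ext_def hat_vertex_edge_def)

definition hat_coord :: "'u::finite edge set \<Rightarrow> real^'u edge \<Rightarrow> 'u hat_edge \<Rightarrow> real" where
  "hat_coord E z = hat_ext (\<lambda>e. z $ e) (\<lambda>x. \<Sum>e\<in>out_edges E x. z $ e)"

definition hat_weight :: "'u edge set \<Rightarrow> ('u edge \<Rightarrow> real) \<Rightarrow> 'u hat_edge \<Rightarrow> real" where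
  "hat_weight E \<alpha> = hat_ext \<alpha> (\<lambda>x. - beta E \<alpha> x)"

section \<open>Hypergeometric integrals\<close>

text \<open>Value of the \<open>n\<close>-form \<open>\<phi> 0 \<and> \<dots> \<and> \<phi> (n - 1)\<close> at the vectors \<open>v 0, \<dots>, v (n - 1)\<close>.\<close>

definition wedge :: "nat \<Rightarrow> (nat \<Rightarrow> 'a \<Rightarrow> real) \<Rightarrow> (nat \<Rightarrow> 'a) \<Rightarrow> real" where
  "wedge n \<phi> v = (\<Sum>\<pi> | \<pi> permutes {..<n}. of_int (sign \<pi>) * (\<Prod>i<n. \<phi> i (v (\<pi> i))))"

text \<open>The form \<open>dz\<^sub>e / z\<^sub>e \<and> \<dots>\<close>, over the edges \<open>e\<close> of the list \<open>es\<close> in this order, at the point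
  \<open>z\<close>. As \<open>hat_coord E\<close> is linear, \<open>dz\<^sub>e\<close> maps a direction vector \<open>w\<close> to \<open>hat_coord E w e\<close>.\<close>

definition log_form ::
    "'u::finite edge set \<Rightarrow> 'u hat_edge list \<Rightarrow> real^'u edge \<Rightarrow> (nat \<Rightarrow> real^'u edge) \<Rightarrow> real" where
  "log_form E es z = wedge (length es) (\<lambda>i w. hat_coord E w (es ! i) / hat_coord E z (es ! i))"

definition positively_oriented ::
    "'u::finite edge set \<Rightarrow> 'u \<Rightarrow> (nat \<Rightarrow> real^'u edge) \<Rightarrow> 'u hat_edge list \<Rightarrow> bool" where
  "positively_oriented E x0 v es \<longleftrightarrow> (\<forall>z\<in>flow_domain E x0. 0 < log_form E es z v)"

definition negatively_oriented ::
    "'u::finite edge set \<Rightarrow> 'u \<Rightarrow> (nat \<Rightarrow> real^'u edge) \<Rightarrow> 'u hat_edge list \<Rightarrow> bool" where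
  "negatively_oriented E x0 v es \<longleftrightarrow> (\<forall>z\<in>flow_domain E x0. log_form E es z v < 0)"

text \<open>The integral of the \<open>n\<close>-form over the oriented domain is computed in the affine chart
  \<open>t \<mapsto> frame_map n a v t\<close>, whose partial derivatives are the vectors \<open>v j\<close>.\<close>

definition chart_domain ::
    "'u::finite edge set \<Rightarrow> 'u \<Rightarrow> real^'u edge \<Rightarrow> (nat \<Rightarrow> real^'u edge) \<Rightarrow> (nat \<Rightarrow> real) set" where
  "chart_domain E x0 a v =
     {t \<in> {..<flow_dim E} \<rightarrow>\<^sub>E UNIV. frame_map (flow_dim E) a v t \<in> flow_domain E x0}"

definition hyp_integrand ::
    "'u::finite edge set \<Rightarrow> ('u edge \<Rightarrow> real) \<Rightarrow> ('u edge \<Rightarrow> complex) \<Rightarrow> (nat \<Rightarrow> real^'u edge)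
      \<Rightarrow> 'u hat_edge list \<Rightarrow> real^'u edge \<Rightarrow> complex" where
  "hyp_integrand E \<alpha> l v es z =
     exp (- (\<Sum>e\<in>E. l e * complex_of_real (z $ e))) *
     complex_of_real ((\<Prod>e\<in>hat_lift E. hat_coord E z e powr hat_weight E \<alpha> e) * log_form E es z v)"

definition hyp_integrable ::
    "'u::finite edge set \<Rightarrow> 'u \<Rightarrow> ('u edge \<Rightarrow> real) \<Rightarrow> ('u edge \<Rightarrow> complex)
      \<Rightarrow> real^'u edge \<Rightarrow> (nat \<Rightarrow> real^'u edge) \<Rightarrow> 'u hat_edge list \<Rightarrow> bool" where
  "hyp_integrable E x0 \<alpha> l a v es \<longleftrightarrow>
     set_integrable (PiM {..<flow_dim E} (\<lambda>_. lborel)) (chart_domain E x0 a v)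
       (\<lambda>t. hyp_integrand E \<alpha> l v es (frame_map (flow_dim E) a v t))"

definition hyp_integral ::
    "'u::finite edge set \<Rightarrow> 'u \<Rightarrow> ('u edge \<Rightarrow> real) \<Rightarrow> ('u edge \<Rightarrow> complex)
      \<Rightarrow> real^'u edge \<Rightarrow> (nat \<Rightarrow> real^'u edge) \<Rightarrow> 'u hat_edge list \<Rightarrow> complex" where
  "hyp_integral E x0 \<alpha> l a v es =
     set_lebesgue_integral (PiM {..<flow_dim E} (\<lambda>_. lborel)) (chart_domain E x0 a v)
       (\<lambda>t. hyp_integrand E \<alpha> l v es (frame_map (flow_dim E) a v t))"

definition env_functional ::
    "'u::finite edge set \<Rightarrow> 'u \<Rightarrow> 'u edge set \<Rightarrow> ('u edge \<Rightarrow> complex) \<Rightarrow> ('u edge \<Rightarrow> real) \<Rightarrow> complex" where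
  "env_functional E x0 T l p =
     exp (- (\<Sum>e\<in>E. l e * complex_of_real (crossings E x0 p e))) *
     complex_of_real ((\<Prod>e\<in>T. p e) / det (mat 1 - P_U E p))"

end

theory Submission
  imports Defs
begin

text \<open>The map \<open>z \<mapsto> p\<close>, \<open>p\<^sub>e = z\<^sub>e / Z\<^sub>x\<close> with \<open>Z\<^sub>x\<close> the total flow out of the origin \<open>x\<close> of \<open>e\<close>, is a bijection
  from the flow domain onto the environments; its inverse sends \<open>p\<close> to the expected crossing numbers.
  Parametrising both sides by the edges outside \<open>T\<close>, elimination of the tree coordinates and the
  identity \<open>det (I - A C) = det (I - C A)\<close> give the Jacobian \<open>det (I - P\<^sub>U) / \<Prod>\<^sub>e\<^sub>\<notin>\<^sub>T Z\<close>. The change of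
  variables therefore turns the Dirichlet density into \<open>\<Prod>\<^sub>e p\<^sub>e\<^bsup>\<alpha>\<^sub>e\<^esup>\<close> times the logarithmic form times
  \<open>det (I - P\<^sub>U) / \<Prod>\<^sub>e\<^sub>\<in>\<^sub>T p\<^sub>e\<close>, and the last factor cancels against the integrand. Integrability holds since
  \<open>\<Prod>\<^sub>e\<^sub>\<in>\<^sub>T p\<^sub>e \<le> det (I - P\<^sub>U)\<close>.\<close>

section \<open>Directed spanning trees and depth functions\<close>

text \<open>A directed tree is handled as the graph of a successor map \<open>s\<close> with a depth
  that drops along \<open>s\<close>. This certificate yields acyclicity, makes I - P unitriangular
  for the indicator of the tree, and shows that the chain can leave every nonempty set of vertices,
  which gives the positivity of the flow.

  The tree selects the coordinates on both sides. The edges outside the lifted tree are the lifts of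
  the edges outside T, so the form contains no vertex edge; and the Dirichlet law does not depend on
  which edge is omitted at each vertex, so the tree edges can be omitted there too. Then dp_e =
  (dz_e - p_e dZ_x) / Z_x, and the subtracted term is what produces det (I - P).

  The frame of the flow space is arbitrary, but it enters only through the constant
  \<open>orient\<close>, the value of the wedge of the dz_e on it. This is nonzero, its sign is the
  orientation, and it is a factor of the Jacobian as well as of the form.

  Matrices and Lebesgue measure live on vectors indexed by a type, while n depends on E. Both are
  therefore padded: by identity rows in determinants, by unit intervals in integrals.\<close>

definition functional_edges :: "('w \<Rightarrow> 'w option) \<Rightarrow> 'w edge set" where
  "functional_edges s = range (\<lambda>x. (Some x, s x))"

lemma functional_edges_iff: "e \<in> functional_edges s \<longleftrightarrow> (\<exists>x. e = (Some x, s x))"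
  by (auto simp: functional_edges_def)

text \<open>A certificate that following \<open>s\<close> ends at the cemetery. Only the strict
  decrease matters, so \<open>d\<close> need not be the distance in the tree; the lifted tree uses
  this freedom.\<close>

definition is_depth :: "('w \<Rightarrow> 'w option) \<Rightarrow> ('w option \<Rightarrow> nat) \<Rightarrow> bool" where
  "is_depth s d \<longleftrightarrow> d None = 0 \<and> (\<forall>x. d (s x) < d (Some x))"

text \<open>A vertex of maximal depth on a cycle must be the origin of both its cycle edges. It has
  only one outgoing edge, so the two edges would coincide.\<close>

lemma functional_edges_acyclic:
  assumes "is_depth s d" "C \<subseteq> functional_edges s"
  shows "\<not> is_cycle C"
proof
  assume "is_cycle C"
  then obtain vs es where vs: "distinct vs" "distinct es" "length vs = length es" "2 \<le> length es"
    "C = set es" and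
    e: "\<forall>j<length es. es ! j = (vs ! j, vs ! (Suc j mod length es)) \<or>
                       es ! j = (vs ! (Suc j mod length es), vs ! j)"
    unfolding is_cycle_def by blast
  let ?k = "length es"
  have ne: "set vs \<noteq> {}" using vs(3,4) by auto
  then have "Max (d ` set vs) \<in> d ` set vs" by (intro Max_in) auto
  then obtain v where "v \<in> set vs" "d v = Max (d ` set vs)" by auto
  then have v: "v \<in> set vs" "\<And>w. w \<in> set vs \<Longrightarrow> d w \<le> d v"
    by auto
  then obtain j where j: "j < ?k" "v = vs ! j" using vs by (metis in_set_conv_nth)
  \<comment> \<open>The index of the edge that precedes the j-th one cyclically, so that edges i and
    j meet at \<open>v\<close>.\<close>
  define i where "i = (if j = 0 then ?k - 1 else j - 1)"
  have i: "i < ?k" "Suc i mod ?k = j" "i \<noteq> j"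
    using vs(4) j(1) unfolding i_def by (cases j; simp)+
  have "0 < ?k" using vs(4) by linarith
  then have "Suc j mod ?k < length vs" "i < length vs"
    using vs(3) i(1) by simp_all
  then have "vs ! (Suc j mod ?k) \<in> set vs" "vs ! i \<in> set vs"
    by (simp_all only: nth_mem)
  then have le: "d (vs ! (Suc j mod ?k)) \<le> d v" "d (vs ! i) \<le> d v" using v by auto
  have dec: "d b < d a" if "(a, b) \<in> C" for a b
    using that assms by (auto simp: functional_edges_def is_depth_def)
  have mem: "es ! j \<in> C" "es ! i \<in> C" using vs i j by auto
  have "es ! j = (v, vs ! (Suc j mod ?k))"
    using e j dec le mem by (metis leD)
  moreover have "es ! i = (v, vs ! i)"
    using e i j dec le mem by (metis leD)
  moreover have "es ! j \<in> functional_edges s" "es ! i \<in> functional_edges s"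
    using mem assms(2) by auto
  ultimately have "es ! i = es ! j"
    by (auto simp: functional_edges_iff)
  then show False using vs i j nth_eq_iff_index_eq by blast
qed

text \<open>Induction on the sum of the depths: the deeper endpoint is replaced by its successor.
  The last conjunct strengthens the induction; it keeps the replaced endpoint off the shorter path,
  so the vertices stay distinct.\<close>

lemma functional_edges_path:
  assumes "is_depth s d"
  shows "\<exists>vs es. distinct vs \<and> length vs = Suc (length es) \<and> hd vs = x \<and> last vs = y \<and>
    set es \<subseteq> functional_edges s \<and>
    (\<forall>j<length es. es ! j = (vs ! j, vs ! Suc j) \<or> es ! j = (vs ! Suc j, vs ! j)) \<and>
    (\<forall>v\<in>set vs. v = x \<or> v = y \<or> d v < max (d x) (d y))"
proof (induction "d x + d y" arbitrary: x y rule: less_induct)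
  case less
  have d0: "d None = 0" and dec: "\<And>x. d (s x) < d (Some x)"
    using assms by (auto simp: is_depth_def)
  consider "x = y" | "x \<noteq> y" "d y \<le> d x" | "d x < d y" by linarith
  then show ?case
  proof cases
    case 1
    then show ?thesis by (intro exI[of _ "[x]"] exI[of _ "[]"]) auto
  next
    case 2
    then obtain a where a: "x = Some a"
      using d0 dec by (metis le_zero_eq not_less_zero option.exhaust)
    have "d (s a) + d y < d x + d y" using dec[of a] a by auto
    from less[OF this] obtain vs es where p: "distinct vs" "length vs = Suc (length es)"
      "hd vs = s a" "last vs = y" "set es \<subseteq> functional_edges s"
      "\<And>j. j<length es \<Longrightarrow> es ! j = (vs ! j, vs ! Suc j) \<or> es ! j = (vs ! Suc j, vs ! j)"
      "\<And>v. v\<in>set vs \<Longrightarrow> v = s a \<or> v = y \<or> d v < max (d (s a)) (d y)"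
      by blast
    have ne: "vs \<noteq> []" using p(2) by auto
    have lt: "\<And>v. v\<in>set vs \<Longrightarrow> v = y \<or> d v < d x"
      using p(7) 2 dec[of a] a by fastforce
    then have nx: "x \<notin> set vs" using 2 by auto
    have "(x # vs) ! j = fst (((x, s a) # es) ! j) \<and> (x # vs) ! Suc j = snd (((x, s a) # es) ! j) \<or>
      (x # vs) ! j = snd (((x, s a) # es) ! j) \<and> (x # vs) ! Suc j = fst (((x, s a) # es) ! j)"
      if "j < Suc (length es)" for j
      using that p(6)[of "j - 1"] p(3) ne by (cases j) (auto simp: hd_conv_nth)
    then have edges: "\<forall>j<length ((x, s a) # es). ((x, s a) # es) ! j = ((x # vs) ! j, (x # vs) ! Suc j)
       \<or> ((x, s a) # es) ! j = ((x # vs) ! Suc j, (x # vs) ! j)"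
      by (metis length_Cons prod.collapse)
    show ?thesis
      by (intro exI[of _ "x # vs"] exI[of _ "(x, s a) # es"] conjI edges)
        (use p ne nx lt 2 a in \<open>auto simp: functional_edges_iff less_max_iff_disj\<close>)
  next
    case 3
    then obtain a where a: "y = Some a"
      using d0 by (metis not_less_zero option.exhaust)
    have "d x + d (s a) < d x + d y" using dec[of a] a by auto
    from less[OF this] obtain vs es where p: "distinct vs" "length vs = Suc (length es)"
      "hd vs = x" "last vs = s a" "set es \<subseteq> functional_edges s"
      "\<And>j. j<length es \<Longrightarrow> es ! j = (vs ! j, vs ! Suc j) \<or> es ! j = (vs ! Suc j, vs ! j)"
      "\<And>v. v\<in>set vs \<Longrightarrow> v = x \<or> v = s a \<or> d v < max (d x) (d (s a))"
      by blast
    have ne: "vs \<noteq> []" using p(2) by auto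
    have lt: "\<And>v. v\<in>set vs \<Longrightarrow> d v < d y"
      using p(7) 3 dec[of a] a by fastforce
    then have nx: "y \<notin> set vs" by auto
    have lst: "vs ! length es = s a" using p(2,4) ne by (simp add: last_conv_nth)
    have edges: "\<forall>j<length (es @ [(y, s a)]). (es @ [(y, s a)]) ! j = ((vs @ [y]) ! j, (vs @ [y]) ! Suc j)
       \<or> (es @ [(y, s a)]) ! j = ((vs @ [y]) ! Suc j, (vs @ [y]) ! j)"
    proof (intro allI impI)
      fix j assume "j < length (es @ [(y, s a)])"
      then consider "j < length es" | "j = length es" by fastforce
      then show "(es @ [(y, s a)]) ! j = ((vs @ [y]) ! j, (vs @ [y]) ! Suc j)
       \<or> (es @ [(y, s a)]) ! j = ((vs @ [y]) ! Suc j, (vs @ [y]) ! j)"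
        using p(2,6) lst by cases (auto simp: nth_append)
    qed
    show ?thesis
      by (intro exI[of _ "vs @ [y]"] exI[of _ "es @ [(y, s a)]"] conjI edges)
        (use p ne nx lt 3 a in \<open>auto simp: functional_edges_iff less_max_iff_disj\<close>)
  qed
qed

lemma directed_spanning_tree_functional_edges:
  assumes "is_depth s d" "functional_edges s \<subseteq> E"
  shows "directed_spanning_tree E (functional_edges s)"
proof -
  have "\<exists>S. S \<subseteq> functional_edges s \<and> simple_path S x y" if "x \<noteq> y" for x y
    using functional_edges_path[OF assms(1), of x y] that unfolding simple_path_def by blast
  moreover have "\<exists>!e. e \<in> functional_edges s \<and> fst e = Some x" for x
    by (auto simp: functional_edges_def)
  ultimately show ?thesis
    unfolding directed_spanning_tree_def spanning_tree_def
    using functional_edges_acyclic[OF assms(1)] assms(2) by blast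
qed

text \<open>The depth is the number of steps to the cemetery. An orbit that never arrived would
  return to a vertex by finiteness, and a shortest return is a cycle inside
  \<open>T\<close>.\<close>

lemma directed_spanning_tree_functional:
  fixes E :: "('w::finite) edge set"
  assumes "directed_spanning_tree E T" "\<And>v. (None, v) \<notin> E" "\<And>v. (v, v) \<notin> E"
  obtains s d where "T = functional_edges s" "is_depth s d"
proof -
  have TE: "T \<subseteq> E" and acyc: "\<And>C. C \<subseteq> T \<Longrightarrow> \<not> is_cycle C"
    and uniq: "\<And>x. \<exists>!e. e \<in> T \<and> fst e = Some x"
    using assms(1) by (auto simp: directed_spanning_tree_def spanning_tree_def)
  have "\<exists>y. (Some x, y) \<in> T" for x
  proof -
    obtain e where "e \<in> T" "fst e = Some x" using uniq by blast
    then have "(Some x, snd e) \<in> T" by (cases e) auto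
    then show ?thesis ..
  qed
  then obtain s where s: "\<And>x. (Some x, s x) \<in> T" by metis
  have uniq': "e = e'" if "e \<in> T" "fst e = Some x" "e' \<in> T" "fst e' = Some x" for e e' x
    using uniq[of x] that by blast
  have T: "T = functional_edges s"
  proof (intro set_eqI iffI)
    fix e assume e: "e \<in> T"
    have "fst e \<noteq> None"
    proof
      assume "fst e = None"
      then have "(None, snd e) \<in> E" using e TE by (metis prod.collapse subsetD)
      then show False using assms(2) by blast
    qed
    then obtain x where "fst e = Some x" by auto
    then have "e = (Some x, s x)" using uniq'[OF e _ s[of x]] by simp
    then show "e \<in> functional_edges s" by (auto simp: functional_edges_iff)
  next
    fix e assume "e \<in> functional_edges s"
    then show "e \<in> T" using s by (auto simp: functional_edges_iff)
  qed
  define g where "g v = (case v of None \<Rightarrow> None | Some x \<Rightarrow> s x)" for v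
  have reach: "\<exists>k. (g ^^ k) v = None" for v
  proof (rule ccontr)
    assume never: "\<nexists>k. (g ^^ k) v = None"
    define a where "a k = (g ^^ k) v" for k
    have edge: "(a k, a (Suc k)) \<in> T" for k
    proof -
      obtain x where "a k = Some x" using never by (auto simp: a_def)
      then show ?thesis using s[of x] by (simp add: a_def g_def)
    qed
    have "\<not> inj a" using finite_imageD[of a UNIV] by (metis finite infinite_UNIV_nat)
    then obtain i j where "i < j" "a i = a j"
      by (metis injI linorder_neqE_nat)
    then have ex: "\<exists>m>0. \<exists>i. a (i + m) = a i" by (metis less_imp_add_positive)
    \<comment> \<open>Minimal over all starting points at once: an equality between two of the m
      vertices would be a shorter return from another start.\<close>
    define m where "m = (LEAST m. m > 0 \<and> (\<exists>i. a (i + m) = a i))"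
    have "m > 0 \<and> (\<exists>i. a (i + m) = a i)" unfolding m_def by (rule LeastI_ex[OF ex])
    then obtain i where m: "m > 0" "a (i + m) = a i" by blast
    have least: "\<not> (\<exists>i. a (i + k) = a i)" if "0 < k" "k < m" for k
      using not_less_Least[of k "\<lambda>m. m > 0 \<and> (\<exists>i. a (i + m) = a i)"] that by (auto simp: m_def)
    have inj: "inj_on (\<lambda>k. a (i + k)) {..<m}"
    proof (rule linorder_inj_onI)
      fix x y assume "x < y" "x \<in> {..<m}" "y \<in> {..<m}"
      then show "a (i + x) \<noteq> a (i + y)" using least[of "y - x"]
        by (metis add.assoc le_add_diff_inverse less_imp_diff_less less_imp_le lessThan_iff zero_less_diff)
    qed auto
    \<comment> \<open>A return after one step would be a loop, and a cycle needs at least two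
      edges.\<close>
    have "m \<noteq> 1" using edge[of i] m TE assms(3) by auto
    then have m2: "m \<ge> 2" using m by auto
    let ?vs = "map (\<lambda>k. a (i + k)) [0..<m]"
    let ?es = "map (\<lambda>k. (a (i + k), a (Suc (i + k)))) [0..<m]"
    have "is_cycle (set ?es)"
      unfolding is_cycle_def
    proof (intro exI[of _ ?vs] exI[of _ ?es] conjI allI impI)
      show "distinct ?vs" using inj by (simp add: distinct_map atLeast0LessThan)
      show "distinct ?es" using inj by (auto simp: distinct_map atLeast0LessThan inj_on_def)
      fix j assume "j < length ?es"
      then have j: "j < m" by simp
      have "a (Suc (i + j)) = a (i + Suc j mod m)"
        using j m by (cases "Suc j = m") auto
      then show "?es ! j = (?vs ! j, ?vs ! (Suc j mod length ?es)) \<or>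
         ?es ! j = (?vs ! (Suc j mod length ?es), ?vs ! j)"
        using j m by simp
    qed (use m2 in auto)
    then show False using acyc[of "set ?es"] edge by auto
  qed
  define d where "d v = (LEAST k. (g ^^ k) v = None)" for v
  have "is_depth s d"
    unfolding is_depth_def
  proof (intro conjI allI)
    show "d None = 0" by (simp add: d_def)
    fix x
    have "d (Some x) = Suc (LEAST k. (g ^^ Suc k) (Some x) = None)"
      unfolding d_def using reach[of "Some x"] by (elim exE) (rule Least_Suc, auto)
    also have "(LEAST k. (g ^^ Suc k) (Some x) = None) = d (s x)"
      unfolding d_def by (subst funpow_Suc_right) (simp add: g_def)
    finally show "d (s x) < d (Some x)" by simp
  qed
  with T show ?thesis using that by blast
qed

section \<open>Lifting the tree to the bipartite graph\<close>

lemma hat_lift_functional_edges: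
  "hat_lift (functional_edges s) =
     functional_edges (\<lambda>(i, x). case i of Minus \<Rightarrow> Some (Plus, x) | Plus \<Rightarrow> map_option (Pair Minus) (s x))"
proof -
  have side: "(\<exists>i. P i) \<longleftrightarrow> P Plus \<or> P Minus" for P by (metis side.exhaust)
  show ?thesis
    by (rule set_eqI)
      (simp add: hat_lift_def functional_edges_def hat_vertex_edge_def image_iff side)
qed

lemma directed_spanning_tree_hat_lift:
  assumes "is_depth s d" "functional_edges s \<subseteq> E"
  shows "directed_spanning_tree (hat_lift E) (hat_lift (functional_edges s))"
proof -
  \<comment> \<open>One step of \<open>s\<close> becomes two steps of the lifted successor map, so
    depths are doubled and the odd values are left for the vertices x_-.\<close>
  define d' where "d' v = (case v of None \<Rightarrow> 0 | Some (Plus, x) \<Rightarrow> 2 * d (Some x)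
    | Some (Minus, x) \<Rightarrow> 2 * d (Some x) + 1)" for v
  have lt: "d (s x) < d (Some x)" for x using assms by (auto simp: is_depth_def)
  have "d' (map_option (Pair Minus) (s x)) < 2 * d (Some x)" for x
    using lt[of x] by (cases "s x") (auto simp: d'_def)
  then have "is_depth (\<lambda>(i, x). case i of Minus \<Rightarrow> Some (Plus, x) | Plus \<Rightarrow> map_option (Pair Minus) (s x)) d'"
    by (auto simp: is_depth_def d'_def split: side.splits)
  moreover have "hat_lift (functional_edges s) \<subseteq> hat_lift E"
    using assms(2) by (auto simp: hat_lift_def)
  ultimately show ?thesis
    unfolding hat_lift_functional_edges by (intro directed_spanning_tree_functional_edges)
qed

section \<open>Determinants\<close>

text \<open>A permutation that moves an index outside \<open>h\<close> S\<open>picks a zero entry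
  from an identity row; the remaining ones are transported from\<close>h \<open>S\<close> to
  \<open>S\<close>. This turns Leibniz sums over an arbitrary index set into determinants over a
  type, where matrix algebra applies.\<close>

lemma det_leibniz_embed:
  fixes A :: "'a::comm_ring_1^'n::finite^'n"
  assumes inj: "inj_on h S" and id: "\<And>i j. i \<notin> h ` S \<Longrightarrow> A $ i $ j = (if i = j then 1 else 0)"
  shows "det A = (\<Sum>\<pi> | \<pi> permutes S. of_int (sign \<pi>) * (\<Prod>i\<in>S. A $ h i $ h (\<pi> i)))"
proof -
  have fin: "finite S" using finite_imageD[OF _ inj] by simp
  have perm: "p permutes h ` S" if "p permutes UNIV" "\<forall>i. i \<notin> h ` S \<longrightarrow> p i = i" for p
    using that by (simp add: permutes_def)
  have "det A = (\<Sum>p | p permutes h ` S. of_int (sign p) * (\<Prod>i\<in>UNIV. A $ i $ p i))"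
    unfolding det_def
  proof (rule sum.mono_neutral_right)
    show "\<forall>p\<in>{p. p permutes UNIV} - {p. p permutes h ` S}. of_int (sign p) * (\<Prod>i\<in>UNIV. A $ i $ p i) = 0"
    proof
      fix p assume "p \<in> {p. p permutes UNIV} - {p. p permutes h ` S}"
      then obtain i where "i \<notin> h ` S" "p i \<noteq> i" using perm by blast
      then have "A $ i $ p i = 0" using id by auto
      then show "of_int (sign p) * (\<Prod>i\<in>UNIV. A $ i $ p i) = 0"
        by (metis UNIV_I finite mult_zero_right prod_zero)
    qed
  qed (auto intro: permutes_subset)
  also have "\<dots> = (\<Sum>p | p permutes h ` S. of_int (sign p) * (\<Prod>i\<in>h ` S. A $ i $ p i))"
  proof (intro sum.cong refl arg_cong2[of _ _ _ _ "(*)"])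
    fix p assume "p \<in> {p. p permutes h ` S}"
    then show "(\<Prod>i\<in>UNIV. A $ i $ p i) = (\<Prod>i\<in>h ` S. A $ i $ p i)"
      by (intro prod.mono_neutral_right) (auto simp: permutes_not_in id)
  qed
  also have "\<dots> = (\<Sum>\<pi> | \<pi> permutes S. of_int (sign \<pi>) * (\<Prod>i\<in>S. A $ h i $ h (\<pi> i)))"
  proof (rule sum.reindex_bij_witness[of _ "map_permutation S h" "map_permutation (h ` S) (inv_into S h)"])
    have bij: "bij_betw h S (h ` S)" using inj by (simp add: bij_betw_def)
    have bij': "bij_betw (inv_into S h) (h ` S) S" using bij by (rule bij_betw_inv_into)
    fix p assume "p \<in> {p. p permutes h ` S}"
    then have p: "p permutes h ` S" by simp
    show q: "map_permutation (h ` S) (inv_into S h) p \<in> {\<pi>. \<pi> permutes S}"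
      using map_permutation_permutes[OF bij' p] by simp
    show eq: "map_permutation S h (map_permutation (h ` S) (inv_into S h) p) = p"
      by (rule map_permutation_compose_inv[OF bij' p]) (auto simp: f_inv_into_f)
    let ?q = "map_permutation (h ` S) (inv_into S h) p"
    have ap: "p (h i) = h (?q i)" if "i \<in> S" for i
      using map_permutation_apply[OF inj that, of ?q] eq by simp
    have "sign ?q = sign p"
      by (rule sign_map_permutation) (use p inj fin in \<open>auto intro: inj_on_inv_into\<close>)
    then show "of_int (sign ?q) * (\<Prod>i\<in>S. A $ h i $ h (?q i)) = of_int (sign p) * (\<Prod>i\<in>h ` S. A $ i $ p i)"
      using ap by (simp add: prod.reindex[OF inj])
  next
    fix q assume "q \<in> {\<pi>. \<pi> permutes S}"
    then have q: "q permutes S" by simp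
    have bij: "bij_betw h S (h ` S)" using inj by (simp add: bij_betw_def)
    show "map_permutation S h q \<in> {p. p permutes h ` S}"
      using map_permutation_permutes[OF bij q] by simp
    show "map_permutation (h ` S) (inv_into S h) (map_permutation S h q) = q"
      by (rule map_permutation_compose_inv[OF bij q]) (auto simp: inv_into_f_f[OF inj])
  qed
  finally show ?thesis .
qed

lemma matrix_mult_distribs:
  fixes A :: "real^'n::finite^'m::finite" and C :: "real^'k::finite^'n"
  shows "(A + B) ** C = A ** C + B ** C" and "A ** (C + D) = A ** C + A ** D"
    and "(A - B) ** C = A ** C - B ** C" and "A ** (C - D) = A ** C - A ** D"
  by (simp_all add: matrix_matrix_mult_def vec_eq_iff sum_subtractf sum.distrib algebra_simps)

text \<open>Both sides differ from \<open>1 + A + B\<close> by the same two determinants: \<open>A\<^sup>2 = 0\<close> and \<open>B\<^sup>2 = 0\<close> give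
  \<open>(1 - A) (1 + A + B) (1 - B) = 1 - A B\<close> and \<open>(1 - B) (1 + A + B) (1 - A) = 1 - B A\<close>.\<close>

lemma det_one_minus_mult_commute:
  fixes A B :: "real^'n::finite^'n"
  assumes "A ** A = 0" "B ** B = 0"
  shows "det (mat 1 - A ** B) = det (mat 1 - B ** A)"
proof -
  have zero: "0 ** X = 0" "X ** 0 = 0" for X :: "real^'n^'n"
    by (simp_all add: matrix_matrix_mult_def vec_eq_iff)
  have fac: "(mat 1 - A) ** (mat 1 + A + B) ** (mat 1 - B) = mat 1 - A ** B"
    if "A ** A = 0" "B ** B = 0" for A B :: "real^'n^'n"
  proof -
    have "B ** (A ** B) = B ** A ** B" "A ** (B ** B) = A ** B ** B" 
      by (simp_all add: matrix_mul_assoc)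
    then show ?thesis
      using that by (simp add: matrix_mult_distribs zero
          flip: matrix_mul_assoc)
  qed
  have "det (mat 1 - A) * det (mat 1 + A + B) * det (mat 1 - B) = det (mat 1 - A ** B)"
    using fac[OF assms] by (metis det_mul)
  moreover have "det (mat 1 - B) * det (mat 1 + A + B) * det (mat 1 - A) = det (mat 1 - B ** A)"
  proof -
    have "mat 1 + A + B = mat 1 + B + A" by (simp add: algebra_simps)
    then show ?thesis using fac[OF assms(2,1)] by (metis det_mul)
  qed
  ultimately show ?thesis by (simp add: mult_ac)
qed

text \<open>A permutation with nonzero product never increases \<open>d\<close>. As the sum of
  \<open>d\<close> over all indices is invariant, it cannot decrease \<open>d\<close> anywhere
  either, so only the identity survives.\<close>

lemma det_triangular_measure:
  fixes A :: "real^'n::finite^'n" and d :: "'n \<Rightarrow> nat"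
  assumes "\<And>i j. i \<noteq> j \<Longrightarrow> A $ i $ j \<noteq> 0 \<Longrightarrow> d j < d i"
  shows "det A = (\<Prod>i\<in>UNIV. A $ i $ i)"
proof -
  have "(\<Prod>i\<in>UNIV. A $ i $ p i) = 0" if p: "p permutes UNIV" "p \<noteq> id" for p
  proof (rule ccontr)
    assume nz: "(\<Prod>i\<in>UNIV. A $ i $ p i) \<noteq> 0"
    then have le: "d (p i) \<le> d i" for i
      using assms[of i "p i"] by (cases "p i = i") (auto simp: less_imp_le)
    obtain k where k: "p k \<noteq> k" using p(2) by (auto simp: fun_eq_iff)
    then have "d (p k) < d k" using assms[of k "p k"] nz by auto
    then have "(\<Sum>i\<in>UNIV. d (p i)) < (\<Sum>i\<in>UNIV. d i)"
      using le by (intro sum_strict_mono_ex1) auto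
    moreover have "(\<Sum>i\<in>UNIV. d (p i)) = (\<Sum>i\<in>UNIV. d i)"
      using sum.permute[OF p(1), of d] by (simp add: o_def)
    ultimately show False by simp
  qed
  then have "det A = (\<Sum>p\<in>{id}. of_int (sign p) * (\<Prod>i\<in>UNIV. A $ i $ p i))"
    unfolding det_def by (intro sum.mono_neutral_right) (auto simp: permutes_id finite_permutations)
  then show ?thesis by simp
qed

text \<open>Weak diagonal dominance, with a non-negative diagonal entry built in. It is a condition
  on a single row, so that rows can be exchanged one at a time, and the admissible rows form a
  convex cone.\<close>

definition dominant_row :: "'n::finite \<Rightarrow> real^'n \<Rightarrow> bool" where
  "dominant_row i r \<longleftrightarrow> (\<Sum>j\<in>UNIV - {i}. \<bar>r $ j\<bar>) \<le> r $ i"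

lemma dominant_row_add: "dominant_row i r \<Longrightarrow> dominant_row i r' \<Longrightarrow> dominant_row i (r + r')"
  unfolding dominant_row_def
  by (rule order_trans[OF sum_mono[of _ _ "\<lambda>j. \<bar>r $ j\<bar> + \<bar>r' $ j\<bar>"]])
    (auto simp: sum.distrib)

lemma dominant_row_scaleR: "dominant_row i r \<Longrightarrow> 0 \<le> c \<Longrightarrow> dominant_row i (c *\<^sub>R r)"
  unfolding dominant_row_def
  by (auto simp: abs_mult mult_left_mono simp flip: sum_distrib_left)

text \<open>Along the segment from the identity to \<open>A\<close> the matrix stays strictly diagonally dominant,
  hence regular, so the determinant cannot change sign.\<close>

lemma det_dominant_nonneg:
  fixes A :: "real^'n::finite^'n"
  assumes dom: "\<And>i. dominant_row i (A $ i)"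
  shows "0 \<le> det A"
proof (rule ccontr)
  assume neg: "\<not> 0 \<le> det A"
  define B where "B c = c *\<^sub>R A + (1 - c) *\<^sub>R mat 1" for c
  have "continuous_on {0..1} (\<lambda>c. det (B c))"
    unfolding B_def det_def by (intro continuous_intros)
  moreover have "det (B 0) = 1" "det (B 1) = det A" by (auto simp: B_def)
  ultimately obtain c where c: "0 \<le> c" "c \<le> 1" "det (B c) = 0"
    using IVT2'[of "\<lambda>c. det (B c)" 1 0 0] neg by auto
  then have c1: "c < 1" using neg \<open>det (B 1) = det A\<close> by (cases "c = 1") auto
  obtain x where x: "B c *v x = 0" "x \<noteq> 0"
    using c(3) invertible_det_nz[of "B c"] matrix_left_invertible_ker[of "B c"]
      invertible_left_inverse[of "B c"] by metis
  \<comment> \<open>The contradiction comes from the row at which the kernel vector has an entry of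
    maximal modulus: there the diagonal term strictly outweighs all the others.\<close>
  have "Max (range (\<lambda>i. \<bar>x $ i\<bar>)) \<in> range (\<lambda>i. \<bar>x $ i\<bar>)" by (intro Max_in) auto
  then obtain i where i: "\<bar>x $ i\<bar> = Max (range (\<lambda>i. \<bar>x $ i\<bar>))" by (metis imageE)
  have le: "\<bar>x $ j\<bar> \<le> \<bar>x $ i\<bar>" for j unfolding i by (intro Max_ge) auto
  have pos: "0 < \<bar>x $ i\<bar>"
  proof -
    obtain j where "x $ j \<noteq> 0" using x(2) by (auto simp: vec_eq_iff)
    then show ?thesis using le[of j] by linarith
  qed
  have "0 = (B c *v x) $ i" using x by simp
  also have "\<dots> = B c $ i $ i * x $ i + (\<Sum>j\<in>UNIV - {i}. B c $ i $ j * x $ j)"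
    unfolding matrix_vector_mult_def by (simp add: sum.remove[of UNIV i])
  finally have "\<bar>B c $ i $ i * x $ i\<bar> = \<bar>\<Sum>j\<in>UNIV - {i}. B c $ i $ j * x $ j\<bar>"
    by linarith
  also have "\<dots> \<le> (\<Sum>j\<in>UNIV - {i}. c * \<bar>A $ i $ j\<bar> * \<bar>x $ i\<bar>)"
  proof (rule order_trans[OF sum_abs], rule sum_mono)
    fix j assume "j \<in> UNIV - {i}"
    then have "B c $ i $ j = c * A $ i $ j" by (simp add: B_def mat_def)
    then show "\<bar>B c $ i $ j * x $ j\<bar> \<le> c * \<bar>A $ i $ j\<bar> * \<bar>x $ i\<bar>"
      using le[of j] c by (simp add: abs_mult mult_left_mono)
  qed
  also have "\<dots> \<le> c * A $ i $ i * \<bar>x $ i\<bar>"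
    using dom[of i] c by (simp add: dominant_row_def mult_left_mono mult_right_mono flip: sum_distrib_left sum_distrib_right)
  also have "\<dots> < (c * A $ i $ i + (1 - c)) * \<bar>x $ i\<bar>"
    using c1 pos by simp
  also have "\<dots> \<le> \<bar>B c $ i $ i * x $ i\<bar>"
    by (simp add: B_def mat_def abs_mult mult_right_mono)
  finally show False by simp
qed

text \<open>The rows of \<open>B\<close> are replaced by those of \<open>A\<close> one at a time.
  Splitting row k as \<open>c k\<close> times the row of \<open>B\<close> plus a dominant remainder,
  multilinearity yields \<open>c k\<close> times the old determinant plus a determinant with
  dominant rows only, which is non-negative.\<close>

lemma det_dominant_mono:
  fixes A B :: "real^'n::finite^'n"
  assumes "\<And>i. 0 \<le> c i" "\<And>i. dominant_row i (B $ i)" "\<And>i. dominant_row i (A $ i - c i *\<^sub>R B $ i)"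
  shows "(\<Prod>i\<in>UNIV. c i) * det B \<le> det A"
proof -
  have domA: "dominant_row i (A $ i)" for i
    using dominant_row_add[OF assms(3)[of i] dominant_row_scaleR[OF assms(2)[of i] assms(1)[of i]]] by simp
  have "(\<Prod>i\<in>X. c i) * det B \<le> det (\<chi> i. if i \<in> X then A $ i else B $ i)" for X :: "'n set"
  proof (induction X rule: finite_induct[OF finite])
    case 1
    have "(\<chi> i. B $ i) = B" by (simp add: vec_eq_iff)
    then show ?case by simp
  next
    case (2 k X)
    let ?M = "\<lambda>r. (\<chi> i. if i = k then r else if i \<in> X then A $ i else B $ i) :: real^'n^'n"
    have "det (\<chi> i. if i \<in> insert k X then A $ i else B $ i) = det (?M (c k *s B $ k + (A $ k - c k *s B $ k)))"
      by (rule arg_cong[of _ _ det]) (auto simp: vec_eq_iff)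
    also have "\<dots> = c k * det (?M (B $ k)) + det (?M (A $ k - c k *s B $ k))"
      unfolding det_row_add[of k "\<lambda>_. c k *s B $ k" "\<lambda>_. A $ k - c k *s B $ k"]
        det_row_mul[of k "c k" "\<lambda>_. B $ k"] ..
    also have "?M (B $ k) = (\<chi> i. if i \<in> X then A $ i else B $ i)"
      using 2 by (auto simp: vec_eq_iff)
    also have "0 \<le> det (?M (A $ k - c k *s B $ k))"
      using assms(2,3) domA by (intro det_dominant_nonneg) (auto simp: scalar_mult_eq_scaleR)
    then have "c k * ((\<Prod>i\<in>X. c i) * det B) \<le>
       c k * det (\<chi> i. if i \<in> X then A $ i else B $ i) + det (?M (A $ k - c k *s B $ k))"
      using mult_left_mono[OF 2(3) assms(1)[of k]] by linarith
    finally show ?case using 2 by (simp add: mult.assoc)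
  qed
  from this[of UNIV] show ?thesis by (simp add: vec_lambda_eta)
qed

section \<open>Inverse matrices and Cramer's rule\<close>

lemma matrix_inv_inverse:
  fixes A :: "real^'n::finite^'n"
  assumes "invertible A"
  shows "A ** matrix_inv A = mat 1" "matrix_inv A ** A = mat 1"
  using someI_ex[OF assms[unfolded invertible_def]] by (auto simp: matrix_inv_def)

text \<open>Cramer's rule, completed on singular matrices by the default value of
  \<open>matrix_inv\<close>. A formula valid for every matrix is what makes the Green function
  measurable on the whole product space.\<close>

lemma matrix_inv_nth:
  fixes A :: "real^'n::finite^'n"
  shows "matrix_inv A $ i $ j = (if det A = 0 then matrix_inv (0 :: real^'n^'n) $ i $ j
     else det (\<chi> k l. if l = i then axis j 1 $ k else A $ k $ l) / det A)"
proof (cases "det A = 0")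
  case True
  then have "\<not> invertible A" "\<not> invertible (0 :: real^'n^'n)" by (simp_all add: invertible_det_nz flip: mat_0)
  \<comment> \<open>Both defining predicates are unsatisfiable, hence equal, so the choice operator
    returns the same matrix for \<open>A\<close> as for the zero matrix.\<close>
  then have "(\<lambda>A'. A ** A' = mat 1 \<and> A' ** A = mat 1) = (\<lambda>_. False)"
    "(\<lambda>A'. (0 :: real^'n^'n) ** A' = mat 1 \<and> A' ** (0 :: real^'n^'n) = mat 1) = (\<lambda>_. False)"
    unfolding invertible_def by blast+
  then show ?thesis using True unfolding matrix_inv_def by simp
next
  case False
  then have inv: "invertible A" using invertible_det_nz by blast
  have "A *v (matrix_inv A *v axis j 1) = axis j 1"
    by (simp add: matrix_vector_mul_assoc matrix_inv_inverse(1)[OF inv])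
  then have "matrix_inv A *v axis j 1 = (\<chi> i. det (\<chi> k l. if l = i then axis j 1 $ k else A $ k $ l) / det A)"
    using cramer[OF False] by simp
  moreover have "matrix_inv A $ i $ j = (matrix_inv A *v axis j 1) $ i"
    by (simp add: matrix_vector_mult_basis column_def)
  ultimately show ?thesis using False by simp
qed

section \<open>Change of variables for finite products of Lebesgue measure\<close>

lemma nn_integral_lborel_prod_vec:
  fixes f :: "'n::finite \<Rightarrow> real \<Rightarrow> ennreal"
  assumes [measurable]: "\<And>i. f i \<in> borel_measurable borel"
  shows "(\<integral>\<^sup>+x. (\<Prod>i\<in>UNIV. f i (x $ i)) \<partial>(lborel :: (real^'n) measure)) = (\<Prod>i\<in>UNIV. \<integral>\<^sup>+y. f i y \<partial>lborel)"
proof -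
  have B: "(Basis :: (real^'n) set) = (\<lambda>i. axis i 1) ` UNIV"
    by (auto simp: Basis_vec_def)
  have inj: "inj (\<lambda>i::'n. axis i (1::real))" by (auto simp: inj_on_def axis_eq_axis)
  define g where "g b = f (inv (\<lambda>i. axis i 1) b)" for b :: "real^'n"
  have g: "g (axis i 1) = f i" for i unfolding g_def by (simp add: inv_f_f[OF inj])
  have "(\<integral>\<^sup>+x. (\<Prod>b\<in>Basis. g b (x \<bullet> b)) \<partial>lborel) = (\<Prod>b\<in>Basis. \<integral>\<^sup>+y. g b y \<partial>lborel)"
    by (rule nn_integral_lborel_prod) (auto simp: g_def)
  then show ?thesis
    unfolding B prod.reindex[OF inj] by (simp add: g inner_axis)
qed

lemma measurable_vec_nth [measurable]: "(\<lambda>x::real^'n::finite. x $ i) \<in> borel_measurable borel"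
  by (intro borel_measurable_continuous_onI continuous_intros)

lemma measurable_vec_lambda [measurable (raw)]:
  assumes "\<And>i. (\<lambda>x. f x i) \<in> borel_measurable M"
  shows "(\<lambda>x. \<chi> i. f x i :: real^'n::finite) \<in> borel_measurable M"
  by (subst borel_measurable_euclidean_space) (use assms in \<open>auto simp: Basis_vec_def inner_axis\<close>)

lemma prod_indicator:
  "finite A \<Longrightarrow> (\<Prod>i\<in>A. indicator (B i) (f i)) = (if \<forall>i\<in>A. f i \<in> B i then 1 else 0 :: ennreal)"
  by (induction A rule: finite_induct) auto

lemma emeasure_distr_density:
  assumes w: "w \<in> borel_measurable M" and f: "f \<in> M \<rightarrow>\<^sub>M N" and B: "B \<in> sets N"
  shows "emeasure (distr (density M w) N f) B = (\<integral>\<^sup>+x. w x * indicator (f -` B \<inter> space M) x \<partial>M)"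
proof -
  have f': "f \<in> density M w \<rightarrow>\<^sub>M N" using f by simp
  show ?thesis
    unfolding emeasure_distr[OF f' B] space_density
    by (rule emeasure_density[OF w measurable_sets[OF f B]])
qed

abbreviation PiL :: "'a set \<Rightarrow> ('a \<Rightarrow> real) measure" where
  "PiL A \<equiv> PiM A (\<lambda>_. lborel)"

lemma product_sigma_finite_lborel: "product_sigma_finite (\<lambda>_. lborel :: real measure)"
  by standard

text \<open>Lebesgue measure on \<open>real^A\<close> is the marginal of Lebesgue measure on \<open>real^'j\<close> with the spare
  coordinates confined to the unit interval; the library's change of variables formula only covers
  the types \<open>real^'j\<close>.\<close>

lemma distr_lborel_vec_PiL:
  fixes \<iota> :: "'a \<Rightarrow> 'j::finite"
  assumes A: "finite A" and inj: "inj_on \<iota> A"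
  shows "distr (density lborel (\<lambda>x::real^'j. \<Prod>j\<in>UNIV - \<iota> ` A. indicator {0..1} (x $ j)))
    (PiL A) (\<lambda>x. \<lambda>i\<in>A. x $ \<iota> i) = PiL A"
proof (rule product_sigma_finite.PiM_eqI[OF product_sigma_finite_lborel A])
  fix B :: "'a \<Rightarrow> real set" assume "\<And>i. i \<in> A \<Longrightarrow> B i \<in> sets lborel"
  then have [measurable]: "\<And>i. i \<in> A \<Longrightarrow> B i \<in> sets borel" by simp
  have [measurable]: "Pi\<^sub>E A B \<in> sets (PiL A)" using A by (intro sets_PiM_I_finite) auto
  let ?\<rho> = "\<lambda>x::real^'j. \<lambda>i\<in>A. x $ \<iota> i"
  let ?w = "\<lambda>x::real^'j. \<Prod>j\<in>UNIV - \<iota> ` A. indicator {0..1} (x $ j) :: ennreal"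
  define f where "f j = (if j \<in> \<iota> ` A then indicator (B (inv_into A \<iota> j)) else indicator {0..1::real} :: real \<Rightarrow> ennreal)" for j
  have [measurable]: "f j \<in> borel_measurable borel" for j
    using inv_into_into[of j \<iota> A] by (auto simp: f_def)
  have fA: "f (\<iota> i) = indicator (B i)" if "i \<in> A" for i using that inj by (simp add: f_def)
  have split: "(\<Prod>j\<in>UNIV. h j) = (\<Prod>i\<in>A. h (\<iota> i)) * (\<Prod>j\<in>UNIV - \<iota> ` A. h j)" for h :: "'j \<Rightarrow> ennreal"
  proof -
    have "(\<Prod>j\<in>UNIV. h j) = (\<Prod>j\<in>UNIV - \<iota> ` A. h j) * (\<Prod>j\<in>\<iota> ` A. h j)"
      by (rule prod.subset_diff) auto
    then show ?thesis by (simp add: prod.reindex[OF inj] mult.commute)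
  qed
  have \<rho>[measurable]: "?\<rho> \<in> lborel \<rightarrow>\<^sub>M PiL A" by measurable
  have [measurable]: "?\<rho> -` Pi\<^sub>E A B \<inter> space lborel \<in> sets lborel"
    by (rule measurable_sets[OF \<rho>]) measurable
  have "emeasure (distr (density lborel ?w) (PiL A) ?\<rho>) (Pi\<^sub>E A B) =
      (\<integral>\<^sup>+x. ?w x * indicator (?\<rho> -` Pi\<^sub>E A B \<inter> space lborel) x \<partial>lborel)"
    by (rule emeasure_distr_density) measurable
  also have "\<dots> = (\<integral>\<^sup>+x. (\<Prod>j\<in>UNIV. f j (x $ j)) \<partial>lborel)"
  proof (rule nn_integral_cong)
    fix x :: "real^'j"
    have "indicator (?\<rho> -` Pi\<^sub>E A B \<inter> space lborel) x = (\<Prod>i\<in>A. indicator (B i) (x $ \<iota> i) :: ennreal)"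
      unfolding prod_indicator[OF A] by (auto simp: indicator_def PiE_def Pi_def)
    moreover have "(\<Prod>j\<in>UNIV - \<iota> ` A. f j (x $ j)) = ?w x"
      by (intro prod.cong) (auto simp: f_def)
    ultimately show "?w x * indicator (?\<rho> -` Pi\<^sub>E A B \<inter> space lborel) x = (\<Prod>j\<in>UNIV. f j (x $ j))"
      unfolding split by (simp add: fA mult.commute cong: prod.cong)
  qed
  also have "\<dots> = (\<Prod>j\<in>UNIV. \<integral>\<^sup>+y. f j y \<partial>lborel)"
    by (rule nn_integral_lborel_prod_vec) measurable
  also have "\<dots> = (\<Prod>i\<in>A. emeasure lborel (B i))"
  proof -
    have "(\<Prod>j\<in>UNIV - \<iota> ` A. \<integral>\<^sup>+y. f j y \<partial>lborel) = 1"
      by (intro prod.neutral) (auto simp: f_def)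
    then show ?thesis unfolding split by (simp add: fA cong: prod.cong)
  qed
  finally show "emeasure (distr (density lborel ?w) (PiL A) ?\<rho>) (Pi\<^sub>E A B) = (\<Prod>i\<in>A. emeasure lborel (B i))" .
qed simp

lemma nn_integral_PiL_vec:
  fixes \<iota> :: "'a \<Rightarrow> 'j::finite"
  assumes A: "finite A" and inj: "inj_on \<iota> A" and [measurable]: "f \<in> borel_measurable (PiL A)"
  shows "(\<integral>\<^sup>+t. f t \<partial>PiL A) =
    (\<integral>\<^sup>+x. (\<Prod>j\<in>UNIV - \<iota> ` A. indicator {0..1} (x $ j)) * f (\<lambda>i\<in>A. x $ \<iota> i) \<partial>(lborel :: (real^'j) measure))"
  by (subst distr_lborel_vec_PiL[OF A inj, symmetric], subst nn_integral_distr, measurable,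
      subst nn_integral_density) auto

lemma nn_integral_change_of_variables_vec:
  fixes \<Psi> :: "real^'n::{finite,wellorder} \<Rightarrow> real^'n::_" and J :: "real^'n::_ \<Rightarrow> real"
  assumes S[measurable]: "S \<in> sets borel" and \<Psi>[measurable]: "\<Psi> \<in> borel_measurable borel"
    and der: "\<And>x. x \<in> S \<Longrightarrow> (\<Psi> has_derivative \<Psi>' x) (at x)" and inj: "inj_on \<Psi> S"
    and im[measurable]: "\<Psi> ` S \<in> sets borel"
    and J[measurable]: "J \<in> borel_measurable borel"
    and detJ: "\<And>x. x \<in> S \<Longrightarrow> \<bar>det (matrix (\<Psi>' x))\<bar> = J x"
    and g[measurable]: "g \<in> borel_measurable borel"
  shows "(\<integral>\<^sup>+x. indicator S x * ennreal (J x) * g (\<Psi> x) \<partial>lborel) = (\<integral>\<^sup>+y. indicator (\<Psi> ` S) y * g y \<partial>lborel)"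
proof -
  have image: "emeasure lborel (\<Psi> ` T) = (\<integral>\<^sup>+x. ennreal (indicator T x * J x) \<partial>lborel)"
    if T[measurable]: "T \<in> sets borel" "\<Psi> ` T \<in> sets borel" and TS: "T \<subseteq> S" for T
  proof -
    have nn: "0 \<le> indicator T x * J x" for x
      using detJ[of x] TS by (auto simp: indicator_def)
    have "\<Psi> ` T \<in> lmeasurable \<and> measure lebesgue (\<Psi> ` T) = m \<longleftrightarrow>
        integral\<^sup>N lborel (\<lambda>x. ennreal (indicator T x * J x)) = ennreal m \<and> 0 \<le> m" for m
    proof -
      have "\<Psi> ` T \<in> lmeasurable \<and> measure lebesgue (\<Psi> ` T) = m \<longleftrightarrow>
         ((\<lambda>x. \<bar>det (matrix (\<Psi>' x))\<bar>) has_integral m) T"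
        using TS der inj by (intro has_measure_differentiable_image)
          (auto intro: has_derivative_at_withinI inj_on_subset)
      also have "\<dots> \<longleftrightarrow> (J has_integral m) T"
        using TS detJ by (intro has_integral_cong) auto
      also have "\<dots> \<longleftrightarrow> ((\<lambda>x. indicator T x * J x) has_integral m) UNIV"
        by (subst has_integral_restrict_UNIV[symmetric], rule has_integral_cong) (auto simp: indicator_def)
      also have "\<dots> \<longleftrightarrow> integral\<^sup>N lborel (\<lambda>x. ennreal (indicator T x * J x)) = ennreal m \<and> 0 \<le> m"
      proof (subst has_integral_iff_nn_integral_lebesgue[OF nn])
        have "(\<lambda>x. indicator T x * J x) \<in> borel_measurable borel" by measurable
        then have "(\<lambda>x. indicator T x * J x) \<in> lebesgue \<rightarrow>\<^sub>M borel"
          by (intro measurable_completion) simp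
        then show "((\<lambda>x. indicator T x * J x) \<in> lebesgue \<rightarrow>\<^sub>M borel \<and>
            (\<integral>\<^sup>+ x. ennreal (indicator T x * J x) \<partial>lebesgue) = ennreal m \<and> 0 \<le> m) \<longleftrightarrow>
            integral\<^sup>N lborel (\<lambda>x. ennreal (indicator T x * J x)) = ennreal m \<and> 0 \<le> m"
          by (simp add: nn_integral_completion)
      qed
      finally show ?thesis .
    qed
    note iff = this
    have leb: "emeasure lborel (\<Psi> ` T) = emeasure lebesgue (\<Psi> ` T)" by simp
    show ?thesis
    proof (cases "\<Psi> ` T \<in> lmeasurable")
      case True
      then have "integral\<^sup>N lborel (\<lambda>x. ennreal (indicator T x * J x)) = ennreal (measure lebesgue (\<Psi> ` T))"
        using iff by blast
      then show ?thesis using True by (simp add: leb emeasure_eq_measure2 fmeasurableD2)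
    next
      \<comment> \<open>The equivalence \<open>iff\<close> concerns finite values only. If the image
        has infinite measure, it excludes a finite integral, so both sides are infinite.\<close>
      case False
      have "integral\<^sup>N lborel (\<lambda>x. ennreal (indicator T x * J x)) = \<infinity>"
      proof (rule ccontr)
        assume "integral\<^sup>N lborel (\<lambda>x. ennreal (indicator T x * J x)) \<noteq> \<infinity>"
        then obtain m where "integral\<^sup>N lborel (\<lambda>x. ennreal (indicator T x * J x)) = ennreal m" "0 \<le> m"
          by (cases "integral\<^sup>N lborel (\<lambda>x. ennreal (indicator T x * J x))") auto
        then show False using iff[of m] False by blast
      qed
      moreover have "emeasure lebesgue (\<Psi> ` T) = \<infinity>"
        using False T(2) by (auto simp: fmeasurable_def less_top[symmetric])
      ultimately show ?thesis unfolding leb by metis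
    qed
  qed
  have eq: "distr (density lborel (\<lambda>x. ennreal (indicator S x * J x))) borel \<Psi> = density lborel (indicator (\<Psi> ` S))"
  proof (rule measure_eqI)
    fix B assume "B \<in> sets (distr (density lborel (\<lambda>x. ennreal (indicator S x * J x))) borel \<Psi>)"
    then have B[measurable]: "B \<in> sets borel" by simp
    let ?T = "S \<inter> (\<Psi> -` B \<inter> space borel)"
    have T[measurable]: "?T \<in> sets borel" by measurable
    have im: "\<Psi> ` ?T = \<Psi> ` S \<inter> B" by auto
    have "emeasure (distr (density lborel (\<lambda>x. ennreal (indicator S x * J x))) borel \<Psi>) B =
      (\<integral>\<^sup>+x. ennreal (indicator S x * J x) * indicator (\<Psi> -` B \<inter> space lborel) x \<partial>lborel)"
      by (rule emeasure_distr_density) measurable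
    also have "\<dots> = (\<integral>\<^sup>+x. ennreal (indicator ?T x * J x) \<partial>lborel)"
      by (intro nn_integral_cong) (auto simp: indicator_def)
    also have "\<dots> = emeasure lborel (\<Psi> ` S \<inter> B)"
    proof -
      have "\<Psi> ` ?T \<in> sets borel" unfolding im by measurable
      from image[OF T this Int_lower1] show ?thesis unfolding im by simp
    qed
    also have "\<dots> = emeasure (density lborel (indicator (\<Psi> ` S))) B"
    proof -
      have "emeasure (density lborel (indicator (\<Psi> ` S))) B = (\<integral>\<^sup>+y. indicator (\<Psi> ` S) y * indicator B y \<partial>lborel)"
        by (rule emeasure_density) auto
      also have "\<dots> = (\<integral>\<^sup>+y. indicator (\<Psi> ` S \<inter> B) y \<partial>lborel)"
        by (simp only: indicator_inter_arith)
      also have "\<dots> = emeasure lborel (\<Psi> ` S \<inter> B)"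
        by (rule nn_integral_indicator) auto
      finally show ?thesis by simp
    qed
    finally show "emeasure (distr (density lborel (\<lambda>x. ennreal (indicator S x * J x))) borel \<Psi>) B =
      emeasure (density lborel (indicator (\<Psi> ` S))) B" .
  qed simp
  have "(\<integral>\<^sup>+x. indicator S x * ennreal (J x) * g (\<Psi> x) \<partial>lborel) =
      (\<integral>\<^sup>+x. ennreal (indicator S x * J x) * g (\<Psi> x) \<partial>lborel)"
    by (intro nn_integral_cong) (auto simp: indicator_def)
  also have "\<dots> = (\<integral>\<^sup>+x. g (\<Psi> x) \<partial>density lborel (\<lambda>x. ennreal (indicator S x * J x)))"
    by (subst nn_integral_density) auto
  also have "\<dots> = (\<integral>\<^sup>+y. g y \<partial>distr (density lborel (\<lambda>x. ennreal (indicator S x * J x))) borel \<Psi>)"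
    by (subst nn_integral_distr) auto
  also have "\<dots> = (\<integral>\<^sup>+y. indicator (\<Psi> ` S) y * g y \<partial>lborel)"
    unfolding eq by (subst nn_integral_density) auto
  finally show ?thesis .
qed

lemma has_derivative_vec:
  fixes f :: "'a::real_normed_vector \<Rightarrow> real^'n::finite"
  assumes "\<And>i. ((\<lambda>x. f x $ i) has_derivative (\<lambda>h. f' h $ i)) (at x within X)"
  shows "(f has_derivative f') (at x within X)"
  using assms by (subst has_derivative_componentwise_within) (auto simp: Basis_vec_def inner_axis)

text \<open>\<open>\<iota>\<close> places the coordinates in a vector type and \<open>e\<close>
  pairs each target coordinate with a source coordinate, which makes the derivative \<open>D\<close>
  a square matrix over \<open>A\<close>. The spare coordinates are carried along by the identity, so
  they change neither the determinant nor the unit box.\<close>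

theorem nn_integral_PiL_change_of_variables:
  fixes \<iota> :: "'a \<Rightarrow> 'j::{finite,wellorder}" and \<Psi> :: "('a \<Rightarrow> real) \<Rightarrow> 'b \<Rightarrow> real"
    and D :: "('a \<Rightarrow> real) \<Rightarrow> 'a \<Rightarrow> 'a \<Rightarrow> real" and J :: "('a \<Rightarrow> real) \<Rightarrow> real"
  assumes A: "finite A" and \<iota>: "inj_on \<iota> A" and e: "bij_betw e A B"
    and S[measurable]: "S \<in> sets (PiL A)" and \<Psi>[measurable]: "\<Psi> \<in> PiL A \<rightarrow>\<^sub>M PiL B"
    and im[measurable]: "\<Psi> ` S \<in> sets (PiL B)" and inj: "inj_on \<Psi> S"
    and der: "\<And>x i. (\<lambda>k\<in>A. x $ \<iota> k) \<in> S \<Longrightarrow> i \<in> A \<Longrightarrow>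
      ((\<lambda>x. \<Psi> (\<lambda>k\<in>A. x $ \<iota> k) (e i)) has_derivative
       (\<lambda>h. \<Sum>k\<in>A. D (\<lambda>k\<in>A. x $ \<iota> k) i k * h $ \<iota> k)) (at x)"
    and J[measurable]: "J \<in> borel_measurable (PiL A)"
    and detJ: "\<And>t. t \<in> S \<Longrightarrow> \<bar>\<Sum>\<pi> | \<pi> permutes A. of_int (sign \<pi>) * (\<Prod>i\<in>A. D t i (\<pi> i))\<bar> = J t"
    and g[measurable]: "g \<in> borel_measurable (PiL B)"
  shows "(\<integral>\<^sup>+t. indicator S t * ennreal (J t) * g (\<Psi> t) \<partial>PiL A) = (\<integral>\<^sup>+q. indicator (\<Psi> ` S) q * g q \<partial>PiL B)"
proof -
  have B: "finite B" using e A bij_betw_finite by blast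
  \<comment> \<open>The target coordinate \<open>e i\<close> gets the slot of \<open>i\<close>, so
    source and target have the same spare slots.\<close>
  define \<kappa> where "\<kappa> b = \<iota> (inv_into A e b)" for b
  have \<kappa>e: "\<kappa> (e i) = \<iota> i" if "i \<in> A" for i
    using that e by (simp add: \<kappa>_def bij_betw_inv_into_left)
  have Be: "B = e ` A" using e by (simp add: bij_betw_def)
  have \<kappa>: "inj_on \<kappa> B"
    using \<iota> \<kappa>e e unfolding Be inj_on_def bij_betw_def by auto
  have \<kappa>B: "\<kappa> ` B = \<iota> ` A" unfolding Be using \<kappa>e by force
  define \<rho> where "\<rho> x = (\<lambda>k\<in>A. x $ \<iota> k)" for x :: "real^'j::_"
  define \<rho>B where "\<rho>B y = (\<lambda>b\<in>B. y $ \<kappa> b)" for y :: "real^'j::_"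
  have [measurable]: "\<rho> \<in> borel \<rightarrow>\<^sub>M PiL A" "\<rho>B \<in> borel \<rightarrow>\<^sub>M PiL B"
    unfolding \<rho>_def \<rho>B_def by measurable
  define \<Phi> where "\<Phi> x = (\<chi> j. if j \<in> \<iota> ` A then \<Psi> (\<rho> x) (e (inv_into A \<iota> j)) else x $ j)" for x :: "real^'j::_"
  have comp: "(\<lambda>x. \<Psi> (\<rho> x) b) \<in> borel_measurable borel" if "b \<in> B" for b
  proof -
    have "(\<lambda>f. f b) \<in> PiL B \<rightarrow>\<^sub>M lborel" using that by measurable
    then have "(\<lambda>x. (\<Psi> \<circ> \<rho>) x b) \<in> borel \<rightarrow>\<^sub>M lborel"
      by (rule measurable_compose[rotated]) simp
    then show ?thesis by simp
  qed
  have eB: "e (inv_into A \<iota> j) \<in> B" if "j \<in> \<iota> ` A" for j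
    using that inv_into_into[OF that] by (auto simp: Be)
  have [measurable]: "\<Phi> \<in> borel_measurable borel"
  proof -
    have "(\<lambda>x. if j \<in> \<iota> ` A then \<Psi> (\<rho> x) (e (inv_into A \<iota> j)) else x $ j) \<in> borel_measurable borel" for j
      using comp[OF eB, of j] by (cases "j \<in> \<iota> ` A") auto
    then show ?thesis unfolding \<Phi>_def by (rule measurable_vec_lambda)
  qed
  let ?w = "\<lambda>x::real^'j::_. \<Prod>j\<in>UNIV - \<iota> ` A. indicator {0..1} (x $ j) :: ennreal"
  define S' where "S' = {x. \<rho> x \<in> S \<and> (\<forall>j\<in>UNIV - \<iota> ` A. x $ j \<in> {0..1})}"
  have w: "?w x = (if \<forall>j\<in>UNIV - \<iota> ` A. x $ j \<in> {0..1} then 1 else 0)" for x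
    by (rule prod_indicator) simp
  have S'[measurable]: "S' \<in> sets borel"
  proof -
    have "S' = {x\<in>space borel. \<rho> x \<in> S} \<inter> (\<Inter>j\<in>UNIV - \<iota> ` A. {x\<in>space borel. x $ j \<in> {0..1}}) \<inter> UNIV"
      by (auto simp: S'_def)
    also have "\<dots> \<in> sets borel" 
      \<comment> \<open>Without spare coordinates the intersection runs over the empty set and has
        to be treated separately.\<close>
      by (cases "UNIV - \<iota> ` A = {}") (simp, measurable)
    finally show ?thesis .
  qed
  have \<Psi>ext: "\<Psi> t \<in> extensional B" if "t \<in> S" for t
    using measurable_space[OF \<Psi>, of t] sets.sets_into_space[OF S] that by (auto simp: space_PiM PiE_def)
  have Sext: "t \<in> extensional A" if "t \<in> S" for t
    using sets.sets_into_space[OF S] that by (auto simp: space_PiM PiE_def)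
  have \<rho>\<Phi>: "\<rho>B (\<Phi> x) = \<Psi> (\<rho> x)" if "x \<in> S'" for x
  proof (rule extensionalityI[of _ B])
    show "\<rho>B (\<Phi> x) \<in> extensional B" by (simp add: \<rho>B_def)
    show "\<Psi> (\<rho> x) \<in> extensional B" using that by (auto simp: S'_def intro: \<Psi>ext)
    fix b assume b: "b \<in> B"
    then obtain i where i: "i \<in> A" "b = e i" by (auto simp: Be)
    then show "\<rho>B (\<Phi> x) b = \<Psi> (\<rho> x) b"
      using b \<iota> by (simp add: \<rho>B_def \<Phi>_def \<kappa>e)
  qed
  have inj': "inj_on \<Phi> S'"
  proof (rule inj_onI)
    fix x y assume x: "x \<in> S'" and y: "y \<in> S'" and eq: "\<Phi> x = \<Phi> y"
    then have "\<Psi> (\<rho> x) = \<Psi> (\<rho> y)" using \<rho>\<Phi> by metis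
    then have \<rho>: "\<rho> x = \<rho> y" using inj x y by (auto simp: S'_def dest: inj_onD)
    have "x $ j = y $ j" for j
    proof (cases "j \<in> \<iota> ` A")
      case True
      then obtain i where "i \<in> A" "j = \<iota> i" by auto
      then show ?thesis using fun_cong[OF \<rho>, of i] by (simp add: \<rho>_def)
    next
      case False
      have "\<Phi> x $ j = \<Phi> y $ j" using eq by simp
      then show ?thesis using False by (simp add: \<Phi>_def)
    qed
    then show "x = y" by (simp add: vec_eq_iff)
  qed
  have im': "\<Phi> ` S' = {y. \<rho>B y \<in> \<Psi> ` S \<and> (\<forall>j\<in>UNIV - \<iota> ` A. y $ j \<in> {0..1})}"
  proof (intro set_eqI iffI)
    fix y assume "y \<in> \<Phi> ` S'"
    then obtain x where x: "x \<in> S'" "y = \<Phi> x" by auto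
    then have "\<rho>B y = \<Psi> (\<rho> x)" "\<rho> x \<in> S" using \<rho>\<Phi> by (auto simp: S'_def)
    moreover have "\<forall>j\<in>UNIV - \<iota> ` A. y $ j \<in> {0..1}" using x by (auto simp: S'_def \<Phi>_def)
    ultimately show "y \<in> {y. \<rho>B y \<in> \<Psi> ` S \<and> (\<forall>j\<in>UNIV - \<iota> ` A. y $ j \<in> {0..1})}" by auto
  next
    fix y assume "y \<in> {y. \<rho>B y \<in> \<Psi> ` S \<and> (\<forall>j\<in>UNIV - \<iota> ` A. y $ j \<in> {0..1})}"
    then obtain t where t: "t \<in> S" "\<rho>B y = \<Psi> t" and box: "\<forall>j\<in>UNIV - \<iota> ` A. y $ j \<in> {0..1}" by auto
    define x where "x = (\<chi> j. if j \<in> \<iota> ` A then t (inv_into A \<iota> j) else y $ j)"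
    have \<rho>x: "\<rho> x = t"
      by (rule extensionalityI[of _ A]) (use Sext[OF t(1)] \<iota> in \<open>auto simp: \<rho>_def x_def\<close>)
    have "\<Phi> x $ j = y $ j" for j
    proof (cases "j \<in> \<iota> ` A")
      case True
      then obtain i where i: "i \<in> A" "j = \<iota> i" by auto
      then have "\<rho>B y (e i) = y $ j" using \<kappa>e by (simp add: \<rho>B_def Be)
      then show ?thesis using i t \<iota> by (simp add: \<Phi>_def \<rho>x)
    next
      case False
      then show ?thesis by (simp add: \<Phi>_def x_def)
    qed
    then have "y = \<Phi> x" by (simp add: vec_eq_iff)
    moreover have "x \<in> S'" using t box by (auto simp: S'_def \<rho>x) (auto simp: x_def)
    ultimately show "y \<in> \<Phi> ` S'" by auto
  qed
  have im'_m[measurable]: "\<Phi> ` S' \<in> sets borel"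
  proof -
    have "\<Phi> ` S' = {y\<in>space borel. \<rho>B y \<in> \<Psi> ` S} \<inter> (\<Inter>j\<in>UNIV - \<iota> ` A. {x\<in>space borel. x $ j \<in> {0..1}}) \<inter> UNIV"
      unfolding im' by auto
    also have "\<dots> \<in> sets borel"
      by (cases "UNIV - \<iota> ` A = {}") (simp, measurable)
    finally show ?thesis .
  qed
  define \<Phi>' where "\<Phi>' x h = (\<chi> j. if j \<in> \<iota> ` A then \<Sum>k\<in>A. D (\<rho> x) (inv_into A \<iota> j) k * h $ \<iota> k else h $ j)"
    for x h :: "real^'j::_"
  have der': "(\<Phi> has_derivative \<Phi>' x) (at x)" if x: "x \<in> S'" for x
  proof (rule has_derivative_vec)
    fix j
    show "((\<lambda>x. \<Phi> x $ j) has_derivative (\<lambda>h. \<Phi>' x h $ j)) (at x)"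
    proof (cases "j \<in> \<iota> ` A")
      case True
      then show ?thesis
        using der[of x "inv_into A \<iota> j"] x inv_into_into[OF True]
        by (simp add: \<Phi>_def \<Phi>'_def \<rho>_def S'_def)
    next
      case False
      then show ?thesis
        by (simp add: \<Phi>_def \<Phi>'_def bounded_linear_imp_has_derivative bounded_linear_vec_nth)
    qed
  qed
  have det': "\<bar>det (matrix (\<Phi>' x))\<bar> = J (\<rho> x)" if x: "x \<in> S'" for x
  proof -
    have entry: "matrix (\<Phi>' x) $ i $ j = (if i \<in> \<iota> ` A then \<Sum>k\<in>A. D (\<rho> x) (inv_into A \<iota> i) k * axis j 1 $ \<iota> k else axis j 1 $ i)" for i j
      by (simp add: matrix_def \<Phi>'_def)
    have "det (matrix (\<Phi>' x)) = (\<Sum>\<pi> | \<pi> permutes A. of_int (sign \<pi>) * (\<Prod>i\<in>A. matrix (\<Phi>' x) $ \<iota> i $ \<iota> (\<pi> i)))"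
      by (rule det_leibniz_embed[OF \<iota>]) (auto simp: entry axis_def)
    also have "\<dots> = (\<Sum>\<pi> | \<pi> permutes A. of_int (sign \<pi>) * (\<Prod>i\<in>A. D (\<rho> x) i (\<pi> i)))"
    proof (intro sum.cong prod.cong arg_cong2[of _ _ _ _ "(*)"] refl)
      fix \<pi> i assume "\<pi> \<in> {\<pi>. \<pi> permutes A}" and i: "i \<in> A"
      then have \<pi>: "\<pi> i \<in> A" by (simp add: permutes_in_image)
      have "(\<Sum>k\<in>A. D (\<rho> x) i k * axis (\<iota> (\<pi> i)) 1 $ \<iota> k) = (\<Sum>k\<in>A. if k = \<pi> i then D (\<rho> x) i k else 0)"
        using \<iota> \<pi> by (intro sum.cong) (auto simp: axis_def inj_on_eq_iff)
      then show "matrix (\<Phi>' x) $ \<iota> i $ \<iota> (\<pi> i) = D (\<rho> x) i (\<pi> i)"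
        using A \<pi> i \<iota> by (simp add: entry)
    qed
    finally show ?thesis using detJ x by (simp add: S'_def)
  qed
  have "(\<integral>\<^sup>+t. indicator S t * ennreal (J t) * g (\<Psi> t) \<partial>PiL A) =
     (\<integral>\<^sup>+x. ?w x * (indicator S (\<rho> x) * ennreal (J (\<rho> x)) * g (\<Psi> (\<rho> x))) \<partial>lborel)"
    unfolding \<rho>_def by (rule nn_integral_PiL_vec[OF A \<iota>]) measurable
  also have "\<dots> = (\<integral>\<^sup>+x. indicator S' x * ennreal (J (\<rho> x)) * g (\<rho>B (\<Phi> x)) \<partial>lborel)"
    by (intro nn_integral_cong) (auto simp: w indicator_def \<rho>\<Phi> S'_def)
  also have "\<dots> = (\<integral>\<^sup>+y. indicator (\<Phi> ` S') y * g (\<rho>B y) \<partial>lborel)"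
    using S' _ der' inj' im'_m _ det' by (rule nn_integral_change_of_variables_vec) measurable
  also have "\<dots> = (\<integral>\<^sup>+y. (\<Prod>j\<in>UNIV - \<kappa> ` B. indicator {0..1} (y $ j)) * (indicator (\<Psi> ` S) (\<rho>B y) * g (\<rho>B y)) \<partial>lborel)"
    by (intro nn_integral_cong) (auto simp: \<kappa>B w indicator_def im')
  also have "\<dots> = (\<integral>\<^sup>+q. indicator (\<Psi> ` S) q * g q \<partial>PiL B)"
    unfolding \<rho>B_def by (rule nn_integral_PiL_vec[OF B \<kappa>, symmetric]) measurable
  finally show ?thesis .
qed

section \<open>Environments and flows\<close>

text \<open>The number Z_x of the overview; it is also the coordinate of \<open>z\<close> on the
  lifted edge from x_- to x_+.\<close>

definition flux :: "'u::finite edge set \<Rightarrow> real^'u edge \<Rightarrow> 'u \<Rightarrow> real" where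
  "flux E z x = (\<Sum>e\<in>out_edges E x. z $ e)"

text \<open>Restricted to \<open>E\<close>, because members of \<open>environments E\<close> are
  extensional and equality of functions is needed.\<close>

definition env_of :: "'u::finite edge set \<Rightarrow> real^'u edge \<Rightarrow> 'u edge \<Rightarrow> real" where
  "env_of E z = (\<lambda>e\<in>E. z $ e / flux E z (the (fst e)))"

locale killed_graph =
  fixes E :: "'u::finite edge set" and x0 :: 'u and s :: "'u \<Rightarrow> 'u option" and d :: "'u option \<Rightarrow> nat"
  assumes graph: "cemetery_graph E x0" and depth: "is_depth s d" and tree: "functional_edges s \<subseteq> E"
begin

abbreviation T :: "'u edge set" where "T \<equiv> functional_edges s"

abbreviation t :: "'u \<Rightarrow> 'u edge" where "t x \<equiv> (Some x, s x)"

lemma no_None: "(None, v) \<notin> E" and no_loop: "(v, v) \<notin> E"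
  using graph by (auto simp: cemetery_graph_def)

lemma t_in_E: "t x \<in> E"
  using tree by (auto simp: functional_edges_def)

lemma T_out: "e \<in> T \<Longrightarrow> fst e = Some x \<longleftrightarrow> e = t x"
  by (auto simp: functional_edges_def)

lemma inj_t: "inj t" by (auto simp: inj_on_def)

lemma T_range: "T = range t" by (simp add: functional_edges_def)

lemma t_out: "t x \<in> out_edges E x"
  using t_in_E by (simp add: out_edges_def)

lemma out_edges_T: "out_edges E x \<inter> T = {t x}"
  using t_in_E by (auto simp: out_edges_def functional_edges_def)

lemma fst_E: "e \<in> E \<Longrightarrow> fst e = Some (the (fst e))"
  using no_None by (cases e; cases "fst e") auto

lemma depth_s: "d (s x) < d (Some x)"
  using depth by (simp add: is_depth_def)

lemma E_eq: "E = (\<Union>x. out_edges E x)"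
  using fst_E by (auto simp: out_edges_def)

lemma prod_out: "(\<Prod>e\<in>E. f e) = (\<Prod>x\<in>UNIV. \<Prod>e\<in>out_edges E x. f e)"
  by (subst E_eq, rule prod.UNION_disjoint) (auto simp: out_edges_def)

lemma prod_T: "(\<Prod>e\<in>T. f e) = (\<Prod>x\<in>UNIV. f (t x))"
  unfolding T_range by (simp add: prod.reindex[OF inj_t])

lemma sum_P_U_row:
  "(\<Sum>y\<in>UNIV. P_U E p $ x $ y * g y) = (\<Sum>e\<in>out_edges E x. p e * (case snd e of None \<Rightarrow> 0 | Some y \<Rightarrow> g y))"
proof -
  let ?S = "{y. (Some x, Some y) \<in> E}"
  have "(\<Sum>y\<in>UNIV. P_U E p $ x $ y * g y) = (\<Sum>y\<in>?S. p (Some x, Some y) * g y)"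
    by (rule sum.mono_neutral_cong_right) (auto simp: P_U_def)
  also have "\<dots> = (\<Sum>e\<in>(\<lambda>y. (Some x, Some y)) ` ?S. p e * (case snd e of None \<Rightarrow> 0 | Some y \<Rightarrow> g y))"
    by (subst sum.reindex) (auto simp: inj_on_def)
  also have "\<dots> = (\<Sum>e\<in>out_edges E x. p e * (case snd e of None \<Rightarrow> 0 | Some y \<Rightarrow> g y))"
    by (rule sum.mono_neutral_left) (auto simp: out_edges_def image_iff split: option.splits)
  finally show ?thesis .
qed

lemma sum_P_U_col:
  "(\<Sum>x\<in>UNIV. g x * P_U E p $ x $ y) = (\<Sum>e\<in>in_edges E y. g (the (fst e)) * p e)"
proof -
  let ?S = "{x. (Some x, Some y) \<in> E}"
  have "(\<Sum>x\<in>UNIV. g x * P_U E p $ x $ y) = (\<Sum>x\<in>?S. g x * p (Some x, Some y))"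
    by (rule sum.mono_neutral_cong_right) (auto simp: P_U_def)
  also have "\<dots> = (\<Sum>e\<in>(\<lambda>x. (Some x, Some y)) ` ?S. g (the (fst e)) * p e)"
    by (subst sum.reindex) (auto simp: inj_on_def)
  also have "(\<lambda>x. (Some x, Some y)) ` ?S = in_edges E y"
  proof (intro set_eqI iffI)
    fix e assume e: "e \<in> in_edges E y"
    then have "e = (Some (the (fst e)), Some y)" using fst_E[of e] by (cases e) (auto simp: in_edges_def)
    moreover have "e \<in> E" using e by (simp add: in_edges_def)
    ultimately show "e \<in> (\<lambda>x. (Some x, Some y)) ` ?S" by (metis imageI mem_Collect_eq)
  qed (auto simp: in_edges_def)
  finally show ?thesis .
qed

section \<open>Determinants and Green functions of environments\<close>

lemma env_pos: "p \<in> environments E \<Longrightarrow> e \<in> E \<Longrightarrow> 0 < p e \<and> p e \<le> 1"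
  using PiE_mem[of p E "\<lambda>_. {0<..1}" e] by (simp add: environments_def)

lemma env_sum: "p \<in> environments E \<Longrightarrow> (\<Sum>e\<in>out_edges E x. p e) = 1"
  by (auto simp: environments_def)

text \<open>Without loops the diagonal entry is \<open>c\<close> itself, and the row sum of
  \<open>P_U\<close> is at most the total outgoing weight. A general \<open>c\<close> is needed for
  rows whose weights sum to less than 1.\<close>

lemma dominant_row_P_U:
  assumes nonneg: "\<And>e. e \<in> out_edges E x \<Longrightarrow> 0 \<le> q e" and le: "(\<Sum>e\<in>out_edges E x. q e) \<le> c"
  shows "dominant_row x (c *\<^sub>R axis x 1 - P_U E q $ x)"
proof -
  have Pnn: "0 \<le> P_U E q $ x $ y" for y
    using nonneg[of "(Some x, Some y)"] by (auto simp: P_U_def out_edges_def)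
  have "(\<Sum>y\<in>UNIV - {x}. \<bar>(c *\<^sub>R axis x 1 - P_U E q $ x) $ y\<bar>) = (\<Sum>y\<in>UNIV - {x}. P_U E q $ x $ y)"
    using Pnn by (intro sum.cong) (auto simp: axis_def)
  also have "\<dots> \<le> (\<Sum>y\<in>UNIV. P_U E q $ x $ y)"
    using Pnn by (intro sum_mono2) auto
  also have "\<dots> = (\<Sum>y\<in>UNIV. P_U E q $ x $ y * 1)"
    by simp
  also have "\<dots> \<le> (\<Sum>e\<in>out_edges E x. q e)"
    unfolding sum_P_U_row using nonneg by (intro sum_mono) (auto split: option.splits)
  also have "\<dots> \<le> (c *\<^sub>R axis x 1 - P_U E q $ x) $ x"
    using le no_loop by (simp add: axis_def P_U_def)
  finally show ?thesis by (simp add: dominant_row_def)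
qed

lemma mat_nth: "(mat 1 :: real^'u^'u) $ x = axis x 1"
  by (simp add: vec_eq_iff mat_def axis_def)

text \<open>Tree edges decrease the depth, so the matrix is triangular in the order given by
  \<open>d\<close>, with unit diagonal because there are no loops.\<close>

lemma det_tree: "det (mat 1 - P_U E (indicator T)) = 1"
proof -
  have "det (mat 1 - P_U E (indicator T)) = (\<Prod>x\<in>UNIV. (mat 1 - P_U E (indicator T)) $ x $ x)"
  proof (rule det_triangular_measure[where d = "\<lambda>x. d (Some x)"])
    fix x y assume "x \<noteq> y" "(mat 1 - P_U E (indicator T)) $ x $ y \<noteq> 0"
    then have "(Some x, Some y) \<in> T"
      by (auto simp: P_U_def mat_def indicator_def split: if_splits)
    then have "s x = Some y" by (auto simp: functional_edges_def)
    then show "d (Some y) < d (Some x)" using depth_s[of x] by simp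
  qed
  also have "\<dots> = 1" using no_loop by (intro prod.neutral) (auto simp: P_U_def mat_def)
  finally show ?thesis .
qed

text \<open>By the matrix-tree theorem \<open>det (I - P)\<close> is the sum of \<open>\<Prod>\<^sub>e\<^sub>\<in>\<^sub>T' p\<^sub>e\<close> over all directed spanning
  trees \<open>T'\<close>; only the lower bound by a single tree is needed.\<close>

lemma prod_tree_le_det:
  assumes p: "p \<in> environments E"
  shows "(\<Prod>e\<in>T. p e) \<le> det (mat 1 - P_U E p)"
proof -
  have "(\<Prod>x\<in>UNIV. p (t x)) * det (mat 1 - P_U E (indicator T)) \<le> det (mat 1 - P_U E p)"
  proof (rule det_dominant_mono)
    fix x
    show "0 \<le> p (t x)" using env_pos[OF p t_in_E] by (simp add: less_imp_le)
    have "(\<Sum>e\<in>out_edges E x. indicator T e :: real) = 1"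
      using out_edges_T[of x] by (simp add: indicator_def sum.If_cases)
    then show "dominant_row x ((mat 1 - P_U E (indicator T)) $ x)"
      using dominant_row_P_U[of x "indicator T" 1] by (simp add: mat_nth)
    define q where "q e = p e - p (t x) * indicator T e" for e
    have "(mat 1 - P_U E p) $ x - p (t x) *\<^sub>R (mat 1 - P_U E (indicator T)) $ x =
        (1 - p (t x)) *\<^sub>R axis x 1 - P_U E q $ x"
      by (simp add: mat_nth vec_eq_iff P_U_def q_def algebra_simps)
    moreover have "0 \<le> q e" if "e \<in> out_edges E x" for e
    proof (cases "e \<in> T")
      case True
      then have "e = t x" using that out_edges_T by auto
      then show ?thesis using True by (simp add: q_def)
    next
      case False
      then show ?thesis using that env_pos[OF p, of e] by (simp add: q_def out_edges_def less_imp_le)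
    qed
    moreover have "(\<Sum>e\<in>out_edges E x. q e) \<le> 1 - p (t x)"
      using \<open>(\<Sum>e\<in>out_edges E x. indicator T e) = 1\<close> env_sum[OF p, of x]
      by (simp add: q_def sum_subtractf flip: sum_distrib_left)
    ultimately show "dominant_row x ((mat 1 - P_U E p) $ x - p (t x) *\<^sub>R (mat 1 - P_U E (indicator T)) $ x)"
      using dominant_row_P_U[of x q "1 - p (t x)"] by simp
  qed
  then show ?thesis by (simp add: det_tree prod_T)
qed

lemma prod_tree_pos: "p \<in> environments E \<Longrightarrow> 0 < (\<Prod>e\<in>T. p e)"
  using env_pos tree by (intro prod_pos) auto

lemma det_pos: "p \<in> environments E \<Longrightarrow> 0 < det (mat 1 - P_U E p)"
  using prod_tree_pos prod_tree_le_det by fastforce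

lemma invertible_env: "p \<in> environments E \<Longrightarrow> invertible (mat 1 - P_U E p)"
  using det_pos[of p] invertible_det_nz[of "mat 1 - P_U E p"] by auto

lemma vec_mat_one_minus:
  "(\<Sum>x\<in>UNIV. Z x * (mat 1 - P_U E p) $ x $ y) = Z y - (\<Sum>e\<in>in_edges E y. Z (the (fst e)) * p e)"
  unfolding sum_P_U_col[symmetric]
  by (simp add: right_diff_distrib sum_subtractf mat_def if_distrib[of "\<lambda>c. _ * c"] cong: if_cong)

lemma row_eqI:
  assumes "det (mat 1 - P_U E p) \<noteq> 0"
    and "\<And>y. (\<Sum>x\<in>UNIV. Z x * (mat 1 - P_U E p) $ x $ y) = b y"
  shows "Z k = (\<Sum>y\<in>UNIV. b y * green E p $ y $ k)"
proof -
  let ?N = "mat 1 - P_U E p"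
  have inv: "?N ** green E p = mat 1"
    using assms(1) unfolding green_def by (intro matrix_inv_inverse) (simp add: invertible_det_nz)
  have "(\<Sum>y\<in>UNIV. b y * green E p $ y $ k) = (\<Sum>y\<in>UNIV. \<Sum>x\<in>UNIV. Z x * (?N $ x $ y * green E p $ y $ k))"
    by (simp add: assms(2)[symmetric] sum_distrib_right mult.assoc)
  also have "\<dots> = (\<Sum>x\<in>UNIV. Z x * (?N ** green E p) $ x $ k)"
    by (subst sum.swap) (simp add: matrix_matrix_mult_def sum_distrib_left)
  also have "\<dots> = Z k"
    unfolding inv by (simp add: mat_def if_distrib[of "\<lambda>c. _ * c"] cong: if_cong)
  finally show ?thesis by simp
qed

lemma green_row:
  assumes "p \<in> environments E"
  shows "(\<Sum>x\<in>UNIV. green E p $ x0 $ x * (mat 1 - P_U E p) $ x $ y) = (if y = x0 then 1 else 0)"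
proof -
  have "green E p ** (mat 1 - P_U E p) = mat 1"
    unfolding green_def by (rule matrix_inv_inverse(2)[OF invertible_env[OF assms]])
  from arg_cong[OF this, of "\<lambda>M. M $ x0 $ y"] show ?thesis
    by (simp add: matrix_matrix_mult_def mat_def)
qed

text \<open>Sum the equations over the set \<open>S\<close> where \<open>Z\<close> is negative. The
  source and the inflow from outside \<open>S\<close> are non-negative, so the sum of
  \<open>Z\<close> over \<open>S\<close> is at least the sum of \<open>Z\<close> weighted by
  \<open>R\<close>, the probability of staying in \<open>S\<close>. But \<open>R \<le> 1\<close> and
  \<open>Z < 0\<close> give the opposite inequality, strictly as soon as \<open>R < 1\<close>
  somewhere in \<open>S\<close>.\<close>

lemma flow_nonneg:
  assumes p: "p \<in> environments E"
    and Z: "\<And>y. Z y = (if y = x0 then 1 else 0) + (\<Sum>x\<in>UNIV. Z x * P_U E p $ x $ y)"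
  shows "0 \<le> Z x"
proof (rule ccontr)
  define S where "S = {y. Z y < 0}"
  assume "\<not> 0 \<le> Z x"
  then have "x \<in> S" by (simp add: S_def)
  \<comment> \<open>A vertex of minimal depth in \<open>S\<close>: its tree edge leaves
    \<open>S\<close>, which forces \<open>R m < 1\<close>.\<close>
  then obtain m where m: "m \<in> S" "\<And>y. y \<in> S \<Longrightarrow> d (Some m) \<le> d (Some y)"
    using ex_has_least_nat[of "\<lambda>y. y \<in> S" x "\<lambda>y. d (Some y)"] by auto
  have Pnn: "0 \<le> P_U E p $ x $ y" for x y using env_pos[OF p] by (auto simp: P_U_def less_imp_le)
  define R where "R x = (\<Sum>y\<in>S. P_U E p $ x $ y)" for x
  have R: "R x = (\<Sum>e\<in>out_edges E x. p e * (case snd e of None \<Rightarrow> 0 | Some y \<Rightarrow> if y \<in> S then 1 else 0))" for x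
    unfolding sum_P_U_row[symmetric] R_def
    by (rule sum.mono_neutral_cong_left) auto
  have "R x \<le> (\<Sum>e\<in>out_edges E x. p e)" for x
    unfolding R
    by (intro sum_mono) (use env_pos[OF p] in \<open>auto simp: out_edges_def less_imp_le split: option.splits\<close>)
  then have R1: "R x \<le> 1" for x by (simp add: env_sum[OF p])
  have "R m < (\<Sum>e\<in>out_edges E m. p e)"
    unfolding R
  proof (rule sum_strict_mono_ex1)
    have "s m = None \<or> the (s m) \<notin> S" using m(2)[of "the (s m)"] depth_s[of m] by (cases "s m") auto
    then have "p (t m) * (case snd (t m) of None \<Rightarrow> 0 | Some y \<Rightarrow> if y \<in> S then 1 else 0) < p (t m)"
      using env_pos[OF p t_in_E, of m] by (cases "s m") auto
    then show "\<exists>e\<in>out_edges E m. p e * (case snd e of None \<Rightarrow> 0 | Some y \<Rightarrow> if y \<in> S then 1 else 0) < p e"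
      using t_out by blast
  qed (use env_pos[OF p] in \<open>auto simp: out_edges_def less_imp_le split: option.splits\<close>)
  then have Rm: "R m < 1" by (simp add: env_sum[OF p])
  have "(\<Sum>y\<in>S. Z y) = (\<Sum>y\<in>S. if y = x0 then 1 else 0) + (\<Sum>y\<in>S. \<Sum>x\<in>UNIV. Z x * P_U E p $ x $ y)"
    by (subst sum.distrib[symmetric]) (rule sum.cong[OF refl Z])
  also have "(\<Sum>y\<in>S. \<Sum>x\<in>UNIV. Z x * P_U E p $ x $ y) = (\<Sum>x\<in>UNIV. Z x * R x)"
    by (subst sum.swap) (simp add: R_def sum_distrib_left)
  also have "(\<Sum>x\<in>UNIV. Z x * R x) = (\<Sum>x\<in>S. Z x * R x) + (\<Sum>x\<in>UNIV - S. Z x * R x)"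
    by (subst add.commute, rule sum.subset_diff) auto
  finally have total: "(\<Sum>y\<in>S. Z y) = (\<Sum>y\<in>S. if y = x0 then 1 else 0) +
      ((\<Sum>x\<in>S. Z x * R x) + (\<Sum>x\<in>UNIV - S. Z x * R x))" .
  have "(\<Sum>x\<in>S. Z x * R x) \<le> (\<Sum>x\<in>S. Z x)"
  proof -
    have "0 \<le> (\<Sum>x\<in>UNIV - S. Z x * R x)"
      by (intro sum_nonneg mult_nonneg_nonneg) (auto simp: S_def R_def intro: sum_nonneg Pnn)
    moreover have "(0::real) \<le> (\<Sum>y\<in>S. if y = x0 then 1 else 0)" by (intro sum_nonneg) auto
    ultimately show ?thesis
      using total
      by linarith
  qed
  moreover have "(\<Sum>x\<in>S. Z x) < (\<Sum>x\<in>S. Z x * R x)"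
  proof (rule sum_strict_mono_ex1)
    show "\<forall>x\<in>S. Z x \<le> Z x * R x"
      using R1 by (auto simp: S_def intro: mult_left_mono_neg[of _ 1 "Z _", simplified])
    show "\<exists>x\<in>S. Z x < Z x * R x"
      using m(1) Rm mult_strict_left_mono_neg[of "R m" 1 "Z m"] by (auto simp: S_def)
  qed simp
  ultimately show False by simp
qed

text \<open>The source term makes \<open>Z x0\<close> positive, and positivity propagates along a
  directed path from \<open>x0\<close> to \<open>y\<close>.\<close>

lemma flow_pos:
  assumes p: "p \<in> environments E"
    and Z: "\<And>y. Z y = (if y = x0 then 1 else 0) + (\<Sum>x\<in>UNIV. Z x * P_U E p $ x $ y)"
  shows "0 < Z y"
proof -
  have Pnn: "0 \<le> P_U E p $ x $ y" for x y using env_pos[OF p] by (auto simp: P_U_def less_imp_le)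
  have nn: "0 \<le> Z x" for x using flow_nonneg[OF p Z] .
  have start: "0 < Z x0"
    by (subst Z) (auto intro!: add_pos_nonneg sum_nonneg nn Pnn mult_nonneg_nonneg)
  have step: "0 < Z y" if "0 < Z x" "(Some x, Some y) \<in> E" for x y
  proof -
    have "0 < Z x * P_U E p $ x $ y" using that env_pos[OF p that(2)] by (simp add: P_U_def)
    also have "\<dots> \<le> (\<Sum>x\<in>UNIV. Z x * P_U E p $ x $ y)"
      by (rule member_le_sum) (auto intro: nn Pnn mult_nonneg_nonneg)
    finally show ?thesis by (subst Z) auto
  qed
  show ?thesis
  proof (cases "y = x0")
    case False
    then obtain S where "S \<subseteq> E" "directed_simple_path S (Some x0) (Some y)"
      using graph by (auto simp: cemetery_graph_def)
    then obtain vs es where vs: "length vs = Suc (length es)" "hd vs = Some x0" "last vs = Some y"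
      "\<And>j. j < length es \<Longrightarrow> es ! j = (vs ! j, vs ! Suc j)" "set es \<subseteq> E"
      unfolding directed_simple_path_def by blast
    have "vs ! j = Some x \<Longrightarrow> 0 < Z x" if "j < length vs" for j x
      using that
    proof (induction j arbitrary: x)
      case 0
      then show ?case using vs(1,2) start by (cases vs) auto
    next
      case (Suc j)
      then have "(vs ! j, Some x) \<in> E" using vs(1,5) vs(4)[of j] nth_mem[of j es] by auto
      moreover from this obtain w where "vs ! j = Some w" using no_None by (cases "vs ! j") auto
      ultimately show ?case using Suc step[of w x] by auto
    qed
    from this[of "length es" y] show ?thesis
      using vs(1,3) by (cases vs rule: rev_cases) (auto simp: nth_append)
  qed (use start in simp)
qed

text \<open>For a Green row Z the equation Z (I - P) = \<delta> at \<open>x0\<close> is the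
  divergence condition for z_e = Z_x p_e: the weights out of a vertex sum to 1, so the flux of z at
  x is Z_x.\<close>

lemma crossings_flow:
  assumes p: "p \<in> environments E"
  defines "z \<equiv> (\<chi> e. if e \<in> E then crossings E x0 p e else 0)"
  shows "z \<in> flow_domain E x0" and "env_of E z = p" and "flux E z x = green E p $ x0 $ x"
proof -
  define Z where "Z x = green E p $ x0 $ x" for x
  have eq: "Z y - (\<Sum>e\<in>in_edges E y. Z (the (fst e)) * p e) = (if y = x0 then 1 else 0)" for y
    using green_row[OF p, of y] unfolding Z_def vec_mat_one_minus .
  have "Z y = (if y = x0 then 1 else 0) + (\<Sum>x\<in>UNIV. Z x * P_U E p $ x $ y)" for y
    using eq[of y] unfolding sum_P_U_col by simp
  from flow_pos[OF p this] have pos: "0 < Z x" for x .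
  have zE: "z $ e = Z (the (fst e)) * p e" if "e \<in> E" for e
    using that by (simp add: z_def crossings_def Z_def)
  have out: "flux E z x = Z x" for x
  proof -
    have "flux E z x = (\<Sum>e\<in>out_edges E x. Z x * p e)"
      unfolding flux_def by (intro sum.cong) (auto simp: out_edges_def zE)
    then show ?thesis by (simp add: env_sum[OF p] flip: sum_distrib_left)
  qed
  then show "flux E z x = green E p $ x0 $ x" by (simp add: Z_def)
  have "(\<Sum>e\<in>in_edges E y. z $ e) = (\<Sum>e\<in>in_edges E y. Z (the (fst e)) * p e)" for y
    by (intro sum.cong) (auto simp: in_edges_def zE)
  then have "divergence E z y = (if y = x0 then 1 else 0)" for y
    using eq[of y] out[of y] by (simp add: divergence_def flux_def)
  then show "z \<in> flow_domain E x0"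
    using pos env_pos[OF p] by (auto simp: flow_domain_def flow_space_def zE) (simp add: z_def)
  have "env_of E z e = p e" for e
  proof (cases "e \<in> E")
    case True
    then have "env_of E z e = z $ e / Z (the (fst e))"
      by (simp add: env_of_def out)
    then show ?thesis unfolding zE[OF True] using pos[of "the (fst e)"] by simp
  next
    case False
    have "p \<in> extensional E" using p by (simp add: environments_def PiE_iff)
    from extensional_arb[OF this False] have "p e = undefined" .
    then show ?thesis using False by (simp add: env_of_def)
  qed
  then show "env_of E z = p" by (simp add: fun_eq_iff)
qed

lemma flux_pos: "z \<in> flow_domain E x0 \<Longrightarrow> 0 < flux E z x"
  unfolding flux_def using t_out[of x] by (intro sum_pos) (auto simp: flow_domain_def out_edges_def)

text \<open>Conversely, the divergence condition says that the fluxes of \<open>z\<close> solve the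
  row system of the matrix I - P of \<open>env_of E z\<close>. That matrix is regular, so the fluxes
  are the Green row at \<open>x0\<close>.\<close>

lemma env_of_flow:
  assumes z: "z \<in> flow_domain E x0"
  shows "env_of E z \<in> environments E" and "e \<in> E \<Longrightarrow> crossings E x0 (env_of E z) e = z $ e"
proof -
  let ?p = "env_of E z"
  have out: "?p e = z $ e / flux E z x" if "e \<in> out_edges E x" for e x
    using that by (auto simp: env_of_def out_edges_def)
  have sum: "(\<Sum>e\<in>out_edges E x. ?p e) = 1" for x
  proof -
    have "(\<Sum>e\<in>out_edges E x. ?p e) = (\<Sum>e\<in>out_edges E x. z $ e / flux E z x)"
      by (intro sum.cong refl out)
    also have "\<dots> = flux E z x / flux E z x" by (simp only: flux_def sum_divide_distrib)
    finally show ?thesis using flux_pos[OF z, of x] by simp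
  qed
  have pos: "0 < ?p e" if "e \<in> E" for e
    using that z flux_pos[OF z, of "the (fst e)"] by (auto simp: env_of_def flow_domain_def)
  have le: "?p e \<le> 1" if "e \<in> E" for e
  proof -
    have e: "e \<in> out_edges E (the (fst e))" using that fst_E by (simp add: out_edges_def)
    have "?p e \<le> (\<Sum>e\<in>out_edges E (the (fst e)). ?p e)"
      by (rule member_le_sum[OF e]) (auto simp: out_edges_def intro: less_imp_le pos)
    then show ?thesis by (simp add: sum)
  qed
  show env: "?p \<in> environments E"
    using pos le sum by (auto simp: environments_def env_of_def)
  have zE: "flux E z (the (fst e)) * ?p e = z $ e" if "e \<in> E" for e
    using that flux_pos[OF z, of "the (fst e)"] by (simp add: env_of_def)
  have row: "(\<Sum>x\<in>UNIV. flux E z x * (mat 1 - P_U E ?p) $ x $ y) = (if y = x0 then 1 else 0)" for y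
  proof -
    have "(\<Sum>e\<in>in_edges E y. flux E z (the (fst e)) * ?p e) = (\<Sum>e\<in>in_edges E y. z $ e)"
      by (intro sum.cong) (auto simp: in_edges_def zE)
    moreover have "divergence E z y = (if y = x0 then 1 else 0)"
      using z by (auto simp: flow_domain_def flow_space_def)
    ultimately show ?thesis
      unfolding vec_mat_one_minus by (simp add: divergence_def flux_def)
  qed
  have "flux E z k = green E ?p $ x0 $ k" for k
    using row_eqI[OF _ row, of k] det_pos[OF env]
    by (simp add: if_distrib[of "\<lambda>c. c * _"] cong: if_cong)
  then show "crossings E x0 ?p e = z $ e" if "e \<in> E"
    using zE[OF that] by (simp add: crossings_def)
qed

end

section \<open>The Jacobian\<close>

text \<open>The determinant of an n by n matrix whose size is a number rather than a type, since n
  is \<open>flow_dim E\<close>.\<close>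

definition leibniz :: "nat \<Rightarrow> (nat \<Rightarrow> nat \<Rightarrow> real) \<Rightarrow> real" where
  "leibniz n M = (\<Sum>\<pi> | \<pi> permutes {..<n}. of_int (sign \<pi>) * (\<Prod>i<n. M i (\<pi> i)))"

lemma leibniz_cong:
  assumes "\<And>i j. i < n \<Longrightarrow> j < n \<Longrightarrow> M i j = M' i j"
  shows "leibniz n M = leibniz n M'"
  unfolding leibniz_def
  by (intro sum.cong arg_cong2[of _ _ _ _ "(*)"] prod.cong refl assms)
    (auto simp: permutes_in_image[of _ "{..<n}", simplified])

lemma leibniz_scale_rows: "leibniz n (\<lambda>i j. M i j / c i) = leibniz n M / (\<Prod>i<n. c i)"
  by (simp add: leibniz_def prod_dividef sum_divide_distrib)

lemma wedge_conv_leibniz: "wedge n \<phi> v = leibniz n (\<lambda>i j. \<phi> i (v j))"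
  by (simp add: wedge_def leibniz_def)

lemma matrix_mult_nth: "(A ** B) $ i $ j = (\<Sum>k\<in>UNIV. A $ i $ k * B $ k $ j)"
  by (simp add: matrix_matrix_mult_def)

section \<open>Divergence-free vectors in non-tree coordinates\<close>

context killed_graph
begin

lemma flux_conv_tree:
  "flux E w x = w $ t x + (\<Sum>e\<in>out_edges E x - T. w $ e)"
  using sum.Int_Diff[of "out_edges E x" "\<lambda>e. w $ e" T] by (simp add: flux_def out_edges_T)

lemma sum_in_edges_tree:
  "(\<Sum>e\<in>in_edges E y. f e) = (\<Sum>x\<in>UNIV. if s x = Some y then f (t x) else 0)
     + (\<Sum>e\<in>E - T. if snd e = Some y then f e else 0 :: real)"
proof -
  have "(\<Sum>e\<in>in_edges E y. f e) = (\<Sum>e\<in>E. if snd e = Some y then f e else 0)"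
    unfolding in_edges_def by (intro sum.mono_neutral_cong_left) auto
  also have "\<dots> = (\<Sum>e\<in>T. if snd e = Some y then f e else 0) + (\<Sum>e\<in>E - T. if snd e = Some y then f e else 0)"
    using sum.subset_diff[OF tree, of "\<lambda>e. if snd e = Some y then f e else 0"] by simp
  finally show ?thesis by (simp add: T_range sum.reindex[OF inj_t])
qed

lemma sum_E_minus_T: "(\<Sum>e\<in>E - T. f e) = (\<Sum>x\<in>UNIV. \<Sum>e\<in>out_edges E x - T. f e)"
proof -
  have "E - T = (\<Union>x. out_edges E x - T)" by (subst E_eq) auto
  then show ?thesis
    by (simp only:) (rule sum.UNION_disjoint, auto simp: out_edges_def)
qed

lemma tau_nth: "P_U E (indicator T) $ x $ y = (if s x = Some y then 1 else 0)"
  using t_in_E[of x] by (auto simp: P_U_def functional_edges_iff indicator_def)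

text \<open>Conservation at \<open>y\<close> after each tree coordinate is written as the flux minus
  the other outgoing coordinates. Read over all \<open>y\<close>, it is a linear system for the
  fluxes with the transpose of I - P for the indicator of the tree as matrix and only non-tree data
  on the right.\<close>

lemma flux_conservation:
  assumes "divergence E w y = 0"
  shows "flux E w y - (\<Sum>x\<in>UNIV. (if s x = Some y then 1 else 0) * flux E w x) =
    (\<Sum>e\<in>E - T. ((if snd e = Some y then 1 else 0) - (if s (the (fst e)) = Some y then 1 else 0)) * w $ e)"
proof -
  have "flux E w y = (\<Sum>e\<in>in_edges E y. w $ e)" using assms by (simp add: divergence_def flux_def)
  also have "\<dots> = (\<Sum>x\<in>UNIV. if s x = Some y then w $ t x else 0)
     + (\<Sum>e\<in>E - T. if snd e = Some y then w $ e else 0)" by (rule sum_in_edges_tree)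
  also have "(\<Sum>x\<in>UNIV. if s x = Some y then w $ t x else 0) =
      (\<Sum>x\<in>UNIV. (if s x = Some y then 1 else 0) * flux E w x) -
      (\<Sum>x\<in>UNIV. \<Sum>e\<in>out_edges E x - T. (if s x = Some y then 1 else 0) * w $ e)"
    unfolding sum_subtractf[symmetric] sum_distrib_left[symmetric]
    by (intro sum.cong) (auto simp: flux_conv_tree)
  also have "(\<Sum>x\<in>UNIV. \<Sum>e\<in>out_edges E x - T. (if s x = Some y then 1 else 0) * w $ e) =
      (\<Sum>e\<in>E - T. (if s (the (fst e)) = Some y then 1 else 0) * w $ e)"
    unfolding sum_E_minus_T by (intro sum.cong) (auto simp: out_edges_def)
  finally show ?thesis
    by (simp add: algebra_simps sum_subtractf if_distrib[of "\<lambda>c. _ * c"] cong: if_cong)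
qed

text \<open>The system of \<open>flux_conservation\<close> is regular by \<open>det_tree\<close>. So
  the coordinates outside the tree determine the fluxes and, through them, the tree
  coordinates.\<close>

lemma flow_zero:
  assumes div: "\<And>y. divergence E w y = 0" and supp: "\<And>e. e \<notin> E - T \<Longrightarrow> e \<notin> T \<Longrightarrow> w $ e = 0"
    and zero: "\<And>e. e \<in> E - T \<Longrightarrow> w $ e = 0"
  shows "w = 0"
proof -
  have "(\<Sum>x\<in>UNIV. flux E w x * (mat 1 - P_U E (indicator T)) $ x $ y) = 0" for y
  proof -
    have "flux E w y - (\<Sum>x\<in>UNIV. (if s x = Some y then 1 else 0) * flux E w x) = 0"
      unfolding flux_conservation[OF div] using zero by (intro sum.neutral) auto
    then show ?thesis
      by (simp add: right_diff_distrib sum_subtractf mat_def tau_nth mult.commute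
          if_distrib[of "\<lambda>c. _ * c"] cong: if_cong)
  qed
  then have "flux E w k = (\<Sum>y\<in>UNIV. 0 * green E (indicator T) $ y $ k)" for k
    by (intro row_eqI) (simp_all add: det_tree)
  then have "w $ t x = 0" for x
    using zero flux_conv_tree[of w x] by (simp add: out_edges_def)
  then show ?thesis using supp zero by (auto simp: vec_eq_iff T_range image_iff) (metis surj_pair)
qed

text \<open>Eliminating the tree coordinates turns the Jacobian into \<open>I - A C\<close>, indexed by the edges
  outside the tree, and \<open>I - C A\<close> is indexed by the vertices; \<open>C\<close> expresses the vertex fluxes through
  the edges outside the tree.\<close>

lemma leibniz_jacobian:
  fixes e :: "nat \<Rightarrow> 'u edge" and v :: "nat \<Rightarrow> real^'u edge"
  assumes e: "bij_betw e {..<n} (E - T)"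
    and div: "\<And>j y. j < n \<Longrightarrow> divergence E (v j) y = 0"
    and supp: "\<And>j f. j < n \<Longrightarrow> f \<notin> E \<Longrightarrow> v j $ f = 0"
    and indep: "\<And>h j. (\<Sum>j<n. h j *\<^sub>R v j) = 0 \<Longrightarrow> j < n \<Longrightarrow> h j = 0"
    and p: "\<And>x. (\<Sum>f\<in>out_edges E x. p f) = 1"
  shows "leibniz n (\<lambda>i j. v j $ e i) \<noteq> 0"
    and "leibniz n (\<lambda>i j. v j $ e i - p (e i) * flux E (v j) (the (fst (e i)))) =
      det (mat 1 - P_U E p) * leibniz n (\<lambda>i j. v j $ e i)"
proof -
  define c where "c = inv_into {..<n} e"
  have inj: "inj_on e {..<n}" and im: "e ` {..<n} = E - T" using e by (auto simp: bij_betw_def)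
  have ce: "c (e j) = j" if "j < n" for j using that inj by (simp add: c_def)
  have cn: "c f < n" and ec: "e (c f) = f" if "f \<in> E - T" for f
    using that im inv_into_into[of f e "{..<n}"] f_inv_into_f[of f e "{..<n}"] by (auto simp: c_def)
  have eD: "e i \<in> E" "e i \<notin> T" if "i < n" for i using that im by auto
  have sum_e: "(\<Sum>f\<in>E - T. g f) = (\<Sum>j<n. g (e j))" for g :: "'u edge \<Rightarrow> real"
    unfolding im[symmetric] by (simp add: sum.reindex[OF inj])
  \<comment> \<open>All matrices are indexed by pairs of vertices, and a vertex x is represented by
    its tree edge \<open>t x\<close>. \<open>L\<close> holds the non-tree coordinates of the frame,
    \<open>W\<close> its fluxes, and \<open>A\<close> distributes the flux at x over the non-tree
    edges out of x with weights \<open>p\<close>.\<close>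
  define L :: "real^'u edge^'u edge" where
    "L = (\<chi> i j. if i \<in> E - T then (if j \<in> E - T then v (c j) $ i else 0) else if i = j then 1 else 0)"
  define W :: "real^'u edge^'u edge" where
    "W = (\<chi> i j. if i \<in> T \<and> j \<in> E - T then flux E (v (c j)) (the (fst i)) else 0)"
  define A :: "real^'u edge^'u edge" where
    "A = (\<chi> i k. if i \<in> E - T \<and> k \<in> T \<and> fst i = fst k then p i else 0)"
  have detL: "det L = leibniz n (\<lambda>i j. v j $ e i)"
  proof -
    have "det L = (\<Sum>\<pi> | \<pi> permutes {..<n}. of_int (sign \<pi>) * (\<Prod>i\<in>{..<n}. L $ e i $ e (\<pi> i)))"
      by (rule det_leibniz_embed[OF inj]) (auto simp: im L_def)
    also have "\<dots> = leibniz n (\<lambda>i j. L $ e i $ e j)" by (simp add: leibniz_def)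
    also have "\<dots> = leibniz n (\<lambda>i j. v j $ e i)"
      by (rule leibniz_cong) (simp add: L_def eD ce)
    finally show ?thesis .
  qed
  have invL: "invertible L"
  proof -
    have "h = 0" if h: "L *v h = 0" for h
    proof -
      have row: "(\<Sum>j\<in>UNIV. L $ i $ j * h $ j) = 0" for i
        using arg_cong[OF h, of "\<lambda>x. x $ i"] by (simp add: matrix_vector_mult_def)
      have out: "h $ i = 0" if "i \<notin> E - T" for i
      proof -
        have "(\<Sum>j\<in>UNIV. L $ i $ j * h $ j) = (\<Sum>j\<in>UNIV. if j = i then h $ j else 0)"
          using that by (intro sum.cong) (auto simp: L_def)
        then show ?thesis using row[of i] by simp
      qed
      define w where "w = (\<Sum>j<n. h $ e j *\<^sub>R v j)"
      have lin: "divergence E w y = (\<Sum>j<n. h $ e j * divergence E (v j) y)" for y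
        by (simp add: divergence_def w_def sum_distrib_left right_diff_distrib sum_subtractf
            sum.swap[of _ "{..<n}"])
      have "w = 0"
      proof (rule flow_zero)
        show "divergence E w y = 0" for y unfolding lin using div by simp
        show "w $ f = 0" if "f \<notin> E - T" "f \<notin> T" for f
          using that supp by (simp add: w_def)
        show "w $ f = 0" if f: "f \<in> E - T" for f
        proof -
          have "(\<Sum>j\<in>UNIV. L $ f $ j * h $ j) = (\<Sum>j\<in>E - T. v (c j) $ f * h $ j)"
            using f by (intro sum.mono_neutral_cong_right) (auto simp: L_def)
          also have "\<dots> = w $ f" unfolding sum_e by (simp add: w_def ce mult.commute)
          finally show ?thesis using row by simp
        qed
      qed
      then have "h $ e j = 0" if "j < n" for j using indep[of "\<lambda>j. h $ e j" j] that by (simp add: w_def)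
      then have "h $ f = 0" if "f \<in> E - T" for f using that im by (metis imageE lessThan_iff)
      then show "h = 0" using out by (auto simp: vec_eq_iff)
    qed
    then show ?thesis
      using matrix_left_invertible_ker[of L] invertible_left_inverse[of L] by blast
  qed
  then show "leibniz n (\<lambda>i j. v j $ e i) \<noteq> 0" using detL invertible_det_nz[of L] by auto
  \<comment> \<open>The linear map from non-tree coordinates to fluxes, which does not depend on the
    frame.\<close>
  define C where "C = W ** matrix_inv L"
  have CL: "C ** L = W"
    unfolding C_def matrix_mul_assoc[symmetric] matrix_inv_inverse[OF invL] by simp
  have C0: "C $ i $ j = 0" if "i \<notin> T \<or> j \<notin> E - T" for i j
  proof (cases "j \<in> E - T")
    case True
    then have "W $ i $ k = 0" for k using that by (simp add: W_def)
    then show ?thesis by (simp add: C_def matrix_matrix_mult_def)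
  next
    case False
    then have "(C ** L) $ i $ j = (\<Sum>k\<in>UNIV. if k = j then C $ i $ k else 0)"
      unfolding matrix_mult_nth by (intro sum.cong) (auto simp: L_def)
    then show ?thesis using False by (auto simp: CL W_def split: if_splits)
  qed
  have A0: "A $ i $ k = 0" if "i \<notin> E - T \<or> k \<notin> T" for i k using that by (auto simp: A_def)
  \<comment> \<open>\<open>A\<close> goes from tree indices to non-tree indices and \<open>C\<close>
    goes back, so both squares vanish, as \<open>det_one_minus_mult_commute\<close>
    requires.\<close>
  have AA: "A ** A = 0"
  proof -
    have zero: "A $ i $ k * A $ k $ j = 0" for i j k using A0[of i k] A0[of k j] by auto
    have "(A ** A) $ i $ j = 0" for i j unfolding matrix_mult_nth by (intro sum.neutral ballI zero)
    then show ?thesis by (simp add: vec_eq_iff)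
  qed
  have CC: "C ** C = 0"
  proof -
    have zero: "C $ i $ k * C $ k $ j = 0" for i j k using C0[of i k] C0[of k j] by auto
    have "(C ** C) $ i $ j = 0" for i j unfolding matrix_mult_nth by (intro sum.neutral ballI zero)
    then show ?thesis by (simp add: vec_eq_iff)
  qed
  have AW: "(A ** W) $ f $ j = p f * flux E (v (c j)) (the (fst f))" if f: "f \<in> E - T" and j: "j \<in> E - T" for f j
  proof -
    obtain x where x: "fst f = Some x" using fst_E f by blast
    have "(A ** W) $ f $ j = (\<Sum>k\<in>UNIV. if k = t x then p f * flux E (v (c j)) x else 0)"
      unfolding matrix_mult_nth using f j x
      by (intro sum.cong) (auto simp: A_def W_def T_out functional_edges_iff)
    then show ?thesis by (simp add: x)
  qed
  \<comment> \<open>On the non-tree block, \<open>K\<close> has the entries dz_e - p_e dZ_x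
    evaluated on the frame, that is, the matrix of the claim.\<close>
  define K where "K = (mat 1 - A ** C) ** L"
  have K: "K = L - A ** W"
    by (simp add: K_def matrix_mult_distribs CL flip: matrix_mul_assoc)
  have AWout: "(A ** W) $ i $ j = 0" if "i \<notin> E - T" for i j
    using A0 that by (simp add: matrix_matrix_mult_def)
  have "det K = (\<Sum>\<pi> | \<pi> permutes {..<n}. of_int (sign \<pi>) * (\<Prod>i\<in>{..<n}. K $ e i $ e (\<pi> i)))"
    by (rule det_leibniz_embed[OF inj]) (auto simp: im K L_def AWout)
  also have "\<dots> = leibniz n (\<lambda>i j. K $ e i $ e j)" by (simp add: leibniz_def)
  also have "\<dots> = leibniz n (\<lambda>i j. v j $ e i - p (e i) * flux E (v j) (the (fst (e i))))"
    by (rule leibniz_cong) (simp add: K AW L_def eD ce)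
  finally have detK: "leibniz n (\<lambda>i j. v j $ e i - p (e i) * flux E (v j) (the (fst (e i)))) = det K" ..
  \<comment> \<open>The matrix I - C A read on vertices.\<close>
  define R :: "real^'u^'u" where "R = (\<chi> y x. (if y = x then 1 else 0) - (\<Sum>f\<in>out_edges E x - T. C $ t y $ f * p f))"
  have CA: "(C ** A) $ i $ t x = (\<Sum>f\<in>out_edges E x - T. C $ i $ f * p f)" for i x
  proof -
    have "(C ** A) $ i $ t x = (\<Sum>f\<in>UNIV. C $ i $ f * A $ f $ t x)" by (simp add: matrix_matrix_mult_def)
    also have "\<dots> = (\<Sum>f\<in>out_edges E x - T. C $ i $ f * p f)"
      by (rule sum.mono_neutral_cong_right) (auto simp: A_def out_edges_def functional_edges_iff)
    finally show ?thesis .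
  qed
  have detR: "det (mat 1 - C ** A) = det R"
  proof -
    have "det (mat 1 - C ** A) = (\<Sum>\<pi> | \<pi> permutes UNIV. of_int (sign \<pi>) * (\<Prod>y\<in>UNIV. (mat 1 - C ** A) $ t y $ t (\<pi> y)))"
    proof (rule det_leibniz_embed[OF inj_t])
      fix i j assume "i \<notin> range t"
      then have "i \<notin> T" by (simp add: T_range)
      then have "(C ** A) $ i $ j = 0" using C0[of i] by (simp add: matrix_matrix_mult_def)
      then show "(mat 1 - C ** A) $ i $ j = (if i = j then 1 else 0)" by (simp add: mat_def)
    qed
    also have "\<dots> = det R"
    proof -
      have "(mat 1 - C ** A) $ t y $ t x = R $ y $ x" for y x
        by (simp only: vector_minus_component CA) (auto simp: R_def mat_def)
      then show ?thesis by (simp only: det_def)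
    qed
    finally show ?thesis .
  qed
  define b where "b y f = (if snd f = Some y then 1 else 0) - (if s (the (fst f)) = Some y then 1 else 0 :: real)"
    for y and f :: "'u edge"
  \<comment> \<open>The conservation law holds for each column of \<open>L\<close>; multiplication
    by the inverse of \<open>L\<close> turns it into a law for \<open>C\<close> that no longer
    mentions the frame.\<close>
  have tau: "C $ t y $ f - (\<Sum>x\<in>UNIV. (if s x = Some y then 1 else 0) * C $ t x $ f) = b y f" if f: "f \<in> E - T" for y f
  proof -
    have W: "W $ t y $ j - (\<Sum>x\<in>UNIV. (if s x = Some y then 1 else 0) * W $ t x $ j) =
       (\<Sum>g\<in>E - T. b y g * L $ g $ j)" for j
    proof (cases "j \<in> E - T")
      case True
      have "W $ t x $ j = flux E (v (c j)) x" for x using True by (auto simp: W_def functional_edges_iff)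
      moreover have "(\<Sum>g\<in>E - T. b y g * L $ g $ j) = (\<Sum>g\<in>E - T. b y g * v (c j) $ g)"
        using True by (intro sum.cong) (auto simp: L_def)
      ultimately show ?thesis
        using flux_conservation[OF div[OF cn[OF True]], of y] by (simp add: b_def)
    next
      case False
      then have "W $ t x $ j = 0" for x by (auto simp: W_def)
      moreover have "(\<Sum>g\<in>E - T. b y g * L $ g $ j) = 0"
        using False by (intro sum.neutral) (auto simp: L_def)
      ultimately show ?thesis by simp
    qed
    have Cx: "C $ i $ f = (\<Sum>j\<in>UNIV. W $ i $ j * matrix_inv L $ j $ f)" for i
      by (simp add: C_def matrix_matrix_mult_def)
    have "C $ t y $ f - (\<Sum>x\<in>UNIV. (if s x = Some y then 1 else 0) * C $ t x $ f) =
       (\<Sum>j\<in>UNIV. (W $ t y $ j - (\<Sum>x\<in>UNIV. (if s x = Some y then 1 else 0) * W $ t x $ j)) * matrix_inv L $ j $ f)"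
      unfolding Cx left_diff_distrib sum_subtractf sum_distrib_left sum_distrib_right
      by (subst sum.swap) (simp add: mult.assoc)
    also have "\<dots> = (\<Sum>g\<in>E - T. b y g * (L ** matrix_inv L) $ g $ f)"
      unfolding W sum_distrib_right matrix_mult_nth
      by (subst sum.swap) (simp add: sum_distrib_left mult.assoc)
    also have "\<dots> = b y f"
      unfolding matrix_inv_inverse[OF invL] using f
      by (simp add: mat_def if_distrib[of "\<lambda>c. _ * c"] cong: if_cong)
    finally show ?thesis .
  qed
  \<comment> \<open>The tree factor undoes the elimination: by \<open>tau\<close> it replaces
    \<open>C\<close> by the explicit incidence \<open>b\<close>, and the non-tree weights at x sum
    to \<open>1 - p (t x)\<close>, which restores the tree entry. As the tree factor has determinant
    1, taking determinants finishes the proof.\<close>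
  have "transpose (mat 1 - P_U E (indicator T)) ** R = transpose (mat 1 - P_U E p)"
  proof -
    have "(transpose (mat 1 - P_U E (indicator T)) ** R) $ y $ x = transpose (mat 1 - P_U E p) $ y $ x" for y x
    proof -
      have Nv: "(\<Sum>k\<in>UNIV. transpose (mat 1 - P_U E (indicator T)) $ y $ k * g k) =
          g y - (\<Sum>k\<in>UNIV. (if s k = Some y then 1 else 0) * g k)" for g
        by (simp add: transpose_def tau_nth mat_def left_diff_distrib sum_subtractf
            if_distrib[of "\<lambda>c. c * _"] cong: if_cong)
      have "(transpose (mat 1 - P_U E (indicator T)) ** R) $ y $ x =
          R $ y $ x - (\<Sum>k\<in>UNIV. (if s k = Some y then 1 else 0) * R $ k $ x)"
        by (simp only: matrix_mult_nth Nv)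
      also have "\<dots> = (if y = x then 1 else 0) - (if s x = Some y then 1 else 0) -
          (\<Sum>f\<in>out_edges E x - T. (C $ t y $ f - (\<Sum>k\<in>UNIV. (if s k = Some y then 1 else 0) * C $ t k $ f)) * p f)"
      proof -
        have "(\<Sum>k\<in>UNIV. (if s k = Some y then 1 else 0) * R $ k $ x) =
            (if s x = Some y then 1 else 0) - (\<Sum>k\<in>UNIV. \<Sum>f\<in>out_edges E x - T. (if s k = Some y then 1 else 0) * C $ t k $ f * p f)"
          by (simp add: R_def right_diff_distrib sum_subtractf sum_distrib_left mult.assoc
              if_distrib[of "\<lambda>c. _ * c"] cong: if_cong)
        also have "(\<Sum>k\<in>UNIV. \<Sum>f\<in>out_edges E x - T. (if s k = Some y then 1 else 0) * C $ t k $ f * p f) =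
            (\<Sum>f\<in>out_edges E x - T. (\<Sum>k\<in>UNIV. (if s k = Some y then 1 else 0) * C $ t k $ f) * p f)"
          unfolding sum_distrib_right by (rule sum.swap)
        finally show ?thesis by (simp add: R_def left_diff_distrib sum_subtractf)
      qed
      also have "(\<Sum>f\<in>out_edges E x - T. (C $ t y $ f - (\<Sum>k\<in>UNIV. (if s k = Some y then 1 else 0) * C $ t k $ f)) * p f) =
          (\<Sum>f\<in>out_edges E x - T. (if snd f = Some y then p f else 0) - (if s x = Some y then 1 else 0) * p f)"
        by (intro sum.cong refl, subst tau) (auto simp: out_edges_def b_def)
      also have "\<dots> = (\<Sum>f\<in>out_edges E x - T. if snd f = Some y then p f else 0) -
          (if s x = Some y then 1 else 0) * (1 - p (t x))"
      proof -
        have "(\<Sum>f\<in>out_edges E x - T. p f) = 1 - p (t x)"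
          using sum.Int_Diff[of "out_edges E x" p T] p[of x] by (simp add: out_edges_T)
        then show ?thesis by (simp add: sum_subtractf flip: sum_distrib_left)
      qed
      also have "(\<Sum>f\<in>out_edges E x - T. if snd f = Some y then p f else 0) =
          P_U E p $ x $ y - (if s x = Some y then p (t x) else 0)"
      proof -
        have "(\<Sum>f\<in>out_edges E x. if snd f = Some y then p f else 0) = P_U E p $ x $ y"
        proof -
          have "(\<Sum>f\<in>out_edges E x. if snd f = Some y then p f else 0) =
             (\<Sum>f\<in>out_edges E x. p f * (case snd f of None \<Rightarrow> 0 | Some y' \<Rightarrow> if y' = y then 1 else 0))"
            by (intro sum.cong) (auto split: option.splits)
          also have "\<dots> = P_U E p $ x $ y" unfolding sum_P_U_row[symmetric]
            by (simp add: if_distrib[of "\<lambda>c. _ * c"] cong: if_cong)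
          finally show ?thesis .
        qed
        then show ?thesis
          using sum.Int_Diff[of "out_edges E x" "\<lambda>f. if snd f = Some y then p f else 0" T]
          unfolding out_edges_T by simp
      qed
      finally show ?thesis
        by (cases "s x = Some y"; cases "x = y") (simp_all add: transpose_def mat_def algebra_simps)
    qed
    then show ?thesis by (simp add: vec_eq_iff)
  qed
  from arg_cong[OF this, of det] have "det R = det (mat 1 - P_U E p)"
    by (simp add: det_mul det_transpose det_tree)
  then show "leibniz n (\<lambda>i j. v j $ e i - p (e i) * flux E (v j) (the (fst (e i)))) =
      det (mat 1 - P_U E p) * leibniz n (\<lambda>i j. v j $ e i)"
    unfolding detK detL[symmetric] K_def det_mul det_one_minus_mult_commute[OF AA CC] detR by simp
qed

end

section \<open>The Dirichlet environment\<close>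

definition selector :: "'u::finite edge set \<Rightarrow> ('u \<Rightarrow> 'u edge) \<Rightarrow> bool" where
  "selector E r \<longleftrightarrow> (\<forall>x. r x \<in> out_edges E x)"

lemma selectorD: "selector E r \<Longrightarrow> r x \<in> E" "selector E r \<Longrightarrow> fst (r x) = Some x"
  by (simp_all add: selector_def out_edges_def)

lemma selector_not_range:
  assumes "selector E r" "e \<in> out_edges E x" "e \<noteq> r x"
  shows "e \<in> E - range r"
  using assms selectorD(2)[OF assms(1)] by (auto simp: out_edges_def)

lemma selector_inj: "selector E r \<Longrightarrow> inj r"
  by (metis injI option.inject selectorD(2))

lemma complete_env_nth:
  "e \<in> E \<Longrightarrow> complete_env E r q e = (if e = r (the (fst e))
     then 1 - (\<Sum>e'\<in>out_edges E (the (fst e)) - {r (the (fst e))}. q e') else q e)"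
  by (simp add: complete_env_def Let_def)

lemma complete_env_measurable [measurable]:
  assumes r: "selector E r"
  shows "complete_env E r \<in> PiL (E - range r) \<rightarrow>\<^sub>M PiM E (\<lambda>_. borel)"
  unfolding complete_env_def Let_def
proof (rule measurable_restrict)
  fix e assume e: "e \<in> E"
  show "(\<lambda>q. if e = r (the (fst e)) then 1 - sum q (out_edges E (the (fst e)) - {r (the (fst e))}) else q e)
    \<in> PiL (E - range r) \<rightarrow>\<^sub>M borel"
  proof (cases "e = r (the (fst e))")
    case True
    have "(\<lambda>q. q e') \<in> borel_measurable (PiL (E - range r))" if "e' \<in> out_edges E x - {r x}" for e' x
      using measurable_component_singleton[OF selector_not_range[OF r, of e' x], of "\<lambda>_. lborel"] that by simp
    then have "(\<lambda>q. 1 - sum q (out_edges E (the (fst e)) - {r (the (fst e))})) \<in> borel_measurable (PiL (E - range r))"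
      by (intro borel_measurable_diff borel_measurable_sum) auto
    then show ?thesis using True by simp
  next
    case False
    then have "e \<in> E - range r" using e selectorD(2)[OF r] by auto
    from measurable_component_singleton[OF this, of "\<lambda>_. lborel"] show ?thesis using False by simp
  qed
qed

lemma environments_measurable [measurable]: "environments E \<in> sets (PiM E (\<lambda>_. borel))"
  for E :: "'u::finite edge set"
proof -
  have comp: "(\<lambda>p. p e) \<in> borel_measurable (PiM E (\<lambda>_. borel :: real measure))" if "e \<in> E" for e
    using that by measurable
  have sums: "(\<lambda>p. \<Sum>e\<in>out_edges E x. p e) \<in> borel_measurable (PiM E (\<lambda>_. borel :: real measure))" for x
    using comp by (intro borel_measurable_sum) (auto simp: out_edges_def)
  have "environments E = Pi\<^sub>E E (\<lambda>_. {0<..1}) \<inter>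
     (\<Inter>x. {p \<in> space (PiM E (\<lambda>_. borel :: real measure)). (\<Sum>e\<in>out_edges E x. p e) = 1})"
    by (auto simp: environments_def space_PiM PiE_iff extensional_def)
  also have "\<dots> \<in> sets (PiM E (\<lambda>_. borel))"
  proof (rule sets.Int)
    show "Pi\<^sub>E E (\<lambda>_. {0<..1}) \<in> sets (PiM E (\<lambda>_. borel :: real measure))"
      by (intro sets_PiM_I_finite) auto
    have "{p \<in> space (PiM E (\<lambda>_. borel :: real measure)). (\<Sum>e\<in>out_edges E x. p e) = 1} \<in> sets (PiM E (\<lambda>_. borel))" for x
      using sums[of x] by measurable
    then show "(\<Inter>x. {p \<in> space (PiM E (\<lambda>_. borel :: real measure)). (\<Sum>e\<in>out_edges E x. p e) = 1})
        \<in> sets (PiM E (\<lambda>_. borel))"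
      by (intro sets.countable_INT') auto
  qed
  finally show ?thesis .
qed

section \<open>Independence of the omitted edges\<close>

lemma nn_integral_lborel_reflect:
  fixes g :: "real \<Rightarrow> ennreal"
  assumes "g \<in> borel_measurable borel"
  shows "(\<integral>\<^sup>+y. g y \<partial>lborel) = (\<integral>\<^sup>+y. g (c - y) \<partial>lborel)"
  using nn_integral_real_affine[of g "-1" c] assms by simp

text \<open>With all other free weights fixed, the weights of the old and the new omitted edge at x
  have a fixed sum. Exchanging their roles is a reflection of one real variable, which preserves
  Lebesgue measure.\<close>

lemma nn_integral_complete_env_step:
  assumes r: "selector E r" and b: "b \<in> out_edges E x" "b \<noteq> r x"
    and f[measurable]: "f \<in> borel_measurable (PiM E (\<lambda>_. borel))"
  shows "(\<integral>\<^sup>+q. f (complete_env E r q) \<partial>PiL (E - range r)) =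
    (\<integral>\<^sup>+q. f (complete_env E (r(x := b)) q) \<partial>PiL (E - range (r(x := b))))"
proof -
  interpret product_sigma_finite "\<lambda>_. lborel :: real measure" by standard
  let ?r' = "r(x := b)" and ?a = "r x"
  have r': "selector E ?r'" using r b by (auto simp: selector_def)
  have a: "?a \<in> out_edges E x" using r by (simp add: selector_def)
  have bn: "b \<notin> range r" using selector_not_range[OF r b] by simp
  have bx: "fst b = Some x" and bE: "b \<in> E" using b by (auto simp: out_edges_def)
  have an: "?a \<notin> range ?r'" using selector_not_range[OF r' a] b by auto
  define D where "D = E - range r - {b}"
  have D: "finite D" "b \<notin> D" "?a \<notin> D" by (auto simp: D_def)
  have eq: "E - range r = insert b D" using bE bn by (auto simp: D_def)
  have eq': "E - range ?r' = insert ?a D"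
  proof -
    define R where "R = r ` (UNIV - {x})"
    have R: "range ?r' = insert b R" "range r = insert ?a R" by (auto simp: R_def)
    have "?a \<notin> R" using selector_inj[OF r] by (auto simp: R_def dest: injD)
    then show ?thesis unfolding D_def R using b(2) selectorD(1)[OF r, of x] by blast
  qed
  define S where "S q = (\<Sum>e\<in>out_edges E x - {?a, b}. q e)" for q :: "'a edge \<Rightarrow> real"
  have comp: "complete_env E r (q(b := 1 - S q - y)) = complete_env E ?r' (q(?a := y))" for q y
  proof (rule ext)
    fix e :: "'a edge"
    let ?w = "the (fst e)"
    have sum: "(\<Sum>e'\<in>X. (q(g := z)) e') = (\<Sum>e'\<in>X. q e')" if "g \<notin> X" for X z and g :: "'a edge"
      using that by (intro sum.cong) auto
    show "complete_env E r (q(b := 1 - S q - y)) e = complete_env E ?r' (q(?a := y)) e"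
    proof (cases "e \<in> E")
      case True
      consider "?w \<noteq> x" | "?w = x" "e = ?a" | "?w = x" "e = b" | "?w = x" "e \<noteq> ?a" "e \<noteq> b" by blast
      then show ?thesis
      proof cases
        case 1
        have "b \<notin> out_edges E ?w" "?a \<notin> out_edges E ?w"
          using 1 bx a by (auto simp: out_edges_def)
        moreover have "e \<noteq> b" "e \<noteq> ?a" using 1 bx a by (auto simp: out_edges_def)
        ultimately show ?thesis
          using 1 by (simp add: complete_env_nth True sum fun_upd_other del: fun_upd_apply)
      next
        case 2
        have "(\<Sum>e'\<in>out_edges E x - {?a}. (q(b := 1 - S q - y)) e') = 1 - S q - y + S q"
        proof -
          have "out_edges E x - {?a} = insert b (out_edges E x - {?a, b})" using b by auto
          then show ?thesis by (simp add: sum S_def fun_upd_same del: fun_upd_apply)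
        qed
        then show ?thesis using 2 b True by (simp add: complete_env_nth)
      next
        case 3
        have "(\<Sum>e'\<in>out_edges E x - {b}. (q(?a := y)) e') = y + S q"
        proof -
          have "out_edges E x - {b} = insert ?a (out_edges E x - {?a, b})" using a b by auto
          then show ?thesis by (simp add: sum S_def fun_upd_same del: fun_upd_apply)
        qed
        then show ?thesis using 3 b True by (simp add: complete_env_nth)
      next
        case 4
        then show ?thesis using True by (simp add: complete_env_nth)
      qed
    qed (simp add: complete_env_def)
  qed
  have m: "(\<lambda>q. f (complete_env E r q)) \<in> borel_measurable (PiL (insert b D))"
    using measurable_compose[OF complete_env_measurable[OF r] f] by (simp only: eq)
  have m': "(\<lambda>q. f (complete_env E ?r' q)) \<in> borel_measurable (PiL (insert ?a D))"
    using measurable_compose[OF complete_env_measurable[OF r'] f] by (simp only: eq')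
  have "(\<integral>\<^sup>+q. f (complete_env E r q) \<partial>PiL (E - range r)) =
      (\<integral>\<^sup>+q. \<integral>\<^sup>+y. f (complete_env E r (q(b := y))) \<partial>lborel \<partial>PiL D)"
    unfolding eq by (rule product_nn_integral_insert[OF D(1,2) m])
  also have "\<dots> = (\<integral>\<^sup>+q. \<integral>\<^sup>+y. f (complete_env E r (q(b := 1 - S q - y))) \<partial>lborel \<partial>PiL D)"
  proof (rule nn_integral_cong)
    fix q assume q: "q \<in> space (PiL D)"
    have "(\<lambda>y. f (complete_env E r (q(b := y)))) \<in> borel_measurable lborel"
      using measurable_compose[OF measurable_component_update[OF q D(2)] m] by simp
    then show "(\<integral>\<^sup>+y. f (complete_env E r (q(b := y))) \<partial>lborel) =
        (\<integral>\<^sup>+y. f (complete_env E r (q(b := 1 - S q - y))) \<partial>lborel)"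
      by (intro nn_integral_lborel_reflect) simp
  qed
  also have "\<dots> = (\<integral>\<^sup>+q. f (complete_env E ?r' q) \<partial>PiL (E - range ?r'))"
    unfolding comp eq' by (rule product_nn_integral_insert[OF D(1,3) m', symmetric])
  finally show ?thesis .
qed

lemma nn_integral_complete_env_indep:
  assumes r: "selector E r" and r': "selector E r'"
    and f[measurable]: "f \<in> borel_measurable (PiM E (\<lambda>_. borel))"
  shows "(\<integral>\<^sup>+q. f (complete_env E r q) \<partial>PiL (E - range r)) =
    (\<integral>\<^sup>+q. f (complete_env E r' q) \<partial>PiL (E - range r'))"
proof -
  define m where "m X x = (if x \<in> X then r' x else r x)" for X x
  have m: "selector E (m X)" for X using r r' by (auto simp: m_def selector_def)
  have "(\<integral>\<^sup>+q. f (complete_env E r q) \<partial>PiL (E - range r)) =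
    (\<integral>\<^sup>+q. f (complete_env E (m X) q) \<partial>PiL (E - range (m X)))" for X
  proof (induction X rule: finite_induct[OF finite])
    case 1
    have "m {} = r" by (auto simp: m_def)
    then show ?case by simp
  next
    case (2 x X)
    have upd: "m (insert x X) = (m X)(x := r' x)" by (auto simp: m_def)
    show ?case
    proof (cases "r' x = m X x")
      case True
      then have "m (insert x X) = m X" unfolding upd by auto
      then show ?thesis using 2 by simp
    next
      case False
      show ?thesis
        unfolding 2(3) upd using False r' by (intro nn_integral_complete_env_step m f) (auto simp: selector_def)
    qed
  qed
  from this[of UNIV] show ?thesis by (simp add: m_def[abs_def])
qed

section \<open>The Dirichlet measure: density, mass and support\<close>

definition dirichlet_density :: "'u::finite edge set \<Rightarrow> ('u edge \<Rightarrow> real) \<Rightarrow> ('u edge \<Rightarrow> real) \<Rightarrow> real" where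
  "dirichlet_density E \<alpha> p = indicator (environments E) p * (C_const E \<alpha> * (\<Prod>e\<in>E. p e powr (\<alpha> e - 1)))"

lemma dirichlet_density_measurable [measurable]:
  "dirichlet_density E \<alpha> \<in> borel_measurable (PiM E (\<lambda>_. borel))"
proof -
  have "(\<lambda>p. \<Prod>e\<in>E. p e powr (\<alpha> e - 1)) \<in> borel_measurable (PiM E (\<lambda>_. borel :: real measure))"
    by (intro borel_measurable_prod) measurable
  then show ?thesis unfolding dirichlet_density_def[abs_def] by measurable
qed

lemma dirichlet_env_eq:
  "dirichlet_env E \<alpha> r = distr (density (PiL (E - range r)) (\<lambda>q. ennreal (dirichlet_density E \<alpha> (complete_env E r q))))
     (PiM E (\<lambda>_. borel)) (complete_env E r)"
  by (simp add: dirichlet_env_def dirichlet_density_def)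

lemma emeasure_dirichlet_env:
  assumes r: "selector E r" and A: "A \<in> sets (PiM E (\<lambda>_. borel))"
  shows "emeasure (dirichlet_env E \<alpha> r) A =
    (\<integral>\<^sup>+q. ennreal (dirichlet_density E \<alpha> (complete_env E r q)) * indicator A (complete_env E r q) \<partial>PiL (E - range r))"
proof -
  note [measurable] = complete_env_measurable[OF r] A
  have "emeasure (dirichlet_env E \<alpha> r) A = (\<integral>\<^sup>+q. ennreal (dirichlet_density E \<alpha> (complete_env E r q)) *
      indicator (complete_env E r -` A \<inter> space (PiL (E - range r))) q \<partial>PiL (E - range r))"
    unfolding dirichlet_env_eq by (rule emeasure_distr_density) measurable
  also have "\<dots> = (\<integral>\<^sup>+q. ennreal (dirichlet_density E \<alpha> (complete_env E r q)) * indicator A (complete_env E r q) \<partial>PiL (E - range r))"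
    by (intro nn_integral_cong) (auto simp: indicator_def)
  finally show ?thesis .
qed

lemma sets_dirichlet_env [simp, measurable_cong]: "sets (dirichlet_env E \<alpha> r) = sets (PiM E (\<lambda>_. borel))"
  by (simp add: dirichlet_env_def)

lemma space_dirichlet_env [simp]: "space (dirichlet_env E \<alpha> r) = space (PiM E (\<lambda>_. borel))"
  by (simp add: dirichlet_env_def)

text \<open>Used twice: to omit the tree edges, so that the free weights are those outside the tree,
  and to omit edges of large weight when the total mass is bounded.\<close>

lemma dirichlet_env_indep:
  assumes r: "selector E r" and r': "selector E r'"
  shows "dirichlet_env E \<alpha> r = dirichlet_env E \<alpha> r'"
proof (rule measure_eqI)
  fix A assume "A \<in> sets (dirichlet_env E \<alpha> r)"
  then have A[measurable]: "A \<in> sets (PiM E (\<lambda>_. borel))" by simp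
  show "emeasure (dirichlet_env E \<alpha> r) A = emeasure (dirichlet_env E \<alpha> r') A"
    unfolding emeasure_dirichlet_env[OF r A] emeasure_dirichlet_env[OF r' A]
    by (rule nn_integral_complete_env_indep[OF r r', of "\<lambda>p. ennreal (dirichlet_density E \<alpha> p) * indicator A p"]) measurable
qed simp

lemma C_const_pos:
  assumes "selector E r" "\<forall>e\<in>E. 0 < \<alpha> e"
  shows "0 < C_const E \<alpha>"
proof -
  have "0 < beta E \<alpha> x" for x
  proof -
    have ne: "out_edges E x \<noteq> {}" using assms(1) by (auto simp: selector_def)
    show ?thesis
      unfolding beta_def by (rule sum_pos[OF finite ne]) (use assms(2) in \<open>simp add: out_edges_def\<close>)
  qed
  then show ?thesis unfolding C_const_def using assms(2)
    by (intro divide_pos_pos prod_pos) (auto intro!: Gamma_real_pos)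
qed

lemma nn_integral_powr_unit:
  assumes "0 < a"
  shows "(\<integral>\<^sup>+y. ennreal (indicator {0<..1} y * y powr (a - 1)) \<partial>lborel) < \<infinity>"
proof -
  have I: "((\<lambda>y. y powr (a - 1)) has_integral (1 powr (a - 1 + 1) / (a - 1 + 1))) {0..1}"
    by (rule has_integral_powr_from_0) (use assms in auto)
  have "(\<integral>\<^sup>+y. ennreal (indicator {0<..1} y * y powr (a - 1)) \<partial>lborel) \<le>
      (\<integral>\<^sup>+y. ennreal (indicator {0..1} y * y powr (a - 1)) \<partial>lborel)"
    by (intro nn_integral_mono) (auto simp: indicator_def)
  also have "\<dots> < \<infinity>"
    by (subst nn_integral_has_integral_lebesgue[OF _ I]) auto
  finally show ?thesis .
qed

text \<open>Every environment has, at each vertex, an edge of weight at least \<open>1 / |E|\<close>. Leaving out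
  such edges, the density is dominated by an integrable product.\<close>

lemma emeasure_dirichlet_env_finite:
  assumes r: "selector E r" and \<alpha>: "\<forall>e\<in>E. 0 < \<alpha> e"
  shows "emeasure (dirichlet_env E \<alpha> r) (space (dirichlet_env E \<alpha> r)) < \<infinity>"
proof -
  define k where "k = real (card E)"
  have "E \<noteq> {}" using selectorD(1)[OF r] by auto
  then have k: "1 \<le> k" by (simp add: k_def Suc_le_eq card_gt_0_iff)
  define B where "B \<sigma> = {p \<in> space (PiM E (\<lambda>_. borel)). \<forall>x. 1 / k \<le> p (\<sigma> x)}" for \<sigma> :: "'a \<Rightarrow> 'a edge"
  have B[measurable]: "B \<sigma> \<in> sets (PiM E (\<lambda>_. borel))" if "selector E \<sigma>" for \<sigma>
  proof -
    have [measurable]: "(\<lambda>p. p (\<sigma> x)) \<in> borel_measurable (PiM E (\<lambda>_. borel :: real measure))" for x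
      using selectorD(1)[OF that] by measurable
    show ?thesis unfolding B_def by measurable
  qed
  have cover: "environments E \<subseteq> (\<Union>\<sigma>\<in>{\<sigma>. selector E \<sigma>}. B \<sigma>)"
  proof
    fix p assume p: "p \<in> environments E"
    have "\<exists>e. e \<in> out_edges E x \<and> 1 / k \<le> p e" for x
    proof (rule ccontr)
      assume neg: "\<nexists>e. e \<in> out_edges E x \<and> 1 / k \<le> p e"
      have ne: "out_edges E x \<noteq> {}" using r by (auto simp: selector_def)
      have "(\<Sum>e\<in>out_edges E x. p e) < (\<Sum>e\<in>out_edges E x. 1 / k)"
        using neg ne by (intro sum_strict_mono) (auto simp: not_le)
      also have "\<dots> \<le> (\<Sum>e\<in>E. 1 / k)"
        using k by (intro sum_mono2) (auto simp: out_edges_def)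
      also have "\<dots> = 1" using \<open>E \<noteq> {}\<close> by (simp add: k_def)
      finally show False using p by (simp add: environments_def)
    qed
    then obtain \<sigma> where "\<And>x. \<sigma> x \<in> out_edges E x" "\<And>x. 1 / k \<le> p (\<sigma> x)" by metis
    moreover have "p \<in> space (PiM E (\<lambda>_. borel))" using p by (auto simp: environments_def space_PiM PiE_iff)
    ultimately show "p \<in> (\<Union>\<sigma>\<in>{\<sigma>. selector E \<sigma>}. B \<sigma>)" by (auto simp: B_def selector_def)
  qed
  have finite_part: "emeasure (dirichlet_env E \<alpha> \<sigma>) (B \<sigma>) < \<infinity>" if \<sigma>: "selector E \<sigma>" for \<sigma>
  proof -
    interpret product_sigma_finite "\<lambda>_. lborel :: real measure" by standard
    \<comment> \<open>One factor \<open>k\<close> per omitted edge: \<open>p powr (\<alpha> - 1) = p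
      powr \<alpha> / p \<le> 1 / p \<le> k\<close> whenever \<open>1 / k \<le> p \<le> 1\<close>,
      for small and large \<open>\<alpha>\<close> alike.\<close>
    define c where "c = C_const E \<alpha> * (\<Prod>x\<in>(UNIV :: 'a set). k)"
    have c: "0 \<le> c" using C_const_pos[OF r \<alpha>] k unfolding c_def by (intro mult_nonneg_nonneg prod_nonneg) auto
    let ?u = "\<lambda>e y. ennreal (indicator {0<..1} y * y powr (\<alpha> e - 1))"
    have bound: "ennreal (dirichlet_density E \<alpha> (complete_env E \<sigma> q)) * indicator (B \<sigma>) (complete_env E \<sigma> q) \<le>
        ennreal c * (\<Prod>e\<in>E - range \<sigma>. ?u e (q e))" for q
    proof (cases "complete_env E \<sigma> q \<in> environments E \<inter> B \<sigma>")
      case True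
      define p where "p = complete_env E \<sigma> q"
      have p01: "0 < p e" "p e \<le> 1" if "e \<in> E" for e
        using True PiE_mem[of p E "\<lambda>_. {0<..1}" e] that by (auto simp: environments_def p_def)
      have pq: "p e = q e" if "e \<in> E - range \<sigma>" for e
        using that by (auto simp: p_def complete_env_def Let_def)
      have "(\<Prod>e\<in>E. p e powr (\<alpha> e - 1)) = (\<Prod>e\<in>E - range \<sigma>. p e powr (\<alpha> e - 1)) * (\<Prod>e\<in>range \<sigma>. p e powr (\<alpha> e - 1))"
        using selectorD(1)[OF \<sigma>] by (intro prod.subset_diff) auto
      also have "(\<Prod>e\<in>range \<sigma>. p e powr (\<alpha> e - 1)) = (\<Prod>x\<in>UNIV. p (\<sigma> x) powr (\<alpha> (\<sigma> x) - 1))"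
        using selector_inj[OF \<sigma>] by (simp add: prod.reindex)
      also have "\<dots> \<le> (\<Prod>x\<in>(UNIV :: 'a set). k)"
      proof (intro prod_mono conjI)
        fix x
        have le: "1 / k \<le> p (\<sigma> x)" using True by (simp add: B_def p_def)
        have pos: "0 < p (\<sigma> x)" "p (\<sigma> x) \<le> 1" using p01 selectorD(1)[OF \<sigma>] by auto
        have "p (\<sigma> x) powr (\<alpha> (\<sigma> x) - 1) = p (\<sigma> x) powr \<alpha> (\<sigma> x) / p (\<sigma> x)"
          using pos by (simp add: powr_diff)
        also have "\<dots> \<le> 1 / p (\<sigma> x)"
          using pos \<alpha> selectorD(1)[OF \<sigma>, of x] by (intro divide_right_mono powr_le1) (auto intro: less_imp_le)
        also have "\<dots> \<le> k" using le pos k by (simp add: field_simps)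
        finally show "p (\<sigma> x) powr (\<alpha> (\<sigma> x) - 1) \<le> k" .
      qed simp
      finally have "(\<Prod>e\<in>E. p e powr (\<alpha> e - 1)) \<le> (\<Prod>e\<in>E - range \<sigma>. p e powr (\<alpha> e - 1)) * (\<Prod>x\<in>(UNIV :: 'a set). k)"
        by (simp add: mult_left_mono prod_nonneg)
      then have "dirichlet_density E \<alpha> p \<le> c * (\<Prod>e\<in>E - range \<sigma>. p e powr (\<alpha> e - 1))"
        using True C_const_pos[OF r \<alpha>] by (simp add: dirichlet_density_def p_def[symmetric] c_def mult_ac)
      also have "(\<Prod>e\<in>E - range \<sigma>. p e powr (\<alpha> e - 1)) = (\<Prod>e\<in>E - range \<sigma>. indicator {0<..1} (q e) * q e powr (\<alpha> e - 1))"
      proof (rule prod.cong)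
        fix e assume e: "e \<in> E - range \<sigma>"
        then show "p e powr (\<alpha> e - 1) = indicator {0<..1} (q e) * q e powr (\<alpha> e - 1)"
          using p01[of e] pq[OF e] by simp
      qed simp
      finally have "ennreal (dirichlet_density E \<alpha> p) \<le>
          ennreal (c * (\<Prod>e\<in>E - range \<sigma>. indicator {0<..1} (q e) * q e powr (\<alpha> e - 1)))"
        by (rule ennreal_leI)
      also have "\<dots> = ennreal c * (\<Prod>e\<in>E - range \<sigma>. ?u e (q e))"
      proof (subst ennreal_mult)
        show "ennreal c * ennreal (\<Prod>e\<in>E - range \<sigma>. indicator {0<..1} (q e) * q e powr (\<alpha> e - 1)) =
            ennreal c * (\<Prod>e\<in>E - range \<sigma>. ?u e (q e))"
          by (subst prod_ennreal) simp_all
      qed (use c in \<open>simp_all add: prod_nonneg\<close>)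
      finally show ?thesis using True by (simp add: p_def)
    next
      case False
      then show ?thesis by (auto simp: dirichlet_density_def indicator_def)
    qed
    have "emeasure (dirichlet_env E \<alpha> \<sigma>) (B \<sigma>) \<le> (\<integral>\<^sup>+q. ennreal c * (\<Prod>e\<in>E - range \<sigma>. ?u e (q e)) \<partial>PiL (E - range \<sigma>))"
      unfolding emeasure_dirichlet_env[OF \<sigma> B[OF \<sigma>]] by (intro nn_integral_mono bound)
    also have "\<dots> = ennreal c * (\<integral>\<^sup>+q. (\<Prod>e\<in>E - range \<sigma>. ?u e (q e)) \<partial>PiL (E - range \<sigma>))"
      by (rule nn_integral_cmult) (auto intro!: borel_measurable_prod_ennreal)
    also have "\<dots> = ennreal c * (\<Prod>e\<in>E - range \<sigma>. \<integral>\<^sup>+y. ?u e y \<partial>lborel)"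
      by (subst product_nn_integral_prod) auto
    also have "\<dots> < \<infinity>"
    proof -
      have "(\<Prod>e\<in>X. \<integral>\<^sup>+y. ?u e y \<partial>lborel) < \<infinity>" if "X \<subseteq> E" for X
        using finite[of X] that
      proof (induction X rule: finite_induct)
        case (insert e X)
        then show ?case using nn_integral_powr_unit[of "\<alpha> e"] \<alpha> by (simp add: ennreal_mult_less_top)
      qed simp
      then show ?thesis by (auto simp: ennreal_mult_less_top)
    qed
    finally show ?thesis .
  qed
  have fin: "finite {\<sigma>. selector E \<sigma>}" by simp
  have "emeasure (dirichlet_env E \<alpha> r) (space (dirichlet_env E \<alpha> r)) =
      emeasure (dirichlet_env E \<alpha> r) (environments E)"
    unfolding space_dirichlet_env emeasure_dirichlet_env[OF r sets.top] emeasure_dirichlet_env[OF r environments_measurable]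
    using measurable_space[OF complete_env_measurable[OF r]]
    by (intro nn_integral_cong) (auto simp: dirichlet_density_def indicator_def)
  also have "\<dots> \<le> emeasure (dirichlet_env E \<alpha> r) (\<Union>\<sigma>\<in>{\<sigma>. selector E \<sigma>}. B \<sigma>)"
    using B fin by (intro emeasure_mono cover) auto
  also have "\<dots> \<le> (\<Sum>\<sigma> | selector E \<sigma>. emeasure (dirichlet_env E \<alpha> r) (B \<sigma>))"
    using B fin by (intro emeasure_subadditive_finite) auto
  \<comment> \<open>The measure of each \<open>B \<sigma>\<close> is computed with
    \<open>\<sigma>\<close> as the omitted edges, which is legitimate because the law does not
    depend on that choice.\<close>
  also have "\<dots> < \<infinity>"
    using finite_part dirichlet_env_indep[OF r] by (auto simp: less_top)
  finally show ?thesis .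
qed

lemma AE_dirichlet_env:
  assumes r: "selector E r"
  shows "AE p in dirichlet_env E \<alpha> r. p \<in> environments E"
proof (rule AE_I)
  let ?N = "space (PiM E (\<lambda>_. borel)) - environments E"
  show "{p \<in> space (dirichlet_env E \<alpha> r). p \<notin> environments E} \<subseteq> ?N" by auto
  show N: "?N \<in> sets (dirichlet_env E \<alpha> r)" by simp
  then have "emeasure (dirichlet_env E \<alpha> r) ?N = (\<integral>\<^sup>+q. 0 \<partial>PiL (E - range r))"
    by (subst emeasure_dirichlet_env[OF r], simp, intro nn_integral_cong)
      (auto simp: dirichlet_density_def indicator_def)
  then show "emeasure (dirichlet_env E \<alpha> r) ?N = 0" by simp
qed

section \<open>Measurability of the functional\<close>

lemma borel_measurable_det:
  fixes A :: "'b \<Rightarrow> real^'n::finite^'n"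
  assumes "\<And>x y. (\<lambda>p. A p $ x $ y) \<in> borel_measurable M"
  shows "(\<lambda>p. det (A p)) \<in> borel_measurable M"
  unfolding det_def using assms by measurable

lemma borel_measurable_one_minus_P_U:
  "(\<lambda>p. (mat 1 - P_U E p) $ x $ y) \<in> borel_measurable (PiM E (\<lambda>_. borel :: real measure))"
proof -
  have "(\<lambda>p. P_U E p $ x $ y) \<in> borel_measurable (PiM E (\<lambda>_. borel :: real measure))"
    by (cases "(Some x, Some y) \<in> E") (simp_all add: P_U_def)
  then show ?thesis by simp
qed

lemma env_functional_measurable [measurable]:
  assumes T: "T \<subseteq> E" and E: "\<And>v. (None, v) \<notin> E"
  shows "env_functional E x0 T l \<in> borel_measurable (PiM E (\<lambda>_. borel))"
proof -
  let ?M = "PiM E (\<lambda>_. borel :: real measure)"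
  have p[measurable]: "(\<lambda>p. p e) \<in> borel_measurable ?M" if "e \<in> E" for e using that by measurable
  note N = borel_measurable_one_minus_P_U[of E] and det = borel_measurable_det
  have G[measurable]: "(\<lambda>p. green E p $ x $ y) \<in> borel_measurable ?M" for x y
  proof -
    have "(\<lambda>p. det (\<chi> k l. if l = x then axis y 1 $ k else (mat 1 - P_U E p) $ k $ l)) \<in> borel_measurable ?M"
    proof (rule det)
      fix k l
      show "(\<lambda>p. (\<chi> k l. if l = x then axis y 1 $ k else (mat 1 - P_U E p) $ k $ l) $ k $ l) \<in> borel_measurable ?M"
        using N[of k l] by (cases "l = x") simp_all
    qed
    then show ?thesis
      unfolding green_def matrix_inv_nth[of "mat 1 - P_U E _"] using det[OF N] by measurable
  qed
  have cr[measurable]: "(\<lambda>p. crossings E x0 p e) \<in> borel_measurable ?M" if "e \<in> E" for e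
    unfolding crossings_def using that by measurable
  have "(\<lambda>p. \<Sum>e\<in>E. l e * complex_of_real (crossings E x0 p e)) \<in> borel_measurable ?M"
    by (intro borel_measurable_sum borel_measurable_times borel_measurable_const)
      (auto intro!: measurable_compose[OF cr borel_measurable_of_real])
  moreover have "(\<lambda>p. \<Prod>e\<in>T. p e) \<in> borel_measurable ?M"
    using T by (intro borel_measurable_prod p) auto
  ultimately show ?thesis
    unfolding env_functional_def[abs_def] using det[OF N] by measurable
qed

section \<open>The chart of the flow domain\<close>

lemma inj_hat_edge: "inj hat_edge"
  by (rule inj_on_inverseI[where g = "\<lambda>(v, w). (map_option snd v, map_option snd w)"])
    (auto simp: option.map_comp o_def option.map_ident)

lemma hat_edge_neq_hat_vertex_edge: "hat_edge e \<noteq> hat_vertex_edge x"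
  by (cases e) (auto simp: hat_vertex_edge_def)

lemma hat_edge_disjoint: "hat_edge ` A \<inter> range hat_vertex_edge = {}"
proof (rule equals0I)
  fix f assume "f \<in> hat_edge ` A \<inter> range hat_vertex_edge"
  then obtain g x where "f = hat_edge g" "f = hat_vertex_edge x" by blast
  then show False using hat_edge_neq_hat_vertex_edge[of g x] by simp
qed

text \<open>Consequently the logarithmic form involves only the coordinates z_e of edges outside the
  tree, never a flux.\<close>

lemma hat_lift_diff: "T \<subseteq> E \<Longrightarrow> hat_lift E - hat_lift T = hat_edge ` (E - T)"
  unfolding hat_lift_def image_set_diff[OF inj_hat_edge]
  using hat_edge_disjoint[of E] by blast

lemma prod_hat_lift:
  fixes f :: "('u::finite) hat_edge \<Rightarrow> real"
  shows "(\<Prod>e\<in>hat_lift E. f e) = (\<Prod>e\<in>E. f (hat_edge e)) * (\<Prod>x\<in>UNIV. f (hat_vertex_edge x))"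
proof -
  have inj: "inj hat_vertex_edge" by (auto simp: inj_def hat_vertex_edge_def)
  have "(\<Prod>e\<in>hat_lift E. f e) = (\<Prod>e\<in>hat_edge ` E. f e) * (\<Prod>e\<in>range hat_vertex_edge. f e)"
    unfolding hat_lift_def by (rule prod.union_disjoint) (auto simp: hat_edge_disjoint)
  then show ?thesis
    by (simp add: prod.reindex[OF inj] prod.reindex[OF inj_on_subset[OF inj_hat_edge]])
qed

lemma flow_spaceD:
  assumes "z \<in> flow_space E x0"
  shows "divergence E z x = (if x = x0 then 1 else 0)" and "f \<notin> E \<Longrightarrow> z $ f = 0"
  using assms unfolding flow_space_def by blast+

lemma complete_env_restrict:
  assumes r: "selector E r" and p: "p \<in> environments E"
  shows "complete_env E r (restrict p (E - range r)) = p"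
proof (rule ext)
  fix e
  have ext: "p \<in> extensional E" using p by (simp add: environments_def PiE_iff)
  show "complete_env E r (restrict p (E - range r)) e = p e"
  proof (cases "e \<in> E")
    case True
    show ?thesis
    proof (cases "e = r (the (fst e))")
      case e: True
      let ?x = "the (fst e)"
      have "(\<Sum>e'\<in>out_edges E ?x - {r ?x}. restrict p (E - range r) e') = (\<Sum>e'\<in>out_edges E ?x - {r ?x}. p e')"
        using selector_not_range[OF r] by (intro sum.cong) auto
      also have "\<dots> = 1 - p (r ?x)"
        using p r sum.remove[of "out_edges E ?x" "r ?x" p] by (simp add: environments_def selector_def)
      finally show ?thesis using True e by (simp add: complete_env_nth)
    next
      case False
      then have "e \<notin> range r" using selectorD(2)[OF r] by auto
      then show ?thesis using True False by (simp add: complete_env_nth)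
    qed
  next
    case False
    from extensional_arb[OF ext False] show ?thesis using False by (simp add: complete_env_def)
  qed
qed

lemma restrict_complete_env:
  assumes r: "selector E r" and q: "q \<in> extensional (E - range r)"
  shows "restrict (complete_env E r q) (E - range r) = q"
proof (rule ext)
  fix e
  show "restrict (complete_env E r q) (E - range r) e = q e"
  proof (cases "e \<in> E - range r")
    case True
    then have "e \<noteq> r (the (fst e))" by auto
    then show ?thesis using True by (simp add: complete_env_nth)
  next
    case False
    from extensional_arb[OF q False] show ?thesis using False by (simp only: restrict_apply if_False)
  qed
qed

section \<open>The affine frame and its orientation\<close>

locale framed_graph = killed_graph +
  fixes a :: "real^'a edge" and v :: "nat \<Rightarrow> real^'a edge" and es :: "'a hat_edge list"
  assumes frame: "affine_frame E x0 a v"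
    and es: "distinct es" "set es = hat_lift E - hat_lift T"
begin

abbreviation n :: nat where "n \<equiv> flow_dim E"

abbreviation fr :: "(nat \<Rightarrow> real) \<Rightarrow> real^'a edge" where "fr \<equiv> frame_map n a v"

definition e :: "nat \<Rightarrow> 'a edge" where "e i = inv hat_edge (es ! i)"

lemma selector_t: "selector E t"
  using t_out by (simp add: selector_def)

lemma flow_dim_eq: "n = card (E - T)"
proof -
  have "card T = CARD('a)" unfolding T_range by (rule card_image[OF inj_t])
  then show ?thesis using card_Diff_subset[OF _ tree] by (simp add: flow_dim_def)
qed

lemma set_es: "set es = hat_edge ` (E - T)"
  using es(2) hat_lift_diff[OF tree] by simp

lemma length_es: "length es = n"
  using distinct_card[OF es(1)] card_image[OF inj_on_subset[OF inj_hat_edge subset_UNIV], of "E - T"]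
  by (simp add: set_es flow_dim_eq)

lemma hat_edge_e: "i < n \<Longrightarrow> es ! i = hat_edge (e i)"
proof -
  assume "i < n"
  then have "es ! i \<in> hat_edge ` (E - T)" using nth_mem[of i es] by (simp add: length_es set_es)
  then obtain f where "es ! i = hat_edge f" by auto
  then show ?thesis by (simp only: e_def inv_f_f[OF inj_hat_edge])
qed

lemma bij_e: "bij_betw e {..<n} (E - T)"
proof -
  have "bij_betw (\<lambda>i. es ! i) {..<n} (hat_edge ` (E - T))"
    using bij_betw_nth[OF es(1), of "{..<n}" "set es"] by (simp add: length_es set_es lessThan_atLeast0)
  moreover have "bij_betw (inv hat_edge) (hat_edge ` (E - T)) (E - T)"
    by (rule bij_betw_imageI) (auto simp: inj_on_def inv_f_f[OF inj_hat_edge] image_image)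
  ultimately have "bij_betw (inv hat_edge \<circ> (\<lambda>i. es ! i)) {..<n} (E - T)"
    by (rule bij_betw_trans)
  then show ?thesis by (simp add: e_def[abs_def] o_def)
qed

lemma e_in: "i < n \<Longrightarrow> e i \<in> E - T"
  using bij_e by (auto simp: bij_betw_def)

lemma prod_e: "(\<Prod>f\<in>E - T. g f) = (\<Prod>i<n. g (e i))"
  using prod.reindex_bij_betw[OF bij_e, of g] by simp

lemma bij_fr: "bij_betw fr ({..<n} \<rightarrow>\<^sub>E UNIV) (flow_space E x0)"
  using frame by (simp add: affine_frame_def)

lemma fr_flow: "u \<in> extensional {..<n} \<Longrightarrow> fr u \<in> flow_space E x0"
  using bij_fr by (auto simp: bij_betw_def PiE_def)

lemma fr_inj: "u \<in> extensional {..<n} \<Longrightarrow> u' \<in> extensional {..<n} \<Longrightarrow> fr u = fr u' \<Longrightarrow> u = u'"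
  using bij_fr by (auto simp: bij_betw_def inj_on_def PiE_def)

lemma fr_restrict: "fr (restrict u {..<n}) = fr u"
  by (simp add: frame_map_def)

lemma fr_nth: "fr u $ f = a $ f + (\<Sum>j<n. u j * v j $ f)"
  by (simp add: frame_map_def)

lemma flux_fr: "flux E (fr u) x = flux E a x + (\<Sum>j<n. u j * flux E (v j) x)"
  unfolding flux_def fr_nth sum.distrib sum_distrib_left by (subst sum.swap) simp

lemma divergence_add: "divergence E (z + w) x = divergence E z x + divergence E w x"
  by (simp add: divergence_def sum.distrib)

text \<open>Both \<open>a\<close> and \<open>a + v j\<close> are values of the chart, so
  \<open>v j\<close> is a difference of two flows and satisfies the homogeneous equations.\<close>

lemma frame_directions:
  assumes "j < n"
  shows "divergence E (v j) x = 0" and "f \<notin> E \<Longrightarrow> v j $ f = 0"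
proof -
  have a: "a \<in> flow_space E x0"
    using fr_flow[of "restrict (\<lambda>_. 0) {..<n}"] by (simp add: fr_restrict) (simp add: frame_map_def)
  have "(\<Sum>i<n. (if i = j then 1 else 0) *\<^sub>R v i) = v j"
    using assms by (simp add: if_distrib[of "\<lambda>c. c *\<^sub>R _"] cong: if_cong)
  then have "a + v j \<in> flow_space E x0"
    using fr_flow[of "restrict (\<lambda>i. if i = j then 1 else 0) {..<n}"]
    by (simp only: fr_restrict restrict_extensional) (simp add: frame_map_def)
  note av = flow_spaceD[OF this]
  show "divergence E (v j) x = 0" "f \<notin> E \<Longrightarrow> v j $ f = 0"
    using av(1)[of x] av(2)[of f] flow_spaceD(1)[OF a, of x] flow_spaceD(2)[OF a, of f] by (simp_all add: divergence_add)
qed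

lemma frame_independent:
  assumes "(\<Sum>j<n. h j *\<^sub>R v j) = 0" "j < n"
  shows "h j = 0"
proof -
  have "fr (restrict h {..<n}) = fr (restrict (\<lambda>_. 0) {..<n})"
    using assms(1) by (simp only: fr_restrict) (simp add: frame_map_def)
  then have "restrict h {..<n} = restrict (\<lambda>_. 0) {..<n}" by (intro fr_inj) auto
  from fun_cong[OF this, of j] show ?thesis using assms(2) by simp
qed

text \<open>The value of the wedge of the dz_e, in the order of \<open>es\<close>, on the frame. It
  is independent of the point, and its sign decides the orientation of \<open>es\<close>.\<close>

definition orient :: real where "orient = leibniz n (\<lambda>i j. v j $ e i)"

lemma jacobian:
  assumes "\<And>x. (\<Sum>f\<in>out_edges E x. p f) = 1"
  shows "leibniz n (\<lambda>i j. v j $ e i - p (e i) * flux E (v j) (the (fst (e i)))) = det (mat 1 - P_U E p) * orient"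
  unfolding orient_def
proof (rule leibniz_jacobian(2)[OF bij_e])
  show "divergence E (v j) y = 0" if "j < n" for j y using frame_directions(1)[OF that] .
  show "v j $ f = 0" if "j < n" "f \<notin> E" for j f using frame_directions(2)[OF that] .
  show "h j = 0" if "(\<Sum>j<n. h j *\<^sub>R v j) = 0" "j < n" for h j using frame_independent[OF that] .
qed (rule assms)

text \<open>The uniform weights: a concrete environment, used for \<open>orient_nonzero\<close> and
  for \<open>flow_domain_nonempty\<close>.\<close>

lemma sum_uniform: "(\<Sum>f\<in>out_edges E x. 1 / real (card (out_edges E (the (fst f))))) = 1"
proof -
  have "out_edges E x \<noteq> {}" using t_out[of x] by auto
  moreover have "(\<Sum>f\<in>out_edges E x. 1 / real (card (out_edges E (the (fst f))))) =
      (\<Sum>f\<in>out_edges E x. 1 / real (card (out_edges E x)))"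
    by (intro sum.cong) (auto simp: out_edges_def)
  ultimately show ?thesis by simp
qed

lemma orient_nonzero: "orient \<noteq> 0"
  unfolding orient_def
proof (rule leibniz_jacobian(1)[OF bij_e])
  show "divergence E (v j) y = 0" if "j < n" for j y using frame_directions(1)[OF that] .
  show "v j $ f = 0" if "j < n" "f \<notin> E" for j f using frame_directions(2)[OF that] .
  show "h j = 0" if "(\<Sum>j<n. h j *\<^sub>R v j) = 0" "j < n" for h j using frame_independent[OF that] .
qed (rule sum_uniform)

lemma log_form_eq: "log_form E es z v = orient / (\<Prod>f\<in>E - T. z $ f)"
proof -
  have "log_form E es z v = leibniz n (\<lambda>i j. v j $ e i / z $ e i)"
    unfolding log_form_def wedge_conv_leibniz length_es
    by (rule leibniz_cong) (simp add: hat_edge_e hat_coord_def)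
  then show ?thesis by (simp add: leibniz_scale_rows orient_def prod_e)
qed

lemma prod_flow_pos: "z \<in> flow_domain E x0 \<Longrightarrow> 0 < (\<Prod>f\<in>E - T. z $ f)"
  by (intro prod_pos) (auto simp: flow_domain_def)

lemma oriented:
  "positively_oriented E x0 v es \<or> negatively_oriented E x0 v es"
  using orient_nonzero prod_flow_pos unfolding positively_oriented_def negatively_oriented_def log_form_eq
  by (cases "0 < orient") (auto intro: divide_pos_pos divide_neg_pos)

section \<open>The chart from flows to environment coordinates\<close>

definition env :: "(nat \<Rightarrow> real) \<Rightarrow> 'a edge \<Rightarrow> real" where "env u = env_of E (fr u)"

definition S :: "(nat \<Rightarrow> real) set" where "S = chart_domain E x0 a v"

lemma S_iff: "u \<in> S \<longleftrightarrow> u \<in> extensional {..<n} \<and> fr u \<in> flow_domain E x0"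
  by (simp add: S_def chart_domain_def PiE_def)

lemma env_in: "u \<in> S \<Longrightarrow> env u \<in> environments E"
  using env_of_flow(1) by (simp add: S_iff env_def)

lemma fr_measurable [measurable]: "(\<lambda>u. fr u $ f) \<in> borel_measurable (PiL {..<n})"
  unfolding fr_nth by measurable

lemma flux_fr_measurable [measurable]: "(\<lambda>u. flux E (fr u) x) \<in> borel_measurable (PiL {..<n})"
  unfolding flux_def by measurable

lemma env_measurable [measurable]: "env \<in> PiL {..<n} \<rightarrow>\<^sub>M PiM E (\<lambda>_. borel)"
  unfolding env_def[abs_def] env_of_def by (rule measurable_restrict) measurable

lemma S_measurable [measurable]: "S \<in> sets (PiL {..<n})"
proof -
  have "S = {u \<in> space (PiL {..<n}). \<forall>f\<in>E. 0 < fr u $ f}"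
    using fr_flow by (auto simp: S_iff flow_domain_def space_PiM PiE_def)
  also have "\<dots> \<in> sets (PiL {..<n})" by measurable
  finally show ?thesis .
qed

abbreviation coords :: "(nat \<Rightarrow> real) \<Rightarrow> 'a edge \<Rightarrow> real" where
  "coords u \<equiv> restrict (env u) (E - T)"

lemma complete_coords: "u \<in> S \<Longrightarrow> complete_env E t (coords u) = env u"
  using complete_env_restrict[OF selector_t env_in] by (simp add: T_range)

lemma coords_measurable [measurable]: "coords \<in> PiL {..<n} \<rightarrow>\<^sub>M PiL (E - T)"
proof (rule measurable_restrict)
  fix f assume "f \<in> E - T"
  then have "f \<in> E" by simp
  then have "(\<lambda>p. p f) \<in> PiM E (\<lambda>_. borel) \<rightarrow>\<^sub>M (borel :: real measure)" by measurable
  from measurable_compose[OF env_measurable this]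
  show "(\<lambda>u. env u f) \<in> PiL {..<n} \<rightarrow>\<^sub>M lborel" by simp
qed

text \<open>The coordinates outside the tree determine the environment, the environment determines
  the flow as its crossing numbers, and the frame map is injective.\<close>

lemma coords_inj: "inj_on coords S"
proof (rule inj_onI)
  fix u u' assume u: "u \<in> S" "u' \<in> S" and "coords u = coords u'"
  then have "env u = env u'" using complete_coords by metis
  then have "fr u $ f = fr u' $ f" if "f \<in> E" for f
    using env_of_flow(2)[of "fr u" f] env_of_flow(2)[of "fr u'" f] u that by (simp add: S_iff env_def)
  moreover have "fr u $ f = 0" "fr u' $ f = 0" if "f \<notin> E" for f
    using u by (auto simp: S_iff flow_domain_def intro: flow_spaceD(2)[OF _ that])
  ultimately have "fr u = fr u'" by (metis vec_eq_iff)
  then show "u = u'" using u fr_inj by (simp add: S_iff)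
qed

text \<open>Surjectivity comes from \<open>crossings_flow\<close>: the crossing numbers of an
  environment form a flow that induces it.\<close>

lemma coords_image: "coords ` S = {q \<in> space (PiL (E - T)). complete_env E t q \<in> environments E}"
proof (intro set_eqI iffI)
  fix q assume "q \<in> coords ` S"
  then obtain u where u: "u \<in> S" "q = coords u" by auto
  then have "complete_env E t q \<in> environments E" using env_in by (simp add: complete_coords)
  then show "q \<in> {q \<in> space (PiL (E - T)). complete_env E t q \<in> environments E}"
    using u by (simp add: space_PiM PiE_def)
next
  fix q assume "q \<in> {q \<in> space (PiL (E - T)). complete_env E t q \<in> environments E}"
  then have q: "q \<in> extensional (E - T)" and p: "complete_env E t q \<in> environments E"
    by (auto simp: space_PiM PiE_def)
  let ?z = "\<chi> f. if f \<in> E then crossings E x0 (complete_env E t q) f else 0"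
  have z: "?z \<in> flow_domain E x0" "env_of E ?z = complete_env E t q"
    using crossings_flow[OF p] by auto
  then have "?z \<in> fr ` ({..<n} \<rightarrow>\<^sub>E UNIV)"
    using bij_fr by (simp add: bij_betw_def flow_domain_def)
  then obtain u where u: "u \<in> extensional {..<n}" "fr u = ?z" by (auto simp: PiE_def)
  have "u \<in> S" using u z by (simp add: S_iff)
  moreover have "coords u = q"
    using restrict_complete_env[OF selector_t] q by (simp add: env_def u z T_range)
  ultimately show "q \<in> coords ` S" by (metis imageI)
qed

lemma coords_image_measurable [measurable]: "coords ` S \<in> sets (PiL (E - T))"
proof -
  have m: "complete_env E t \<in> PiL (E - T) \<rightarrow>\<^sub>M PiM E (\<lambda>_. borel)"
    using complete_env_measurable[OF selector_t] by (simp add: T_range)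
  have "coords ` S = complete_env E t -` environments E \<inter> space (PiL (E - T))"
    unfolding coords_image by auto
  then show ?thesis using measurable_sets[OF m environments_measurable] by simp
qed

definition J :: "(nat \<Rightarrow> real) \<Rightarrow> real" where
  "J u = \<bar>det (mat 1 - P_U E (env u)) * orient / (\<Prod>i<n. flux E (fr u) (the (fst (e i))))\<bar>"

lemma det_env_measurable [measurable]: "(\<lambda>u. det (mat 1 - P_U E (env u))) \<in> borel_measurable (PiL {..<n})"
  using measurable_compose[OF env_measurable borel_measurable_det[OF borel_measurable_one_minus_P_U]] .

lemma J_measurable [measurable]: "J \<in> borel_measurable (PiL {..<n})"
  unfolding J_def[abs_def] by measurable

lemma nn_integral_chart:
  assumes g: "g \<in> borel_measurable (PiL (E - T))"
  shows "(\<integral>\<^sup>+u. indicator S u * ennreal (J u) * g (coords u) \<partial>PiL {..<n}) =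
    (\<integral>\<^sup>+q. indicator (coords ` S) q * g q \<partial>PiL (E - T))"
proof -
  \<comment> \<open>The vectors must be indexed by a finite well-ordered type with at least n
    elements. \<open>'a edge bit0\<close> is one, with twice as many elements as there are pairs of
    vertices.\<close>
  have "card {..<n} \<le> CARD('a edge bit0)"
    using card_mono[of UNIV "E - T"] by (simp add: flow_dim_eq)
  then obtain \<iota> :: "nat \<Rightarrow> 'a edge bit0" where \<iota>: "inj_on \<iota> {..<n}"
    using card_le_inj[of "{..<n}" "UNIV :: 'a edge bit0 set"] by auto
  \<comment> \<open>The quotient rule for z_e / Z_x, with z_e / Z_x written as the weight again;
    only the denominator Z_x then remains, and it scales the whole row.\<close>
  define D where "D u i k = (v k $ e i - env u (e i) * flux E (v k) (the (fst (e i)))) / flux E (fr u) (the (fst (e i)))"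
    for u i k
  show ?thesis
  proof (rule nn_integral_PiL_change_of_variables[where e = e and D = D,
        OF _ \<iota> bij_e S_measurable coords_measurable coords_image_measurable coords_inj _ J_measurable _ g])
    fix x :: "real^'a edge bit0" and i
    let ?u = "\<lambda>x::real^'a edge bit0. \<lambda>k\<in>{..<n}. x $ \<iota> k" and ?w = "the (fst (e i))"
    assume S: "?u x \<in> S" and "i \<in> {..<n}"
    then have i: "e i \<in> E" "e i \<in> E - T" using e_in by auto
    have pos: "0 < flux E (fr (?u x)) ?w" using S by (intro flux_pos) (simp add: S_iff)
    have lin: "((\<lambda>x::real^'a edge bit0. c + (\<Sum>k<n. x $ \<iota> k * b k)) has_derivative (\<lambda>h. \<Sum>k<n. h $ \<iota> k * b k)) (at x)"
      for c and b :: "nat \<Rightarrow> real"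
      by (auto intro!: derivative_eq_intros bounded_linear_imp_has_derivative bounded_linear_vec_nth)
    have num: "fr (?u x) $ e i = a $ e i + (\<Sum>k<n. x $ \<iota> k * v k $ e i)" for x
      by (simp add: fr_nth)
    have den: "flux E (fr (?u x)) ?w = flux E a ?w + (\<Sum>k<n. x $ \<iota> k * flux E (v k) ?w)" for x
      by (simp add: flux_fr)
    have "((\<lambda>x. fr (?u x) $ e i / flux E (fr (?u x)) ?w) has_derivative
       (\<lambda>h. ((\<Sum>k<n. h $ \<iota> k * v k $ e i) * flux E (fr (?u x)) ?w - fr (?u x) $ e i * (\<Sum>k<n. h $ \<iota> k * flux E (v k) ?w))
          / (flux E (fr (?u x)) ?w * flux E (fr (?u x)) ?w))) (at x)"
      unfolding num den by (rule has_derivative_divide'[OF lin lin]) (use pos in \<open>simp add: den\<close>)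
    moreover have "(\<lambda>h. ((\<Sum>k<n. h $ \<iota> k * v k $ e i) * flux E (fr (?u x)) ?w - fr (?u x) $ e i * (\<Sum>k<n. h $ \<iota> k * flux E (v k) ?w))
          / (flux E (fr (?u x)) ?w * flux E (fr (?u x)) ?w)) = (\<lambda>h. \<Sum>k\<in>{..<n}. D (?u x) i k * h $ \<iota> k)"
    proof
      fix h :: "real^'a edge bit0"
      let ?F = "flux E (fr (?u x)) ?w" and ?N = "fr (?u x) $ e i"
      have p: "env (?u x) (e i) = ?N / ?F" using i by (simp add: env_def env_of_def)
      have "((\<Sum>k<n. h $ \<iota> k * v k $ e i) * ?F - ?N * (\<Sum>k<n. h $ \<iota> k * flux E (v k) ?w)) / (?F * ?F) =
          (\<Sum>k<n. h $ \<iota> k * v k $ e i) / ?F - (?N / ?F) * (\<Sum>k<n. h $ \<iota> k * flux E (v k) ?w) / ?F"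
        using pos by (simp add: diff_divide_distrib)
      also have "\<dots> = (\<Sum>k<n. (v k $ e i - ?N / ?F * flux E (v k) ?w) / ?F * h $ \<iota> k)"
        by (simp add: sum_divide_distrib sum_distrib_left flip: sum_subtractf)
          (intro sum.cong refl, simp add: diff_divide_distrib algebra_simps)
      finally show "((\<Sum>k<n. h $ \<iota> k * v k $ e i) * ?F - ?N * (\<Sum>k<n. h $ \<iota> k * flux E (v k) ?w)) / (?F * ?F) =
         (\<Sum>k\<in>{..<n}. D (?u x) i k * h $ \<iota> k)"
        by (simp only: D_def p)
    qed
    moreover have "(\<lambda>x. coords (?u x) (e i)) = (\<lambda>x. fr (?u x) $ e i / flux E (fr (?u x)) ?w)"
      using i by (auto simp: env_def env_of_def)
    ultimately show "((\<lambda>x. coords (?u x) (e i)) has_derivative (\<lambda>h. \<Sum>k\<in>{..<n}. D (?u x) i k * h $ \<iota> k)) (at x)"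
      by simp
  next
    fix u assume u: "u \<in> S"
    have "(\<Sum>\<pi> | \<pi> permutes {..<n}. of_int (sign \<pi>) * (\<Prod>i\<in>{..<n}. D u i (\<pi> i))) = leibniz n (D u)"
      by (simp add: leibniz_def)
    also have "\<dots> = det (mat 1 - P_U E (env u)) * orient / (\<Prod>i<n. flux E (fr u) (the (fst (e i))))"
      unfolding D_def leibniz_scale_rows by (subst jacobian) (use env_sum[OF env_in[OF u]] in auto)
    finally show "\<bar>\<Sum>\<pi> | \<pi> permutes {..<n}. of_int (sign \<pi>) * (\<Prod>i\<in>{..<n}. D u i (\<pi> i))\<bar> = J u"
      by (simp add: J_def)
  qed simp
qed

text \<open>Written as a push-forward from the chart, the Dirichlet law transfers integrability and
  integrals together.\<close>

lemma dirichlet_env_chart: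
  "dirichlet_env E \<alpha> t = distr (density (PiL {..<n}) (\<lambda>u. ennreal (indicator S u * (J u * dirichlet_density E \<alpha> (env u)))))
     (PiM E (\<lambda>_. borel)) env"
proof (rule measure_eqI)
  fix A assume "A \<in> sets (dirichlet_env E \<alpha> t)"
  then have A[measurable]: "A \<in> sets (PiM E (\<lambda>_. borel))" by simp
  have m[measurable]: "complete_env E t \<in> PiL (E - T) \<rightarrow>\<^sub>M PiM E (\<lambda>_. borel)"
    using complete_env_measurable[OF selector_t] by (simp add: T_range)
  let ?g = "\<lambda>q. ennreal (dirichlet_density E \<alpha> (complete_env E t q)) * indicator A (complete_env E t q)"
  have g: "?g \<in> borel_measurable (PiL (E - T))" by measurable
  have J: "0 \<le> J u" for u by (simp add: J_def)
  have "emeasure (dirichlet_env E \<alpha> t) A = (\<integral>\<^sup>+q. ?g q \<partial>PiL (E - T))"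
    using emeasure_dirichlet_env[OF selector_t A] by (simp add: T_range)
  also have "\<dots> = (\<integral>\<^sup>+q. indicator (coords ` S) q * ?g q \<partial>PiL (E - T))"
    by (intro nn_integral_cong) (auto simp: coords_image dirichlet_density_def indicator_def)
  also have "\<dots> = (\<integral>\<^sup>+u. indicator S u * ennreal (J u) * ?g (coords u) \<partial>PiL {..<n})"
    by (rule nn_integral_chart[OF g, symmetric])
  also have "\<dots> = (\<integral>\<^sup>+u. ennreal (indicator S u * (J u * dirichlet_density E \<alpha> (env u))) *
      indicator (env -` A \<inter> space (PiL {..<n})) u \<partial>PiL {..<n})"
    by (intro nn_integral_cong) (auto simp: indicator_def complete_coords ennreal_mult' J)
  also have "\<dots> = emeasure (distr (density (PiL {..<n}) (\<lambda>u. ennreal (indicator S u * (J u * dirichlet_density E \<alpha> (env u)))))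
     (PiM E (\<lambda>_. borel)) env) A"
    by (rule emeasure_distr_density[symmetric]) measurable
  finally show "emeasure (dirichlet_env E \<alpha> t) A = emeasure (distr (density (PiL {..<n})
     (\<lambda>u. ennreal (indicator S u * (J u * dirichlet_density E \<alpha> (env u))))) (PiM E (\<lambda>_. borel)) env) A" .
qed simp

text \<open>At each vertex the exponent \<open>- beta E \<alpha> x\<close> of the vertex edge
  divides every factor z_e to the power \<alpha>_e by the same power of the flux.\<close>

lemma prod_weights:
  assumes u: "u \<in> S"
  shows "(\<Prod>f\<in>hat_lift E. hat_coord E (fr u) f powr hat_weight E \<alpha> f) = (\<Prod>f\<in>E. env u f powr \<alpha> f)"
proof -
  have z: "fr u \<in> flow_domain E x0" using u by (simp add: S_iff)
  note F = flux_pos[OF z]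
  have zpos: "0 < fr u $ f" if "f \<in> E" for f using z that by (simp add: flow_domain_def)
  have "(\<Prod>f\<in>E. env u f powr \<alpha> f) = (\<Prod>x\<in>UNIV. \<Prod>f\<in>out_edges E x. env u f powr \<alpha> f)"
    by (rule prod_out)
  also have "\<dots> = (\<Prod>x\<in>UNIV. (\<Prod>f\<in>out_edges E x. (fr u $ f) powr \<alpha> f) * flux E (fr u) x powr - beta E \<alpha> x)"
  proof (rule prod.cong[OF refl])
    fix x
    have "(\<Prod>f\<in>out_edges E x. env u f powr \<alpha> f) =
        (\<Prod>f\<in>out_edges E x. (fr u $ f) powr \<alpha> f / flux E (fr u) x powr \<alpha> f)"
      using zpos F by (intro prod.cong) (auto simp: env_def env_of_def out_edges_def powr_divide less_imp_le)
    also have "\<dots> = (\<Prod>f\<in>out_edges E x. (fr u $ f) powr \<alpha> f) / (\<Prod>f\<in>out_edges E x. flux E (fr u) x powr \<alpha> f)"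
      by (rule prod_dividef)
    also have "(\<Prod>f\<in>out_edges E x. flux E (fr u) x powr \<alpha> f) = flux E (fr u) x powr beta E \<alpha> x"
      unfolding beta_def using F[of x] by (intro powr_sum[symmetric]) auto
    finally show "(\<Prod>f\<in>out_edges E x. env u f powr \<alpha> f) =
        (\<Prod>f\<in>out_edges E x. (fr u $ f) powr \<alpha> f) * flux E (fr u) x powr - beta E \<alpha> x"
      by (simp add: powr_minus_divide)
  qed
  also have "\<dots> = (\<Prod>f\<in>E. (fr u $ f) powr \<alpha> f) * (\<Prod>x\<in>UNIV. flux E (fr u) x powr - beta E \<alpha> x)"
    by (simp add: prod.distrib prod_out)
  finally show ?thesis
    by (simp add: prod_hat_lift hat_coord_def hat_weight_def flux_def)
qed

text \<open>\<open>J\<close> contributes det (I - P) * orient / Z, the density C Q / (PD PT) and the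
  functional PT / det (I - P). What is left is C Q orient / (Z PD), and Z PD is the product of the
  z_e outside the tree. Positivity of \<open>orient\<close> removes the absolute value in
  \<open>J\<close>.\<close>

lemma integrand_eq:
  assumes u: "u \<in> S" and pos: "0 < orient"
  shows "(J u * dirichlet_density E \<alpha> (env u)) *\<^sub>R env_functional E x0 T l (env u) =
    of_real (C_const E \<alpha>) * hyp_integrand E \<alpha> l v es (fr u)"
proof -
  have z: "fr u \<in> flow_domain E x0" using u by (simp add: S_iff)
  have env: "env u \<in> environments E" using env_in[OF u] .
  note F = flux_pos[OF z]
  have zpos: "0 < fr u $ f" if "f \<in> E" for f using z that by (simp add: flow_domain_def)
  have p0: "0 < env u f" if "f \<in> E" for f using env_pos[OF env that] by simp
  define Q where "Q = (\<Prod>f\<in>E. env u f powr \<alpha> f)"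
  define d where "d = det (mat 1 - P_U E (env u))"
  define Z where "Z = (\<Prod>f\<in>E - T. flux E (fr u) (the (fst f)))"
  define PT where "PT = (\<Prod>f\<in>T. env u f)"
  define PD where "PD = (\<Prod>f\<in>E - T. env u f)"
  have d: "0 < d" using det_pos[OF env] by (simp add: d_def)
  have Z: "0 < Z" unfolding Z_def by (intro prod_pos) (auto intro: F)
  have PT: "0 < PT" unfolding PT_def by (intro prod_pos) (use tree p0 in auto)
  have PD: "0 < PD" unfolding PD_def by (intro prod_pos) (use p0 in auto)
  have "(\<Prod>i<n. flux E (fr u) (the (fst (e i)))) = Z"
    unfolding Z_def by (rule prod_e[symmetric])
  then have J: "J u = d * orient / Z"
    using d Z pos by (simp add: J_def d_def[symmetric])
  have "(\<Prod>f\<in>E. env u f powr (\<alpha> f - 1)) = (\<Prod>f\<in>E. env u f powr \<alpha> f / env u f)"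
  proof (rule prod.cong[OF refl])
    fix f assume "f \<in> E"
    then show "env u f powr (\<alpha> f - 1) = env u f powr \<alpha> f / env u f"
      using p0[of f] by (simp add: powr_diff)
  qed
  also have "\<dots> = Q / (\<Prod>f\<in>E. env u f)" by (simp add: prod_dividef Q_def)
  also have "(\<Prod>f\<in>E. env u f) = PD * PT"
    unfolding PD_def PT_def using tree by (intro prod.subset_diff) auto
  finally have dens: "dirichlet_density E \<alpha> (env u) = C_const E \<alpha> * (Q / (PD * PT))"
    using env by (simp add: dirichlet_density_def)
  have "(\<Prod>f\<in>E - T. fr u $ f) = Z * PD"
    unfolding Z_def PD_def prod.distrib[symmetric]
  proof (rule prod.cong[OF refl])
    fix f assume "f \<in> E - T"
    then show "fr u $ f = flux E (fr u) (the (fst f)) * env u f"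
      using F[of "the (fst f)"] by (simp add: env_def env_of_def)
  qed
  then have log: "log_form E es (fr u) v = orient / (Z * PD)" by (simp add: log_form_eq)
  have cr: "(\<Sum>f\<in>E. l f * complex_of_real (crossings E x0 (env u) f)) = (\<Sum>f\<in>E. l f * complex_of_real (fr u $ f))"
    using env_of_flow(2)[OF z] by (intro sum.cong) (auto simp: env_def)
  have "J u * dirichlet_density E \<alpha> (env u) * (PT / d) = C_const E \<alpha> * (Q * (orient / (Z * PD)))"
    unfolding J dens using d Z PT PD by (simp add: field_simps)
  then have "complex_of_real (J u * dirichlet_density E \<alpha> (env u)) * complex_of_real (PT / d) =
      complex_of_real (C_const E \<alpha>) * complex_of_real (Q * (orient / (Z * PD)))"
    by (simp only: of_real_mult[symmetric])
  then show ?thesis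
    unfolding env_functional_def hyp_integrand_def cr prod_weights[OF u] log Q_def[symmetric] d_def[symmetric]
      PT_def[symmetric] scaleR_conv_of_real
    by (metis (no_types, lifting) mult.assoc mult.left_commute)
qed

text \<open>Almost everywhere the functional is bounded by 1 on a finite measure: positive crossing
  numbers and positive real parts bound the exponential, and \<open>prod_tree_le_det\<close> bounds
  the quotient.\<close>

lemma env_functional_integrable:
  assumes \<alpha>: "\<forall>f\<in>E. 0 < \<alpha> f" and l: "\<forall>f\<in>E. 0 < Re (l f)"
  shows "integrable (dirichlet_env E \<alpha> t) (env_functional E x0 T l)"
proof -
  interpret finite_measure "dirichlet_env E \<alpha> t"
    by (rule finite_measureI) (use emeasure_dirichlet_env_finite[OF selector_t \<alpha>] in auto)
  have "AE p in dirichlet_env E \<alpha> t. norm (env_functional E x0 T l p) \<le> 1"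
    using AE_dirichlet_env[OF selector_t]
  proof (rule AE_mp, intro AE_I2 impI)
    fix p assume p: "p \<in> environments E"
    let ?z = "\<chi> f. if f \<in> E then crossings E x0 p f else 0"
    have z: "?z \<in> flow_domain E x0" using crossings_flow(1)[OF p] .
    have cr: "0 < crossings E x0 p f" if "f \<in> E" for f
      using z that by (auto simp: flow_domain_def)
    have "norm (exp (- (\<Sum>f\<in>E. l f * complex_of_real (crossings E x0 p f)))) =
        exp (- (\<Sum>f\<in>E. Re (l f) * crossings E x0 p f))"
      by (simp add: norm_exp_eq_Re)
    also have "\<dots> \<le> 1"
    proof -
      have "0 \<le> (\<Sum>f\<in>E. Re (l f) * crossings E x0 p f)"
        using cr l by (intro sum_nonneg mult_nonneg_nonneg less_imp_le) auto
      then show ?thesis by simp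
    qed
    finally have 1: "norm (exp (- (\<Sum>f\<in>E. l f * complex_of_real (crossings E x0 p f)))) \<le> 1" .
    have "0 \<le> (\<Prod>f\<in>T. p f) / det (mat 1 - P_U E p)" "(\<Prod>f\<in>T. p f) / det (mat 1 - P_U E p) \<le> 1"
      using prod_tree_pos[OF p] prod_tree_le_det[OF p] det_pos[OF p] by auto
    then have "norm (complex_of_real ((\<Prod>f\<in>T. p f) / det (mat 1 - P_U E p))) \<le> 1"
      by (simp only: norm_of_real abs_of_nonneg)
    from mult_le_one[OF 1 norm_ge_zero this] show "norm (env_functional E x0 T l p) \<le> 1"
      by (simp only: env_functional_def norm_mult)
  qed
  then show ?thesis
    by (rule integrable_const_bound)
      (use env_functional_measurable[OF tree no_None] in simp)
qed

lemma hypergeometric_integral: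
  assumes \<alpha>: "\<forall>f\<in>E. 0 < \<alpha> f" and l: "\<forall>f\<in>E. 0 < Re (l f)" and pos: "0 < orient"
  shows "hyp_integrable E x0 \<alpha> l a v es"
    and "of_real (C_const E \<alpha>) * hyp_integral E x0 \<alpha> l a v es = (\<integral>p. env_functional E x0 T l p \<partial>dirichlet_env E \<alpha> t)"
proof -
  let ?w = "\<lambda>u. indicator S u * (J u * dirichlet_density E \<alpha> (env u))"
  let ?h = "\<lambda>u. indicator S u *\<^sub>R hyp_integrand E \<alpha> l v es (fr u)"
  let ?F = "env_functional E x0 T l"
  have C: "0 < C_const E \<alpha>" using C_const_pos[OF selector_t \<alpha>] .
  have F[measurable]: "?F \<in> borel_measurable (PiM E (\<lambda>_. borel))"
    by (rule env_functional_measurable[OF tree no_None])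
  have Fe[measurable]: "(\<lambda>u. ?F (env u)) \<in> borel_measurable (PiL {..<n})"
    by (rule measurable_compose[OF env_measurable F])
  have w[measurable]: "?w \<in> borel_measurable (PiL {..<n})" by measurable
  have dnn: "0 \<le> dirichlet_density E \<alpha> p" for p
    using C by (auto simp: dirichlet_density_def intro!: mult_nonneg_nonneg prod_nonneg)
  have wnn: "0 \<le> ?w u" for u using dnn by (simp add: J_def)
  have eq: "?w u *\<^sub>R ?F (env u) = of_real (C_const E \<alpha>) * ?h u" for u
    using integrand_eq[OF _ pos, of u \<alpha> l] by (cases "u \<in> S") simp_all
  have env': "env \<in> density (PiL {..<n}) (\<lambda>u. ennreal (?w u)) \<rightarrow>\<^sub>M PiM E (\<lambda>_. borel)" by simp
  have "integrable (density (PiL {..<n}) (\<lambda>u. ennreal (?w u))) (\<lambda>u. ?F (env u))"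
    using env_functional_integrable[OF \<alpha> l]
    unfolding dirichlet_env_chart by (subst (asm) integrable_distr_eq[OF env' F])
  then have "integrable (PiL {..<n}) (\<lambda>u. ?w u *\<^sub>R ?F (env u))"
    by (subst (asm) integrable_density) (use wnn in auto)
  then have "integrable (PiL {..<n}) (\<lambda>u. of_real (C_const E \<alpha>) * ?h u)"
    unfolding eq .
  \<comment> \<open>The factor \<open>C_const E \<alpha>\<close> is positive, so it can be divided
    out to reach the integrand itself.\<close>
  then have "integrable (PiL {..<n}) (\<lambda>u. inverse (of_real (C_const E \<alpha>)) * (of_real (C_const E \<alpha>) * ?h u))"
    by (rule integrable_mult_right)
  then have int: "integrable (PiL {..<n}) ?h"
    using C by (simp only: mult.assoc[symmetric]) simp
  then show "hyp_integrable E x0 \<alpha> l a v es"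
    by (simp add: hyp_integrable_def set_integrable_def S_def)
  have "(\<integral>p. ?F p \<partial>dirichlet_env E \<alpha> t) = (\<integral>u. ?F (env u) \<partial>density (PiL {..<n}) (\<lambda>u. ennreal (?w u)))"
    unfolding dirichlet_env_chart by (rule integral_distr[OF env' F])
  also have "\<dots> = (\<integral>u. ?w u *\<^sub>R ?F (env u) \<partial>PiL {..<n})"
    by (rule integral_density) (use wnn in auto)
  also have "\<dots> = of_real (C_const E \<alpha>) * (\<integral>u. ?h u \<partial>PiL {..<n})"
    unfolding eq by (rule integral_mult_right_zero)
  finally show "of_real (C_const E \<alpha>) * hyp_integral E x0 \<alpha> l a v es = (\<integral>p. ?F p \<partial>dirichlet_env E \<alpha> t)"
    by (simp add: hyp_integral_def set_lebesgue_integral_def S_def)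
qed

text \<open>On an empty domain every list would be positively oriented vacuously; a point is needed
  to read off the sign of \<open>orient\<close>.\<close>

lemma flow_domain_nonempty: "flow_domain E x0 \<noteq> {}"
proof -
  define p where "p = (\<lambda>f\<in>E. 1 / real (card (out_edges E (the (fst f)))))"
  have card: "1 \<le> card (out_edges E x)" for x
    using t_out[of x] by (auto simp: Suc_le_eq card_gt_0_iff)
  have "(\<Sum>f\<in>out_edges E x. p f) = 1" for x
    by (rule trans[OF sum.cong sum_uniform]) (auto simp: p_def out_edges_def)
  then have "p \<in> environments E"
    using card by (auto simp: environments_def p_def Suc_le_eq)
  from crossings_flow(1)[OF this] show ?thesis by auto
qed

lemma positively_oriented_iff: "positively_oriented E x0 v es \<longleftrightarrow> 0 < orient"
  using flow_domain_nonempty prod_flow_pos unfolding positively_oriented_def log_form_eq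
  by (auto simp: zero_less_divide_iff) (meson less_asym)

end

theorem theorem2p2:
  fixes E T :: "'u::finite edge set" and x0 :: 'u
    and \<alpha> :: "'u edge \<Rightarrow> real" and l :: "'u edge \<Rightarrow> complex"
    and r :: "'u \<Rightarrow> 'u edge"
    and a :: "real^'u edge" and v :: "nat \<Rightarrow> real^'u edge" and es :: "'u hat_edge list"
  assumes "cemetery_graph E x0"
    and "\<forall>e\<in>E. 0 < \<alpha> e"
    and "directed_spanning_tree E T"
    and "\<forall>e\<in>E. 0 < Re (l e)"
    and "\<forall>x. r x \<in> out_edges E x"
    and "affine_frame E x0 a v"
    and "distinct es" and "set es = hat_lift E - hat_lift T"
  shows "directed_spanning_tree (hat_lift E) (hat_lift T) \<and>
    (positively_oriented E x0 v es \<or> negatively_oriented E x0 v es) \<and>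
    (\<forall>p\<in>environments E. invertible (mat 1 - P_U E p)) \<and>
    integrable (dirichlet_env E \<alpha> r) (env_functional E x0 T l) \<and>
    (positively_oriented E x0 v es \<longrightarrow>
       hyp_integrable E x0 \<alpha> l a v es \<and>
       complex_of_real (C_const E \<alpha>) * hyp_integral E x0 \<alpha> l a v es =
         (\<integral>p. env_functional E x0 T l p \<partial>dirichlet_env E \<alpha> r))"
proof -
  have no: "(None, w) \<notin> E" "(w, w) \<notin> E" for w
    using assms(1) by (auto simp: cemetery_graph_def)
  obtain s d where T: "T = functional_edges s" and d: "is_depth s d"
    using directed_spanning_tree_functional[OF assms(3) no] by blast
  have sub: "functional_edges s \<subseteq> E"
    using assms(3) T by (simp add: directed_spanning_tree_def spanning_tree_def)
  have "killed_graph E x0 s d" by (rule killed_graph.intro[OF assms(1) d sub])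
  moreover have "framed_graph_axioms E x0 s a v es"
    by (rule framed_graph_axioms.intro[OF assms(6,7)]) (simp only: assms(8) T)
  ultimately interpret framed_graph E x0 s d a v es by (rule framed_graph.intro)
  have r: "selector E r" using assms(5) by (simp add: selector_def)
  \<comment> \<open>The given omitted edges are replaced by the tree edges, for which the chart was
    built.\<close>
  have D: "dirichlet_env E \<alpha> r = dirichlet_env E \<alpha> (\<lambda>x. (Some x, s x))"
    by (rule dirichlet_env_indep[OF r selector_t])
  show ?thesis
    unfolding T D
    by (intro conjI impI ballI directed_spanning_tree_hat_lift[OF d sub] oriented invertible_env
        env_functional_integrable[OF assms(2,4)] hypergeometric_integral[OF assms(2,4)])
      (simp_all only: positively_oriented_iff)
qed

end
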